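(* Let $G$ be a discrete group, let $(FS, d_{FS})$ be a metric space with an action of $G$ by isometries, and let $\Phi \colon FS \times \mathbb{R} \to FS$ be a $G$-equivariant flow. Assume that $FS \setminus FS^{\mathbb{R}}$ is locally connected, locally compact and finite dimensional (covering dimension), that the action of $G$ on $FS \setminus FS^{\mathbb{R}}$ is proper, and that the flow is uniformly continuous, i.e. for all $\alpha > 0$ and all $\epsilon > 0$ there exists $\delta > 0$ such that for all $z, z' \in FS$ and all $\tau \in [-\alpha,\alpha]$, $d_{FS}(z,z') \leq \delta$ implies $d_{FS}(\Phi_\tau(z), \Phi_\tau(z')) \leq \epsilon$. Then there exists a number $M \in \mathbb{N}$ such that for any $\alpha > 0$ there is a $\gamma > 0$ such that for any compact $K \subseteq FS_{>\gamma}$ there is a collection $\mathcal{V}$ of open $\mathcal{V}cyc$-subsets of $FS$ satisfying: 1. $\mathcal{V}$ is $G$-invariant, i.e. for all $g \in G$ and all $V \in \mathcal{V}$, the set $gV$ is also in $\mathcal{V}$; 2. $\dim \mathcal{V} \leq M$; 3. $G \backslash \mathcal{V}$ is finite; 4. for any $z \in GK$ there is some $V \in \mathcal{V}$ with $\Phi_{[-\alpha,\alpha]}(z) \subseteq V$.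
   Context: $\Phi_\tau(z) := \Phi(z,\tau)$ and $\Phi_{[-\alpha,\alpha]}(z) := \{\Phi_\tau(z) : \tau \in [-\alpha,\alpha]\}$. $FS^{\mathbb{R}}$ denotes the set of points of $FS$ that are fixed by the flow (stationary points); it is $G$-invariant because the flow is $G$-equivariant. The $G$-period of $z \in FS$ is $\mathrm{per}^G_\Phi(z) := \inf\{\tau \in (0,\infty) : \exists g \in G \text{ with } \Phi_\tau(z) = gz\}$, where $\inf \emptyset = \infty$. For $\gamma \geq 0$, $FS_{>\gamma} := \{z \in FS : \mathrm{per}^G_\Phi(z) > \gamma\}$. A family of subgroups of $G$ is a set of subgroups closed under conjugation and taking subgroups. $\mathcal{V}cyc$ is the family of virtually cyclic subgroups of $G$ (including the finite ones). For a family $\mathcal{F}$, an $\mathcal{F}$-subset of $FS$ is a subset $U \subseteq FS$ such that (a) for all $g \in G$, $gU \cap U \neq \emptyset$ implies $gU = U$, and (b) the stabilizer $G_U = \{g \in G : gU = U\}$ belongs to $\mathcal{F}$. A collection $\mathcal{V}$ of subsets has $\dim \mathcal{V} \leq M$ if every point lies in at most $M+1$ members of $\mathcal{V}$. *)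

theory Defs
  imports
    "HOL-Analysis.Analysis"
    "HOL-Algebra.Group_Action"
    "HOL-Algebra.Elementary_Groups"
begin

text \<open>Throughout, the flow space is the universe of a type of class \<open>metric_space\<close>, and a
  group action on it is given by \<^term>\<open>act\<close> with \<^term>\<open>group_action G UNIV act\<close>.\<close>

definition is_flow :: "('a::metric_space \<times> real \<Rightarrow> 'a) \<Rightarrow> bool" where
  "is_flow \<Phi> \<longleftrightarrow>
     continuous_on UNIV \<Phi> \<and>
     (\<forall>z. \<Phi> (z, 0) = z) \<and>
     (\<forall>z s t. \<Phi> (z, s + t) = \<Phi> (\<Phi> (z, s), t))"

definition flow_stationary :: "('a \<times> real \<Rightarrow> 'a) \<Rightarrow> 'a set" where
  "flow_stationary \<Phi> = {z. \<forall>t. \<Phi> (z, t) = z}"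

definition flow_segment :: "('a \<times> real \<Rightarrow> 'a) \<Rightarrow> real \<Rightarrow> 'a \<Rightarrow> 'a set" where
  "flow_segment \<Phi> \<alpha> z = (\<lambda>t. \<Phi> (z, t)) ` {-\<alpha>..\<alpha>}"

definition flow_uniformly_continuous :: "('a::metric_space \<times> real \<Rightarrow> 'a) \<Rightarrow> bool" where
  "flow_uniformly_continuous \<Phi> \<longleftrightarrow>
     (\<forall>\<alpha>>0. \<forall>\<epsilon>>0. \<exists>\<delta>>0. \<forall>z z'. \<forall>t\<in>{-\<alpha>..\<alpha>}.
        dist z z' \<le> \<delta> \<longrightarrow> dist (\<Phi> (z, t)) (\<Phi> (z', t)) \<le> \<epsilon>)"

text \<open>The infimum is taken in \<^typ>\<open>ereal\<close>, so that the period is \<open>\<infinity>\<close> if there is no such time.\<close>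
definition G_period ::
    "('g, 'b) monoid_scheme \<Rightarrow> ('g \<Rightarrow> 'a \<Rightarrow> 'a) \<Rightarrow> ('a \<times> real \<Rightarrow> 'a) \<Rightarrow> 'a \<Rightarrow> ereal" where
  "G_period G act \<Phi> z = Inf (ereal ` {t. 0 < t \<and> (\<exists>g\<in>carrier G. \<Phi> (z, t) = act g z)})"

definition period_gt ::
    "('g, 'b) monoid_scheme \<Rightarrow> ('g \<Rightarrow> 'a \<Rightarrow> 'a) \<Rightarrow> ('a \<times> real \<Rightarrow> 'a) \<Rightarrow> real \<Rightarrow> 'a set" where
  "period_gt G act \<Phi> \<gamma> = {z. G_period G act \<Phi> z > ereal \<gamma>}"

text \<open>Properness for an action of a discrete group; only used for \<open>G\<close>-invariant \<open>X\<close>.\<close>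
definition proper_action_on ::
    "('g, 'b) monoid_scheme \<Rightarrow> ('g \<Rightarrow> 'a::topological_space \<Rightarrow> 'a) \<Rightarrow> 'a set \<Rightarrow> bool" where
  "proper_action_on G act X \<longleftrightarrow>
     (\<forall>x\<in>X. \<exists>U. openin (top_of_set X) U \<and> x \<in> U \<and>
        finite {g \<in> carrier G. act g ` U \<inter> U \<noteq> {}})"

text \<open>\<open>dim \<V> \<le> n\<close>; finiteness is stated separately because infinite sets have \<^const>\<open>card\<close> zero.\<close>
definition collection_dim_le :: "'a set set \<Rightarrow> nat \<Rightarrow> bool" where
  "collection_dim_le \<V> n \<longleftrightarrow> (\<forall>x. finite {V \<in> \<V>. x \<in> V} \<and> card {V \<in> \<V>. x \<in> V} \<le> n + 1)"

text \<open>Lebesgue covering dimension of the subspace \<open>X\<close>, with arbitrary open covers. (The library's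
  \<^const>\<open>dimension_le\<close> is the small inductive dimension, which can differ from it for
  non-separable metric spaces.)\<close>
definition covering_dim_le :: "'a::topological_space set \<Rightarrow> nat \<Rightarrow> bool" where
  "covering_dim_le X n \<longleftrightarrow>
     (\<forall>\<U>. (\<forall>U\<in>\<U>. openin (top_of_set X) U) \<and> \<Union>\<U> = X \<longrightarrow>
        (\<exists>\<W>. (\<forall>W\<in>\<W>. openin (top_of_set X) W) \<and> \<Union>\<W> = X \<and>
             (\<forall>W\<in>\<W>. \<exists>U\<in>\<U>. W \<subseteq> U) \<and> collection_dim_le \<W> n))"

text \<open>Subgroups having a cyclic subgroup of finite index; the cyclic subgroup may be trivial, so
  finite subgroups are included.\<close>
definition virtually_cyclic_subgroups :: "('g, 'b) monoid_scheme \<Rightarrow> 'g set set" where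
  "virtually_cyclic_subgroups G =
     {H. subgroup H G \<and>
         (\<exists>C. subgroup C (G\<lparr>carrier := H\<rparr>) \<and> cyclic_group (G\<lparr>carrier := C\<rparr>) \<and>
              finite (rcosets\<^bsub>G\<lparr>carrier := H\<rparr>\<^esub> C))}"

abbreviation set_act :: "('g \<Rightarrow> 'a \<Rightarrow> 'a) \<Rightarrow> 'g \<Rightarrow> 'a set \<Rightarrow> 'a set" where
  "set_act act \<equiv> \<lambda>g U. act g ` U"

definition family_subset ::
    "('g, 'b) monoid_scheme \<Rightarrow> ('g \<Rightarrow> 'a \<Rightarrow> 'a) \<Rightarrow> 'g set set \<Rightarrow> 'a set \<Rightarrow> bool" where
  "family_subset G act \<F> U \<longleftrightarrow>
     (\<forall>g\<in>carrier G. act g ` U \<inter> U \<noteq> {} \<longrightarrow> act g ` U = U) \<and>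
     stabilizer G (set_act act) U \<in> \<F>"

end

theory Submission
  imports Defs
begin

text \<open>A local cross section (slice) exists through every point of large \<open>G\<close>-period, and orbits return to it
  only after a long time. Finitely many slices meet all orbits near \<open>K\<close>. Each slice carries a weight, and a
  greedy procedure marks points on the slices: a point of the \<open>i\<close>-th slice is marked if its weight is
  positive and no mark of an earlier slice is within a certain time, which also depends on the weight.
  Marks are sparse and relatively dense along orbits near \<open>K\<close>, so the flow tubes around marks and the flow
  tubes between marks give two families of disjoint sets, which contain long segments. They are only
  neighbourhoods of segments near which the marks depend continuously on the orbit. This fails where a weight
  takes one of finitely many exceptional values. With \<open>n + 1\<close> independent choices of the weights
  in general position, where \<open>n\<close> is the covering dimension, every orbit segment avoids the exceptional values
  for at least one choice. Hence \<open>2 (n + 1)\<close> disjoint families suffice.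

  General position uses that a compact set of covering dimension \<open>n\<close> is a union of \<open>n + 1\<close> sets each of which is
  a disjoint union of small compact sets: the \<open>r\<close>-th weight can be perturbed to be a nonexceptional constant on
  each of the small sets of colour \<open>r\<close>.\<close>

section \<open>Covering dimension and colourings\<close>

text \<open>An exceptional value is a single equation on the orbit, so failure of all
  \<open>n + 1\<close> choices on one orbit segment amounts to \<open>n + 1\<close> equations on a
  set of dimension \<open>n\<close>, which a small perturbation makes unsolvable. The number of
  slices depends on \<open>K\<close>, whereas the dimension bound must not: the slices enter only
  the length of the time window on which general position is demanded, and the number of families is
  governed by \<open>n\<close>. Stabilizers come out finite, hence virtually cyclic, because each
  tube lies over one translate of a compact piece of a slice that meets only finitely many of its
  translates. Blocking radii lie between \<open>R - 2\<close> and \<open>R + 2\<close>. The first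
  bound has to be at least the width \<open>8 * \<alpha>\<close> of a tube around a mark, and twice
  the second is the time for which no orbit may return to a slice. This leads to
  \<open>R = 8 * \<alpha> + 3\<close> and to the period bound
  \<open>16 * \<alpha> + 10\<close>.\<close>

lemma infdist_lessE:
  assumes "A \<noteq> {}" "infdist x A < e"
  obtains a where "a \<in> A" "dist x a < e"
  using assms by (auto simp: infdist_notempty cINF_less_iff)

text \<open>With a partition of unity \<open>\<phi>\<close> subordinate to a refinement of order \<open>n + 1\<close>, the sets on which all members
  of \<open>S\<close> dominate all members outside \<open>S\<close> are disjoint for distinct \<open>S\<close> of equal cardinality.\<close>
lemma coloured_refinement:
  fixes A X :: "'a::metric_space set"
  assumes dim: "covering_dim_le X n" and X: "open X" and A: "compact A" "A \<subseteq> X"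
    and cov: "\<And>U. U \<in> \<O> \<Longrightarrow> open U" "A \<subseteq> \<Union>\<O>"
  shows "\<exists>\<P>::nat \<Rightarrow> 'a set set.
    (\<forall>r\<le>n. finite (\<P> r) \<and> pairwise disjnt (\<P> r) \<and>
       (\<forall>P\<in>\<P> r. compact P \<and> P \<subseteq> A \<and> (\<exists>U\<in>\<O>. P \<subseteq> U))) \<and>
    A \<subseteq> (\<Union>r\<le>n. \<Union>(\<P> r))"
proof -
  have clA: "closed A"
    using A compact_imp_closed by blast
  \<comment> \<open>Covering dimension concerns covers of all of \<open>X\<close>, so the complement
    of \<open>A\<close> joins the cover.\<close>
  define \<U> where "\<U> = insert (X - A) ((\<lambda>U. U \<inter> X) ` \<O>)"
  have op\<U>: "\<forall>U\<in>\<U>. openin (top_of_set X) U"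
  proof
    fix U assume "U \<in> \<U>"
    then have "open U" "U \<subseteq> X"
      using X cov(1) clA by (auto simp: \<U>_def)
    then show "openin (top_of_set X) U"
      using X by (simp add: openin_open_eq)
  qed
  have un\<U>: "\<Union>\<U> = X"
    using A cov(2) by (auto simp: \<U>_def)
  obtain \<W> where W: "\<forall>W\<in>\<W>. openin (top_of_set X) W" "\<Union>\<W> = X"
      "\<forall>W\<in>\<W>. \<exists>U\<in>\<U>. W \<subseteq> U" "collection_dim_le \<W> n"
    using dim[unfolded covering_dim_le_def, THEN spec, THEN mp, OF conjI[OF op\<U> un\<U>]]
    by (elim exE conjE)
  have opW: "open W" if "W \<in> \<W>" for W
    using W(1) that openin_open_eq[OF X] by blast
  obtain \<W>' where W': "\<W>' \<subseteq> \<W>" "finite \<W>'" "A \<subseteq> \<Union>\<W>'"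
  proof (rule compactE[OF A(1), of \<W>])
    show "A \<subseteq> \<Union>\<W>" using A(2) W(2) by simp
  qed (use opW in auto)
  \<comment> \<open>The case distinction is due to \<open>infdist\<close> being 0 for the empty set.
    Only comparisons between values matter below, so the functions are not normalised to sum
    1.\<close>
  define \<phi> where "\<phi> W x = (if A \<subseteq> W then 1 else infdist x (A - W))" for W x
  have cont: "continuous_on UNIV (\<phi> W)" for W
    unfolding \<phi>_def by (cases "A \<subseteq> W") (auto intro!: continuous_intros)
  have pos: "0 < \<phi> W x \<longleftrightarrow> x \<in> W" if "W \<in> \<W>'" "x \<in> A" for W x
  proof (cases "A \<subseteq> W")
    case False
    have "closed (A - W)"
      using clA opW W'(1) that by (simp add: closed_Diff subset_iff)
    then have "x \<in> A - W \<longleftrightarrow> infdist x (A - W) = 0"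
      using False by (intro in_closed_iff_infdist_zero) auto
    then show ?thesis
      using that False infdist_nonneg[of x "A - W"] by (auto simp: \<phi>_def less_le)
  qed (use that in \<open>auto simp: \<phi>_def\<close>)
  define Q where "Q S = (\<Inter>W\<in>S. {x. 0 < \<phi> W x}) \<inter>
      (\<Inter>W\<in>S. \<Inter>W'\<in>\<W>'-S. {x. \<phi> W' x < \<phi> W x})" for S
  have opQ: "open (Q S)" if "S \<subseteq> \<W>'" for S
    unfolding Q_def using that W'(2) finite_subset[OF that W'(2)]
    by (intro open_Int open_INT) (auto intro!: open_Collect_less cont continuous_intros)
  define \<S> where "\<S> = {S. S \<subseteq> \<W>' \<and> S \<noteq> {} \<and> card S \<le> n + 1}"
  have finS: "finite \<S>"
    unfolding \<S>_def by (rule finite_subset[of _ "Pow \<W>'"]) (use W'(2) in auto)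
  have "\<exists>S\<in>\<S>. x \<in> Q S" if x: "x \<in> A" for x
  proof -
    let ?S = "{W \<in> \<W>'. x \<in> W}"
    have fin: "finite {V \<in> \<W>. x \<in> V}" "card {V \<in> \<W>. x \<in> V} \<le> n + 1"
      using W(4) by (auto simp: collection_dim_le_def)
    have sub: "?S \<subseteq> {V \<in> \<W>. x \<in> V}"
      using W'(1) by auto
    have "card ?S \<le> n + 1"
      by (rule order_trans[OF card_mono[OF fin(1) sub] fin(2)])
    then have "?S \<in> \<S>"
      using x W'(3) by (auto simp: \<S>_def)
    moreover have "\<phi> W' x < \<phi> W x" if "W \<in> ?S" "W' \<in> \<W>' - ?S" for W W'
      using that pos[of W x] pos[of W' x] x by auto
    then have "x \<in> Q ?S"
      unfolding Q_def using pos x by blast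
    ultimately show ?thesis by blast
  qed
  then have covQ: "A \<subseteq> \<Union>(Q ` \<S>)"
    by blast
  \<comment> \<open>A Lebesgue number shrinks the open sets \<open>Q S\<close> to compact sets
    \<open>F S\<close> that still cover \<open>A\<close>.\<close>
  obtain e where e: "e > 0" "\<forall>x\<in>A. \<exists>B\<in>Q ` \<S>. ball x e \<subseteq> B"
  proof (rule Heine_Borel_lemma[OF A(1) covQ])
    show "open B" if "B \<in> Q ` \<S>" for B
      using that opQ by (auto simp: \<S>_def)
  qed blast
  define F where "F S = {x \<in> A. ball x e \<subseteq> Q S}" for S
  have FQ: "F S \<subseteq> Q S" for S
    using e(1) by (auto simp: F_def)
  have cF: "compact (F S)" for S
  proof -
    have "F S = A - (\<Union>y\<in>-Q S. ball y e)"
      by (auto simp: F_def dist_commute subset_iff)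
    then show ?thesis
      using A(1) by (metis compact_diff open_UN open_ball)
  qed
  \<comment> \<open>The sets \<open>S\<close> have between 1 and \<open>n + 1\<close> elements, so
    grading by \<open>card S - 1\<close> uses exactly the colours up to \<open>n\<close>.\<close>
  define \<P> where "\<P> r = F ` {S \<in> \<S>. card S = r + 1}" for r
  have disj: "F S \<inter> F T = {}" if S: "S \<in> \<S>" "T \<in> \<S>" "card S = card T" "S \<noteq> T" for S T
  proof -
    have "finite S" "finite T"
      using S W'(2) finite_subset by (auto simp: \<S>_def)
    then obtain w w' where w: "w \<in> S - T" "w' \<in> T - S"
      using S(3,4) by (metis Diff_eq_empty_iff card_subset_eq ex_in_conv)
    have "\<phi> w' x < \<phi> w x" if "x \<in> Q S" for x
      using that w S by (auto simp: Q_def \<S>_def)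
    moreover have "\<phi> w x < \<phi> w' x" if "x \<in> Q T" for x
      using that w S by (auto simp: Q_def \<S>_def)
    ultimately show ?thesis
      using FQ[of S] FQ[of T] less_asym by (metis disjoint_iff subsetD)
  qed
  have sub: "\<exists>U\<in>\<O>. F S \<subseteq> U" if S: "S \<in> \<S>" "F S \<noteq> {}" for S
  proof -
    obtain w where w: "w \<in> S" "w \<in> \<W>'"
      using S(1) unfolding \<S>_def by blast
    have Fw: "F S \<subseteq> w"
    proof
      fix x assume "x \<in> F S"
      then have "x \<in> A" "0 < \<phi> w x"
        using FQ[of S] w by (auto simp: F_def Q_def)
      then show "x \<in> w"
        using pos w by blast
    qed
    obtain U where U: "U \<in> \<U>" "w \<subseteq> U"
      using W(3) W'(1) w by blast
    have "F S \<subseteq> A" by (auto simp: F_def)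
    then have "U \<noteq> X - A"
      using Fw U S(2) by blast
    then obtain V where "V \<in> \<O>" "U = V \<inter> X"
      using U(1) unfolding \<U>_def by blast
    then show ?thesis
      using U(2) Fw by blast
  qed
  show ?thesis
  \<comment> \<open>Empty pieces are dropped because a point of the piece is what rules out the
    added member \<open>X - A\<close> as the set containing it.\<close>
  proof (intro exI[of _ "\<lambda>r. \<P> r - {{}}"] conjI allI impI ballI)
    fix r assume "r \<le> n"
    show "finite (\<P> r - {{}})"
      using finS by (simp add: \<P>_def)
    show "pairwise disjnt (\<P> r - {{}})"
    proof (rule pairwiseI)
      fix B C assume B: "B \<in> \<P> r - {{}}" and C: "C \<in> \<P> r - {{}}" and ne: "B \<noteq> C"
      obtain S where S: "B = F S" "S \<in> \<S>" "card S = r + 1"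
        using B unfolding \<P>_def by blast
      obtain T where T: "C = F T" "T \<in> \<S>" "card T = r + 1"
        using C unfolding \<P>_def by blast
      have "S \<noteq> T" using ne S T by blast
      then show "disjnt B C"
        using disj[OF S(2) T(2)] S T by (simp add: disjnt_def)
    qed
    fix P assume "P \<in> \<P> r - {{}}"
    then obtain S where S: "P = F S" "S \<in> \<S>" "F S \<noteq> {}"
      by (auto simp: \<P>_def)
    then show "compact P" "P \<subseteq> A" "\<exists>U\<in>\<O>. P \<subseteq> U"
      using cF sub by (auto simp: F_def)
  next
    show "A \<subseteq> (\<Union>r\<le>n. \<Union>(\<P> r - {{}}))"
    proof
      fix x assume x: "x \<in> A"
      then obtain S where S: "S \<in> \<S>" "ball x e \<subseteq> Q S"
        using e(2) by blast
      then have "x \<in> F S"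
        using x by (auto simp: F_def)
      have "finite S" using S(1) W'(2) finite_subset by (auto simp: \<S>_def)
      then have "card S \<noteq> 0"
        using S(1) by (auto simp: \<S>_def)
      then have "F S \<in> \<P> (card S - 1)" "card S - 1 \<le> n"
        using S(1) by (auto simp: \<P>_def \<S>_def)
      then show "x \<in> (\<Union>r\<le>n. \<Union>(\<P> r - {{}}))"
        using \<open>x \<in> F S\<close> by auto
    qed
  qed
qed

lemma notin_closureI:
  fixes x :: "'a::metric_space"
  assumes "\<And>y. (\<And>m. y m \<in> D) \<Longrightarrow> y \<longlonglongrightarrow> x \<Longrightarrow> False"
  shows "x \<notin> closure D"
  using assms unfolding closure_sequential by blast

section \<open>Isometric actions and flows\<close>

text \<open>\<open>X\<close> will be the set of nonstationary points. Properness is stated at single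
  points; isometry spreads the resulting gap over whole orbits.\<close>

locale proper_flow = group G for G :: "('g, 'b) monoid_scheme" (structure) +
  fixes act :: "'g \<Rightarrow> 'a::metric_space \<Rightarrow> 'a" and fl :: "real \<Rightarrow> 'a \<Rightarrow> 'a" and X :: "'a set"
  assumes act_one [simp]: "act \<one> x = x"
    and act_mult: "\<lbrakk>g \<in> carrier G; h \<in> carrier G\<rbrakk> \<Longrightarrow> act (g \<otimes> h) x = act g (act h x)"
    and act_dist [simp]: "g \<in> carrier G \<Longrightarrow> dist (act g x) (act g y) = dist x y"
    and fl_cont: "continuous_on UNIV (\<lambda>p. fl (snd p) (fst p))"
    and fl_zero [simp]: "fl 0 x = x"
    and fl_add: "fl (s + t) x = fl s (fl t x)"
    and fl_act: "g \<in> carrier G \<Longrightarrow> fl t (act g x) = act g (fl t x)"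
    and fl_unif: "\<lbrakk>0 < a; 0 < e\<rbrakk> \<Longrightarrow>
      \<exists>d>0. \<forall>x y t. \<bar>t\<bar> \<le> a \<longrightarrow> dist x y \<le> d \<longrightarrow> dist (fl t x) (fl t y) \<le> e"
    and X_open: "open X"
    and X_fl: "x \<in> X \<Longrightarrow> fl t x \<in> X"
    and X_act: "\<lbrakk>g \<in> carrier G; x \<in> X\<rbrakk> \<Longrightarrow> act g x \<in> X"
    and X_cball: "x \<in> X \<Longrightarrow> \<exists>r>0. compact (cball x r) \<and> cball x r \<subseteq> X"
    and X_proper: "x \<in> X \<Longrightarrow> \<exists>r>0. finite {g \<in> carrier G. dist x (act g x) < r}"
begin

definition orb :: "'a \<Rightarrow> 'a set" where
  "orb x = (\<lambda>g. act g x) ` carrier G"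

definition sat :: "'a set \<Rightarrow> 'a set" where
  "sat A = (\<Union>g\<in>carrier G. act g ` A)"

definition invariant :: "('a \<Rightarrow> 'c) \<Rightarrow> bool" where
  "invariant u \<longleftrightarrow> (\<forall>g\<in>carrier G. \<forall>x. u (act g x) = u x)"

definition cinv :: "('a \<Rightarrow> real) \<Rightarrow> bool" where
  "cinv u \<longleftrightarrow> continuous_on UNIV u \<and> invariant u"

lemma act_inv [simp]:
  assumes "g \<in> carrier G"
  shows "act (inv g) (act g x) = x" "act g (act (inv g) x) = x"
  using assms act_mult[of "inv g" g x] act_mult[of g "inv g" x] by auto

lemma act_inj: "g \<in> carrier G \<Longrightarrow> act g x = act g y \<longleftrightarrow> x = y"
  by (metis act_inv(1))

lemma dist_act_left: "g \<in> carrier G \<Longrightarrow> dist (act g x) y = dist x (act (inv g) y)"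
  by (metis act_dist act_inv(2) inv_closed)

lemma dist_act_right: "g \<in> carrier G \<Longrightarrow> dist x (act g y) = dist (act (inv g) x) y"
  by (metis act_dist act_inv(2) inv_closed)

lemma cont_act: "g \<in> carrier G \<Longrightarrow> continuous_on S (act g)"
  unfolding continuous_on_iff by (metis act_dist)

lemma fl_minus [simp]: "fl (- t) (fl t x) = x" "fl t (fl (- t) x) = x"
  using fl_add[of "-t" t x] fl_add[of t "-t" x] by auto

lemma cont_fl [continuous_intros]:
  assumes "continuous_on S f" "continuous_on S u"
  shows "continuous_on S (\<lambda>x. fl (u x) (f x))"
  using continuous_on_compose2[OF fl_cont continuous_on_Pair[OF assms]] by auto

lemma fl_inj: "fl t x = fl t y \<longleftrightarrow> x = y"
  by (metis fl_minus(1))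

lemma X_fl_iff [simp]: "fl t x \<in> X \<longleftrightarrow> x \<in> X"
  by (metis X_fl fl_minus(1))

lemma orb_refl [simp]: "x \<in> orb x"
  unfolding orb_def using act_one one_closed by (metis image_eqI)

lemma orb_nonempty [simp]: "orb x \<noteq> {}"
  using orb_refl by blast

lemma orb_act:
  assumes "g \<in> carrier G"
  shows "act g ` orb x = orb x" "orb (act g x) = orb x"
proof -
  have *: "act h (act g y) \<in> orb y" if "h \<in> carrier G" "g \<in> carrier G" for h g y
    using that act_mult[of h g y] unfolding orb_def by (metis image_eqI m_closed)
  have le: "act g ` orb x \<subseteq> orb x" "orb (act g x) \<subseteq> orb x" if "g \<in> carrier G" for g x
    using *[OF _ that] *[OF that] that by (auto simp: orb_def)
  show "orb (act g x) = orb x"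
    using le(2)[OF assms, of x] le(2)[of "inv g" "act g x"] assms by auto
  have "y \<in> act g ` orb x" if "y \<in> orb x" for y
    using le(1)[of "inv g" x] that assms
    by (intro image_eqI[of _ _ "act (inv g) y"]) (auto simp: image_subset_iff)
  then show "act g ` orb x = orb x"
    using le(1)[OF assms] by blast
qed

lemma infdist_act:
  assumes g: "g \<in> carrier G" and A: "act g ` A = A"
  shows "infdist (act g x) A = infdist x A"
proof -
  have "infdist (act g x) (act g ` A) = infdist x A"
    unfolding infdist_def using g by (simp add: image_image)
  then show ?thesis using A by simp
qed

lemma infdist_orb_act: "g \<in> carrier G \<Longrightarrow> infdist (act g x) (orb z) = infdist x (orb z)"
  by (rule infdist_act) (auto simp: orb_act)

lemma sat_act: "g \<in> carrier G \<Longrightarrow> act g ` sat A = sat A"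
proof -
  have le: "act g ` sat A \<subseteq> sat A" if "g \<in> carrier G" for g
  proof (clarsimp simp: sat_def)
    fix h x assume "h \<in> carrier G" "x \<in> A"
    then show "\<exists>k\<in>carrier G. act g (act h x) \<in> act k ` A"
      using that by (intro bexI[of _ "g \<otimes> h"] image_eqI[of _ _ x]) (auto simp: act_mult)
  qed
  show ?thesis if "g \<in> carrier G"
  proof
    show "sat A \<subseteq> act g ` sat A"
    proof
      fix y assume "y \<in> sat A"
      then have "act (inv g) y \<in> sat A" using le[of "inv g"] that by auto
      then show "y \<in> act g ` sat A"
        using that by (auto intro!: image_eqI[of _ _ "act (inv g) y"])
    qed
  qed (use le that in auto)
qed

lemma subset_sat: "A \<subseteq> sat A"
proof
  fix x assume "x \<in> A"
  then have "x \<in> act \<one> ` A" by (intro image_eqI[of _ _ x]) auto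
  then show "x \<in> sat A" unfolding sat_def using one_closed by blast
qed

text \<open>By properness only finitely many group elements move \<open>z\<close> by a small
  distance, and the least positive displacement among them is a gap.\<close>

lemma separated:
  assumes "z \<in> X"
  shows "\<exists>s>0. \<forall>g\<in>carrier G. dist z (act g z) < s \<longrightarrow> act g z = z"
proof -
  obtain r where r: "r > 0" "finite {g \<in> carrier G. dist z (act g z) < r}" (is "finite ?F")
    using X_proper[OF assms] by blast
  define D where "D = insert r ((\<lambda>g. dist z (act g z)) ` ?F - {0})"
  have D: "finite D" "D \<noteq> {}"
    using r by (auto simp: D_def)
  have "Min D > 0"
    using D r(1) by (auto simp: Min_gr_iff D_def)
  moreover have "act g z = z" if "g \<in> carrier G" "dist z (act g z) < Min D" for g
  proof (rule ccontr)
    assume "act g z \<noteq> z"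
    then have "dist z (act g z) \<in> D"
      using that D by (auto simp: D_def)
    then show False
      using that D Min_le by fastforce
  qed
  ultimately show ?thesis by blast
qed

text \<open>By isometry two points of the orbit are equal or at least \<open>s\<close> apart, so an
  orbit point within \<open>s / 2\<close> of \<open>x\<close> has no closer competitor.\<close>

lemma infdist_orb_attained:
  assumes s: "\<forall>g\<in>carrier G. dist z (act g z) < s \<longrightarrow> act g z = z"
    and x: "infdist x (orb z) < s / 2"
  shows "\<exists>g\<in>carrier G. dist x (act g z) = infdist x (orb z)"
proof -
  have "\<exists>p\<in>orb z. dist x p < s / 2"
    using infdist_lessE[OF orb_nonempty x] by metis
  then obtain g where g: "g \<in> carrier G" "dist x (act g z) < s / 2"
    by (auto simp: orb_def)
  have "dist x (act g z) \<le> dist x (act h z)" if h: "h \<in> carrier G" for h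
  proof (rule ccontr)
    assume "\<not> ?thesis"
    then have "dist (act g z) (act h z) < s"
      using g dist_triangle3[of "act g z" "act h z" x] by linarith
    then have "dist z (act (inv g \<otimes> h) z) < s"
      using g(1) h by (simp add: dist_act_left act_mult)
    then have "act (inv g \<otimes> h) z = z"
      using s g(1) h by blast
    then have "act h z = act g z"
      using g(1) h by (metis act_inv(2) act_mult inv_closed)
    then show False using \<open>\<not> _\<close> by simp
  qed
  then have "dist x (act g z) \<le> infdist x (orb z)"
    unfolding infdist_notempty[OF orb_nonempty] by (intro cINF_greatest) (auto simp: orb_def)
  moreover have "infdist x (orb z) \<le> dist x (act g z)"
    by (rule infdist_le) (use g in \<open>auto simp: orb_def\<close>)
  ultimately show ?thesis
    using g(1) by (auto intro!: bexI[of _ g])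
qed

lemma infdist_orb_zero:
  assumes "z \<in> X" "infdist x (orb z) = 0"
  shows "x \<in> orb z"
proof -
  obtain s where s: "s > 0" "\<forall>g\<in>carrier G. dist z (act g z) < s \<longrightarrow> act g z = z"
    using separated[OF assms(1)] by blast
  then obtain g where "g \<in> carrier G" "dist x (act g z) = 0"
    using infdist_orb_attained[OF s(2), of x] assms(2) by auto
  then show ?thesis by (auto simp: orb_def)
qed

text \<open>Isometries turn the distance of \<open>x\<close> to translates of \<open>Q\<close> into
  the distance of points of \<open>Q\<close> to the orbit of \<open>x\<close>. Compactness of
  \<open>Q\<close> then provides a minimum, although \<open>sat Q\<close> need not be
  compact.\<close>

lemma infdist_sat_zero:
  assumes Q: "compact Q" "Q \<noteq> {}" and x: "x \<in> X" "infdist x (sat Q) = 0"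
  shows "x \<in> sat Q"
proof -
  have "continuous_on Q (\<lambda>q. infdist q (orb x))"
    by (intro continuous_intros)
  then obtain q where q: "q \<in> Q" "\<forall>y\<in>Q. infdist q (orb x) \<le> infdist y (orb x)"
    using continuous_attains_inf[OF Q] by blast
  have "infdist q (orb x) \<le> e" if "e > 0" for e
  proof -
    have "sat Q \<noteq> {}" using Q subset_sat by blast
    then have "\<exists>p\<in>sat Q. dist x p < e"
      using infdist_lessE[of "sat Q" x e] that x(2) by metis
    then obtain g y where g: "g \<in> carrier G" "y \<in> Q" "dist x (act g y) < e"
      by (auto simp: sat_def)
    then have "dist y (act (inv g) x) < e"
      by (metis dist_act_right dist_commute)
    moreover have "act (inv g) x \<in> orb x"
      using g by (auto simp: orb_def)
    ultimately have "infdist y (orb x) \<le> e"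
      by (meson infdist_le2 less_imp_le)
    then show ?thesis using q g by force
  qed
  then have "infdist q (orb x) = 0"
    using infdist_nonneg[of q "orb x"] by (meson dense_ge order_antisym)
  then have "q \<in> orb x"
    using infdist_orb_zero x by blast
  then obtain g where "g \<in> carrier G" "q = act g x" by (auto simp: orb_def)
  then have "x = act (inv g) q" "inv g \<in> carrier G" by auto
  then show ?thesis using q(1) by (auto simp: sat_def)
qed

section \<open>Genericity of invariant functions\<close>

text \<open>The distance to the saturation of \<open>Q\<close> is an invariant function. It stays
  above a positive constant off \<open>W\<close>, since \<open>W\<close> is invariant and
  compactness gives a uniform margin around \<open>Q\<close>.\<close>

lemma bump:
  assumes Q: "compact Q" "Q \<subseteq> W" and W: "open W" "\<And>g. g \<in> carrier G \<Longrightarrow> act g ` W \<subseteq> W"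
  shows "\<exists>\<theta>. cinv \<theta> \<and> (\<forall>x. 0 \<le> \<theta> x \<and> \<theta> x \<le> 1) \<and> (\<forall>x\<in>Q. \<theta> x = 1) \<and> (\<forall>x. x \<notin> W \<longrightarrow> \<theta> x = 0)"
proof (cases "Q = {}")
  case True
  then show ?thesis
    by (intro exI[of _ "\<lambda>_. 0"]) (auto simp: cinv_def invariant_def)
next
  case False
  obtain s where s: "s > 0" "(\<Union>x\<in>Q. ball x s) \<subseteq> W"
    using compact_subset_open_imp_ball_epsilon_subset[OF Q(1) W(1) Q(2)] by metis
  have satne: "sat Q \<noteq> {}"
    using False subset_sat by blast
  have far: "s \<le> infdist x (sat Q)" if x: "x \<notin> W" for x
  proof (rule ccontr)
    assume "\<not> ?thesis"
    then have "infdist x (sat Q) < s" by simp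
    then obtain p where p: "p \<in> sat Q" "dist x p < s"
      by (rule infdist_lessE[OF satne])
    then obtain g y where g: "g \<in> carrier G" "y \<in> Q" "p = act g y"
      by (auto simp: sat_def)
    then have "dist y (act (inv g) x) < s"
      using p by (metis dist_act_right dist_commute)
    then have "act (inv g) x \<in> ball y s" by simp
    then have "act (inv g) x \<in> W"
      using s(2) g(2) by blast
    then have "act g (act (inv g) x) \<in> W"
      using W(2)[OF g(1)] by blast
    then show False
      using x g(1) by simp
  qed
  show ?thesis
  proof (intro exI[of _ "\<lambda>x. max 0 (1 - infdist x (sat Q) / s)"] conjI allI ballI impI)
    show "cinv (\<lambda>x. max 0 (1 - infdist x (sat Q) / s))"
      unfolding cinv_def invariant_def using s
      by (auto intro!: continuous_intros simp: infdist_act sat_act)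
    show "max 0 (1 - infdist x (sat Q) / s) = 1" if "x \<in> Q" for x
      using that subset_sat by (auto simp: subset_iff)
    show "max 0 (1 - infdist x (sat Q) / s) = 0" if "x \<notin> W" for x
      using far[OF that] s(1) by (simp add: field_simps)
  qed (use s infdist_nonneg in \<open>auto simp: field_simps\<close>)
qed

text \<open>One set is treated at a time, by blending the current function with the constant
  \<open>c k\<close> along an invariant bump. The bump vanishes wherever \<open>c k\<close> is not
  \<open>e\<close>-close to the original \<open>w\<close>, so errors do not add up over the steps,
  and it vanishes on the other saturations, so earlier values survive.\<close>

lemma assign_constants:
  fixes Q :: "'i \<Rightarrow> 'a set"
  assumes w: "cinv w" and e: "e > 0" and I: "finite I"
    and Q: "\<And>i. i \<in> I \<Longrightarrow> compact (Q i) \<and> Q i \<subseteq> X"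
    and disj: "\<And>i j. \<lbrakk>i \<in> I; j \<in> I; i \<noteq> j\<rbrakk> \<Longrightarrow> Q i \<inter> sat (Q j) = {}"
    and c: "\<And>i x. \<lbrakk>i \<in> I; x \<in> Q i\<rbrakk> \<Longrightarrow> \<bar>c i - w x\<bar> < e"
  shows "\<exists>w'. cinv w' \<and> (\<forall>x. \<bar>w' x - w x\<bar> \<le> e) \<and> (\<forall>i\<in>I. \<forall>x\<in>Q i. w' x = c i)"
  using I Q disj c
proof (induction I rule: finite_induct)
  case empty
  then show ?case using w e by (intro exI[of _ w]) auto
next
  case (insert k I)
  obtain w' where w': "cinv w'" "\<And>x. \<bar>w' x - w x\<bar> \<le> e" "\<And>i x. i \<in> I \<Longrightarrow> x \<in> Q i \<Longrightarrow> w' x = c i"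
  proof -
    have "\<exists>w'. cinv w' \<and> (\<forall>x. \<bar>w' x - w x\<bar> \<le> e) \<and> (\<forall>i\<in>I. \<forall>x\<in>Q i. w' x = c i)"
      using insert.prems by (intro insert.IH) auto
    then show ?thesis using that by blast
  qed
  \<comment> \<open>Since \<open>infdist\<close> to the empty set is 0, an empty \<open>Q i\<close>
    would make \<open>W\<close> empty.\<close>
  define J where "J = {i \<in> I. Q i \<noteq> {}}"
  define W where "W = {x. \<bar>c k - w x\<bar> < e} \<inter> (\<Inter>i\<in>J. {x. 0 < infdist x (sat (Q i))})"
  have inv: "w (act g x) = w x" if "g \<in> carrier G" for g x
    using w that by (auto simp: cinv_def invariant_def)
  have wc: "continuous_on UNIV w"
    using w by (simp add: cinv_def)
  have "open {x. \<bar>c k - w x\<bar> < e}"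
    by (intro open_Collect_less continuous_intros wc)
  moreover have "open (\<Inter>i\<in>J. {x. 0 < infdist x (sat (Q i))})"
    using insert.hyps(1) by (intro open_INT) (auto simp: J_def intro!: open_Collect_less continuous_intros)
  ultimately have "open W"
    unfolding W_def by blast
  moreover have "act g ` W \<subseteq> W" if "g \<in> carrier G" for g
    using that by (auto simp: W_def inv infdist_act sat_act)
  moreover have "x \<in> W" if x: "x \<in> Q k" for x
  proof -
    have "0 < infdist x (sat (Q i))" if i: "i \<in> J" for i
    proof (rule ccontr)
      assume "\<not> ?thesis"
      then have "infdist x (sat (Q i)) = 0"
        using infdist_nonneg[of x "sat (Q i)"] by linarith
      then have "x \<in> sat (Q i)"
        using infdist_sat_zero[of "Q i" x] i x insert.prems(1) by (auto simp: J_def)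
      then show False
        using x i insert.prems(2)[of k i] insert.hyps(2) by (auto simp: J_def)
    qed
    then show ?thesis
      using insert.prems(3) x by (auto simp: W_def)
  qed
  ultimately obtain \<theta> where \<theta>: "cinv \<theta>" "\<And>x. 0 \<le> \<theta> x \<and> \<theta> x \<le> 1" "\<And>x. x \<in> Q k \<Longrightarrow> \<theta> x = 1"
      "\<And>x. x \<notin> W \<Longrightarrow> \<theta> x = 0"
    using bump[of "Q k" W] insert.prems(1) by (metis insertI1 subsetI)
  define w'' where "w'' x = (1 - \<theta> x) * w' x + \<theta> x * c k" for x
  have "cinv w''"
    using w'(1) \<theta>(1) unfolding cinv_def invariant_def w''_def
    by (auto intro!: continuous_intros)
  moreover have "\<forall>x. \<bar>w'' x - w x\<bar> \<le> e"
  proof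
    fix x
    show "\<bar>w'' x - w x\<bar> \<le> e"
    proof (cases "x \<in> W")
      case True
      have "w'' x - w x = (1 - \<theta> x) * (w' x - w x) + \<theta> x * (c k - w x)"
        by (simp add: w''_def algebra_simps)
      also have "\<bar>\<dots>\<bar> \<le> (1 - \<theta> x) * \<bar>w' x - w x\<bar> + \<theta> x * \<bar>c k - w x\<bar>"
      proof -
        have "\<bar>(1 - \<theta> x) * (w' x - w x)\<bar> = (1 - \<theta> x) * \<bar>w' x - w x\<bar>"
            "\<bar>\<theta> x * (c k - w x)\<bar> = \<theta> x * \<bar>c k - w x\<bar>"
          using \<theta>(2)[of x] by (simp_all add: abs_mult)
        then show ?thesis
          using abs_triangle_ineq[of "(1 - \<theta> x) * (w' x - w x)" "\<theta> x * (c k - w x)"] by linarith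
      qed
      also have "\<dots> \<le> (1 - \<theta> x) * e + \<theta> x * e"
        using \<theta>(2)[of x] w'(2)[of x] True by (intro add_mono mult_left_mono) (auto simp: W_def)
      finally show ?thesis by (simp add: algebra_simps)
    next
      case False
      then show ?thesis
        using \<theta>(4) w'(2) by (simp add: w''_def)
    qed
  qed
  moreover have "\<forall>i\<in>insert k I. \<forall>x\<in>Q i. w'' x = c i"
  proof (intro ballI)
    fix i x assume that: "i \<in> insert k I" "x \<in> Q i"
    show "w'' x = c i"
    proof (cases "i = k")
      case True
      then show ?thesis using that \<theta>(3) by (simp add: w''_def)
    next
      case False
      then have i: "i \<in> J" using that by (auto simp: J_def)
      have "x \<in> sat (Q i)" using that(2) subset_sat by blast
      then have "\<not> 0 < infdist x (sat (Q i))" by simp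
      then have "x \<notin> W" using i unfolding W_def by blast
      then show ?thesis using \<theta>(4) w'(3) that False by (simp add: w''_def)
    qed
  qed
  ultimately show ?case by (intro exI[of _ w''] conjI)
qed

section \<open>Dense open conditions on families of weights\<close>

definition admissible :: "(nat \<Rightarrow> nat \<Rightarrow> 'a \<Rightarrow> real) \<Rightarrow> bool" where
  "admissible v \<longleftrightarrow> (\<forall>r i. cinv (v r i))"

text \<open>In \<open>v r i\<close> the index \<open>r\<close> counts the independent choices and
  \<open>i\<close> the slices; families are compared uniformly in both.\<close>

definition near :: "real \<Rightarrow> (nat \<Rightarrow> nat \<Rightarrow> 'a \<Rightarrow> real) \<Rightarrow> (nat \<Rightarrow> nat \<Rightarrow> 'a \<Rightarrow> real) \<Rightarrow> bool" where
  "near e v v' \<longleftrightarrow> (\<forall>r i x. \<bar>v' r i x - v r i x\<bar> \<le> e)"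

text \<open>The interior of \<open>P\<close> is dense in the admissible families for the uniform
  distance. Asking for an interior lets finitely many such conditions be combined by successive
  perturbations.\<close>

definition generic :: "((nat \<Rightarrow> nat \<Rightarrow> 'a \<Rightarrow> real) \<Rightarrow> bool) \<Rightarrow> bool" where
  "generic P \<longleftrightarrow> (\<forall>v e. admissible v \<longrightarrow> e > 0 \<longrightarrow>
     (\<exists>v' d. admissible v' \<and> d > 0 \<and> near e v v' \<and> (\<forall>v''. admissible v'' \<longrightarrow> near d v' v'' \<longrightarrow> P v'')))"

lemma near_refl: "e \<ge> 0 \<Longrightarrow> near e v v"
  by (simp add: near_def)

lemma near_trans: "near a u v \<Longrightarrow> near b v w \<Longrightarrow> a + b \<le> c \<Longrightarrow> near c u w"
  unfolding near_def
proof (intro allI)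
  fix r i x
  assume "\<forall>r i x. \<bar>v r i x - u r i x\<bar> \<le> a" "\<forall>r i x. \<bar>w r i x - v r i x\<bar> \<le> b" "a + b \<le> c"
  then have "\<bar>v r i x - u r i x\<bar> \<le> a" "\<bar>w r i x - v r i x\<bar> \<le> b" "a + b \<le> c"
    by blast+
  then show "\<bar>w r i x - u r i x\<bar> \<le> c" by linarith
qed

lemma near_mono: "near a u v \<Longrightarrow> a \<le> b \<Longrightarrow> near b u v"
  unfolding near_def by (meson order_trans)

lemma genericE:
  assumes "generic P" "admissible v" "e > 0"
  obtains v' d where "admissible v'" "d > 0" "near e v v'" "\<And>v''. admissible v'' \<Longrightarrow> near d v' v'' \<Longrightarrow> P v''"
  using assms unfolding generic_def by blast

lemma generic_True: "generic (\<lambda>_. True)"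
  unfolding generic_def
proof (intro allI impI)
  fix v :: "nat \<Rightarrow> nat \<Rightarrow> 'a \<Rightarrow> real" and e :: real assume "admissible v" "e > 0"
  then show "\<exists>v' d. admissible v' \<and> d > 0 \<and> near e v v' \<and> (\<forall>v''. admissible v'' \<longrightarrow> near d v' v'' \<longrightarrow> True)"
    using near_refl[of e v] by (intro exI[of _ v] exI[of _ 1]) auto
qed

lemma generic_conj:
  assumes "generic P" "generic Q"
  shows "generic (\<lambda>v. P v \<and> Q v)"
  unfolding generic_def
proof (intro allI impI)
  fix v :: "nat \<Rightarrow> nat \<Rightarrow> 'a \<Rightarrow> real" and e :: real assume v: "admissible v" "e > 0"
  obtain v1 d1 where 1: "admissible v1" "d1 > 0" "near (e/2) v v1" "\<And>v''. admissible v'' \<Longrightarrow> near d1 v1 v'' \<Longrightarrow> P v''"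
    using genericE[OF assms(1) v(1), of "e/2"] v(2) by auto
  \<comment> \<open>At most half of \<open>d1\<close> is spent here, which leaves the other half as
    room around \<open>v2\<close>.\<close>
  obtain v2 d2 where 2: "admissible v2" "d2 > 0" "near (min (e/2) (d1/2)) v1 v2"
      "\<And>v''. admissible v'' \<Longrightarrow> near d2 v2 v'' \<Longrightarrow> Q v''"
    using genericE[OF assms(2) 1(1), of "min (e/2) (d1/2)"] v(2) 1(2) by auto
  show "\<exists>v' d. admissible v' \<and> d > 0 \<and> near e v v' \<and> (\<forall>v''. admissible v'' \<longrightarrow> near d v' v'' \<longrightarrow> P v'' \<and> Q v'')"
  proof (intro exI[of _ v2] exI[of _ "min d2 (d1/2)"] conjI allI impI)
    show "near e v v2"
      using near_trans[OF 1(3) 2(3)] by simp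
    fix v'' assume v'': "admissible v''" "near (min d2 (d1/2)) v2 v''"
    show "P v''"
      using 1(4)[OF v''(1)] near_trans[OF 2(3) v''(2), of d1] by simp
    show "Q v''"
      using 2(4)[OF v''(1)] near_mono[OF v''(2), of d2] by simp
  qed (use 1 2 in auto)
qed

lemma generic_ball:
  assumes "finite I" "\<And>i. i \<in> I \<Longrightarrow> generic (P i)"
  shows "generic (\<lambda>v. \<forall>i\<in>I. P i v)"
  using assms
proof (induction I rule: finite_induct)
  case empty
  then show ?case using generic_True by simp
next
  case (insert k I)
  then show ?case using generic_conj[of "P k" "\<lambda>v. \<forall>i\<in>I. P i v"] by simp
qed

lemma generic_mono: "generic P \<Longrightarrow> (\<And>v. admissible v \<Longrightarrow> P v \<Longrightarrow> Q v) \<Longrightarrow> generic Q"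
  unfolding generic_def by fast

text \<open>In the application \<open>h r x\<close> is the point where the orbit of \<open>x\<close>
  meets slice \<open>j r\<close>, and \<open>A r\<close> is the exceptional set there. A violation
  needs \<open>n + 1\<close> coincidences for the same \<open>x\<close>.\<close>

definition avoids ::
    "nat \<Rightarrow> (nat \<Rightarrow> nat) \<Rightarrow> (nat \<Rightarrow> 'a \<Rightarrow> 'a) \<Rightarrow> (nat \<Rightarrow> ('a \<times> real) set) \<Rightarrow> 'a set \<Rightarrow>
     (nat \<Rightarrow> nat \<Rightarrow> 'a \<Rightarrow> real) \<Rightarrow> bool" where
  "avoids n j h A E v \<longleftrightarrow> (\<forall>x\<in>E. \<exists>r\<le>n. (h r x, v r (j r) (h r x)) \<notin> A r)"

text \<open>The conclusion also reaches a neighbourhood of \<open>E\<close> relative to the larger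
  set \<open>F\<close>. Hence after one stratum of \<open>F\<close> has been treated, the rest to be
  treated is again compact.\<close>

lemma avoids_robust:
  assumes E: "compact E" "E \<subseteq> F" and h: "\<And>r. r \<le> n \<Longrightarrow> continuous_on F (h r)"
    and A: "\<And>r. r \<le> n \<Longrightarrow> closed (A r)" and v: "admissible v" "avoids n j h A E v"
  shows "\<exists>U d. open U \<and> E \<subseteq> U \<and> d > 0 \<and> (\<forall>v''. near d v v'' \<longrightarrow> avoids n j h A (F \<inter> U) v'')"
proof -
  have "\<exists>\<delta> d. \<delta> > 0 \<and> d > 0 \<and> (\<forall>v''. near d v v'' \<longrightarrow> avoids n j h A (F \<inter> ball x \<delta>) v'')"
    if x: "x \<in> E" for x
  proof -
    obtain r where r: "r \<le> n" "(h r x, v r (j r) (h r x)) \<notin> A r"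
      using v(2) x unfolding avoids_def by blast
    define \<phi> where "\<phi> y = (h r y, v r (j r) (h r y))" for y
    have "continuous_on UNIV (v r (j r))"
      using v(1) by (simp add: admissible_def cinv_def)
    then have "continuous_on F (\<lambda>y. v r (j r) (h r y))"
      using h[OF r(1)] by (rule continuous_on_compose2) auto
    then have \<phi>: "continuous_on F \<phi>"
      unfolding \<phi>_def using h[OF r(1)] by (intro continuous_on_Pair)
    have "open (- A r)" "\<phi> x \<in> - A r"
      using A r by (auto simp: \<phi>_def)
    then obtain e where e: "e > 0" "ball (\<phi> x) e \<subseteq> - A r"
      using open_contains_ball by blast
    have "e/2 > 0" using e(1) by simp
    then obtain \<delta> where \<delta>: "\<delta> > 0" "\<And>y. y \<in> F \<Longrightarrow> dist y x < \<delta> \<Longrightarrow> dist (\<phi> y) (\<phi> x) < e/2"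
      using \<phi> x E(2) unfolding continuous_on_iff by blast
    have "avoids n j h A (F \<inter> ball x \<delta>) v''" if v'': "near (e/3) v v''" for v''
      unfolding avoids_def
    proof
      fix y assume y: "y \<in> F \<inter> ball x \<delta>"
      have "\<bar>v'' r (j r) (h r y) - v r (j r) (h r y)\<bar> \<le> e/3"
        using v'' unfolding near_def by blast
      then have "dist (h r y, v'' r (j r) (h r y)) (\<phi> y) \<le> e/3"
        by (simp add: \<phi>_def dist_Pair_Pair dist_real_def)
      moreover have "dist (\<phi> y) (\<phi> x) < e/2"
        using \<delta>(2)[of y] y by (simp add: dist_commute)
      ultimately have "dist (h r y, v'' r (j r) (h r y)) (\<phi> x) < e"
        using dist_triangle[of "(h r y, v'' r (j r) (h r y))" "\<phi> x" "\<phi> y"] e(1) by linarith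
      then have "(h r y, v'' r (j r) (h r y)) \<in> ball (\<phi> x) e"
        by (simp add: dist_commute)
      then show "\<exists>r\<le>n. (h r y, v'' r (j r) (h r y)) \<notin> A r"
        using e(2) r(1) by blast
    qed
    moreover have "e/3 > 0" using e(1) by simp
    ultimately show ?thesis
      using \<delta>(1) by blast
  qed
  then obtain \<delta> d where d: "\<And>x. x \<in> E \<Longrightarrow> \<delta> x > 0" "\<And>x. x \<in> E \<Longrightarrow> d x > (0::real)"
      "\<And>x v''. x \<in> E \<Longrightarrow> near (d x) v v'' \<Longrightarrow> avoids n j h A (F \<inter> ball x (\<delta> x)) v''"
    by metis
  have "E \<subseteq> (\<Union>x\<in>E. ball x (\<delta> x))"
    using d(1) by auto
  then obtain T where T: "T \<subseteq> E" "finite T" "E \<subseteq> (\<Union>x\<in>T. ball x (\<delta> x))"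
    using compactE_image[OF E(1), of E "\<lambda>x. ball x (\<delta> x)"] by auto
  define D where "D = Min (insert 1 (d ` T))"
  have D: "D > 0" "\<And>x. x \<in> T \<Longrightarrow> D \<le> d x"
    using T d(2) by (auto simp: D_def)
  show ?thesis
  proof (intro exI[of _ "\<Union>x\<in>T. ball x (\<delta> x)"] exI[of _ D] conjI allI impI)
    fix v'' assume v'': "near D v v''"
    show "avoids n j h A (F \<inter> (\<Union>x\<in>T. ball x (\<delta> x))) v''"
      unfolding avoids_def
    proof
      fix y assume "y \<in> F \<inter> (\<Union>x\<in>T. ball x (\<delta> x))"
      then obtain x where x: "x \<in> T" "y \<in> F \<inter> ball x (\<delta> x)" by blast
      have "near (d x) v v''"
        using near_mono[OF v'' D(2)[OF x(1)]] .
      then have "avoids n j h A (F \<inter> ball x (\<delta> x)) v''"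
        using d(3) x(1) T(1) by blast
      then show "\<exists>r\<le>n. (h r y, v'' r (j r) (h r y)) \<notin> A r"
        using x(2) unfolding avoids_def by blast
    qed
  qed (use D T in auto)
qed

text \<open>Each colour \<open>r\<close> of a fine coloured refinement of \<open>E\<close> is served
  by the \<open>r\<close>-th choice alone: that weight is moved to a constant on every piece of
  colour \<open>r\<close>, off the finitely many forbidden values. A point is good only for the
  colours of the pieces containing it, which is all that \<open>avoids\<close> asks. By
  \<open>hinj\<close> and \<open>piece\<close>, disjoint pieces have images that stay disjoint
  modulo \<open>G\<close>, so the constants can be prescribed independently by invariant
  functions.\<close>

lemma avoids_dense_piece:
  assumes dim: "covering_dim_le X n" and E: "compact E" "E \<subseteq> X"
    and h: "\<And>r. r \<le> n \<Longrightarrow> continuous_on E (h r)" "\<And>r. r \<le> n \<Longrightarrow> h r ` E \<subseteq> X"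
    and hinj: "\<And>r x y g. \<lbrakk>r \<le> n; x \<in> E; y \<in> E; g \<in> carrier G; h r y = act g (h r x)\<rbrakk> \<Longrightarrow> y = act g x"
    and A: "\<And>r. r \<le> n \<Longrightarrow> closed (A r)" "\<And>r x. r \<le> n \<Longrightarrow> finite {a. (x, a) \<in> A r}"
    and piece: "\<And>x g. \<lbrakk>x \<in> E; g \<in> carrier G; act g x \<in> E\<rbrakk> \<Longrightarrow> act g x = x"
    and v: "admissible v" and e: "e > 0"
  shows "\<exists>v'. admissible v' \<and> near e v v' \<and> avoids n j h A E v'"
proof -
  define w where "w r = v r (j r)" for r
  have w: "cinv (w r)" for r
    using v by (simp add: admissible_def w_def)
  define ok where "ok r c y \<longleftrightarrow> \<bar>c - w r (h r y)\<bar> < e \<and> (h r y, c) \<notin> A r" for r c y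
  have one: "\<exists>c \<delta>. \<delta> > 0 \<and> (\<forall>y\<in>E. dist y x < \<delta> \<longrightarrow> ok r c y)" if x: "x \<in> E" and r: "r \<le> n" for x r
  proof -
    have "infinite {w r (h r x) - e<..<w r (h r x) + e}"
      using e by (intro infinite_Ioo) simp
    then have "infinite ({w r (h r x) - e<..<w r (h r x) + e} - {a. (h r x, a) \<in> A r})"
      using A(2)[OF r] by simp
    then have "{w r (h r x) - e<..<w r (h r x) + e} - {a. (h r x, a) \<in> A r} \<noteq> {}"
      using finite.emptyI by metis
    then obtain c where c: "c \<in> {w r (h r x) - e<..<w r (h r x) + e} - {a. (h r x, a) \<in> A r}"
      by blast
    have "continuous_on UNIV (w r)"
      using w by (simp add: cinv_def)
    then have wc: "continuous_on E (\<lambda>y. w r (h r y))"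
      using h(1)[OF r] by (rule continuous_on_compose2) auto
    define \<phi> where "\<phi> y = (h r y, w r (h r y))" for y
    have \<phi>: "continuous_on E \<phi>"
      unfolding \<phi>_def using h(1)[OF r] wc by (intro continuous_on_Pair)
    define O' where "O' = (\<lambda>p. (fst p, c)) -` (- A r) \<inter> {p. \<bar>c - snd p\<bar> < e}"
    have "open ((\<lambda>p::'a \<times> real. (fst p, c)) -` (- A r))"
      using A(1)[OF r] by (intro open_vimage continuous_intros) auto
    moreover have "open {p::'a \<times> real. \<bar>c - snd p\<bar> < e}"
      by (intro open_Collect_less continuous_intros)
    ultimately have "open O'"
      unfolding O'_def by blast
    moreover have "\<phi> x \<in> O'"
      using c by (auto simp: O'_def \<phi>_def)
    ultimately obtain \<epsilon> where \<epsilon>: "\<epsilon> > 0" "ball (\<phi> x) \<epsilon> \<subseteq> O'"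
      using open_contains_ball by blast
    obtain \<delta> where \<delta>: "\<delta> > 0" "\<forall>y\<in>E. dist y x < \<delta> \<longrightarrow> dist (\<phi> y) (\<phi> x) < \<epsilon>"
      using \<phi> x \<epsilon>(1) unfolding continuous_on_iff by blast
    have "ok r c y" if "y \<in> E" "dist y x < \<delta>" for y
    proof -
      have "dist (\<phi> y) (\<phi> x) < \<epsilon>"
        using \<delta>(2) that by blast
      then have "\<phi> y \<in> ball (\<phi> x) \<epsilon>"
        by (simp add: dist_commute)
      then have "\<phi> y \<in> O'" using \<epsilon>(2) by blast
      then show ?thesis by (auto simp: O'_def \<phi>_def ok_def)
    qed
    then show ?thesis using \<delta>(1) by blast
  qed
  \<comment> \<open>On a member of this cover one constant per colour is both close to the old
    weight and not forbidden.\<close>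
  define \<O> where "\<O> = {U. open U \<and> (\<exists>c. \<forall>r\<le>n. \<forall>y\<in>U \<inter> E. ok r (c r) y)}"
  have "x \<in> \<Union>\<O>" if x: "x \<in> E" for x
  proof -
    have "\<forall>r. \<exists>c \<delta>. r \<le> n \<longrightarrow> \<delta> > 0 \<and> (\<forall>y\<in>E. dist y x < \<delta> \<longrightarrow> ok r c y)"
      using one[OF x] by blast
    then obtain c \<delta> where c: "\<And>r. r \<le> n \<Longrightarrow> \<delta> r > (0::real)"
        "\<And>r y. r \<le> n \<Longrightarrow> y \<in> E \<Longrightarrow> dist y x < \<delta> r \<Longrightarrow> ok r (c r) y"
      by metis
    define D where "D = Min (\<delta> ` {..n})"
    have D: "D > 0" "\<And>r. r \<le> n \<Longrightarrow> D \<le> \<delta> r"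
      using c(1) by (auto simp: D_def)
    have "ok r (c r) y" if "r \<le> n" "y \<in> ball x D \<inter> E" for r y
    proof -
      have "dist y x < \<delta> r"
        using that D(2)[of r] by (simp add: dist_commute)
      then show ?thesis using c(2) that by blast
    qed
    then have "ball x D \<in> \<O>"
      unfolding \<O>_def by blast
    then show ?thesis using D(1) by (meson UnionI centre_in_ball)
  qed
  then have cov: "E \<subseteq> \<Union>\<O>" by blast
  have opO: "open U" if "U \<in> \<O>" for U
    using that by (simp add: \<O>_def)
  obtain \<P> where P0: "\<forall>r\<le>n. finite (\<P> r) \<and> pairwise disjnt (\<P> r) \<and>
       (\<forall>P\<in>\<P> r. compact P \<and> P \<subseteq> E \<and> (\<exists>U\<in>\<O>. P \<subseteq> U))" and Pcov: "E \<subseteq> (\<Union>r\<le>n. \<Union>(\<P> r))"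
  proof -
    have "\<exists>\<P>. (\<forall>r\<le>n. finite (\<P> r) \<and> pairwise disjnt (\<P> r) \<and>
       (\<forall>P\<in>\<P> r. compact P \<and> P \<subseteq> E \<and> (\<exists>U\<in>\<O>. P \<subseteq> U))) \<and> E \<subseteq> (\<Union>r\<le>n. \<Union>(\<P> r))"
      by (rule coloured_refinement[OF dim X_open E _ cov]) (fact opO)
    then show ?thesis using that by (elim exE conjE)
  qed
  have P1: "finite (\<P> r)" "pairwise disjnt (\<P> r)" if "r \<le> n" for r
    using P0[rule_format, OF that] by simp_all
  have P2: "compact P" "P \<subseteq> E" "\<exists>U\<in>\<O>. P \<subseteq> U" if "r \<le> n" "P \<in> \<P> r" for r P
    using P0[rule_format, OF that(1)] that(2) by simp_all
  have "\<exists>w'. cinv w' \<and> (\<forall>x. \<bar>w' x - w r x\<bar> \<le> e) \<and> (\<forall>P\<in>\<P> r. \<forall>x\<in>P. (h r x, w' (h r x)) \<notin> A r)"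
    if r: "r \<le> n" for r
  proof -
    have "\<forall>P\<in>\<P> r. \<exists>c. \<forall>y\<in>P. ok r c y"
    proof
      fix P assume P: "P \<in> \<P> r"
      then obtain U where U: "P \<subseteq> E" "U \<in> \<O>" "P \<subseteq> U"
        using P2[OF r P] by blast
      then obtain c where "\<forall>r\<le>n. \<forall>y\<in>U \<inter> E. ok r (c r) y"
        unfolding \<O>_def by blast
      then have "\<forall>y\<in>P. ok r (c r) y"
        using U r by blast
      then show "\<exists>c. \<forall>y\<in>P. ok r c y" by blast
    qed
    then obtain c where c: "\<And>P y. P \<in> \<P> r \<Longrightarrow> y \<in> P \<Longrightarrow> ok r (c P) y"
      by metis
    have "\<exists>w'. cinv w' \<and> (\<forall>x. \<bar>w' x - w r x\<bar> \<le> e) \<and> (\<forall>P\<in>\<P> r. \<forall>x\<in>h r ` P. w' x = c P)"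
    proof (rule assign_constants[OF w e])
      show "finite (\<P> r)" using P1[OF r] by blast
      fix P assume P: "P \<in> \<P> r"
      note PE = P2(1,2)[OF r P]
      have "compact (h r ` P)"
        by (rule compact_continuous_image[OF continuous_on_subset[OF h(1)[OF r] PE(2)] PE(1)])
      then show "compact (h r ` P) \<and> h r ` P \<subseteq> X"
        using h(2)[OF r] PE(2) by blast
      show "\<bar>c P - w r x\<bar> < e" if "x \<in> h r ` P" for x
        using that c[OF P] by (auto simp: ok_def)
    next
      fix P P' assume P: "P \<in> \<P> r" "P' \<in> \<P> r" "P \<noteq> P'"
      have sub: "P \<subseteq> E" "P' \<subseteq> E" using P2(2)[OF r] P by blast+
      have dis: "P \<inter> P' = {}" using pairwiseD[OF P1(2)[OF r] P] by (simp add: disjnt_def)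
      show "h r ` P \<inter> sat (h r ` P') = {}"
      proof (rule ccontr)
        assume "h r ` P \<inter> sat (h r ` P') \<noteq> {}"
        then obtain x x' g where x: "x \<in> P" "x' \<in> P'" "g \<in> carrier G" "h r x = act g (h r x')"
          by (auto simp: sat_def)
        have xE: "x \<in> E" "x' \<in> E" using sub x by blast+
        have "x = act g x'" using hinj[OF r xE(2,1) x(3,4)] .
        then have "x = x'" using piece[OF xE(2) x(3)] xE(1) by simp
        then show False using dis x by blast
      qed
    qed
    then obtain w' where w': "cinv w'" "\<forall>x. \<bar>w' x - w r x\<bar> \<le> e" "\<forall>P\<in>\<P> r. \<forall>x\<in>h r ` P. w' x = c P"
      by blast
    have "(h r x, w' (h r x)) \<notin> A r" if "P \<in> \<P> r" "x \<in> P" for P x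
    proof -
      have "w' (h r x) = c P" using w'(3) that by blast
      then show ?thesis using c[OF that] by (simp add: ok_def)
    qed
    then show ?thesis using w'(1,2) by blast
  qed
  then obtain w' where w': "\<And>r. r \<le> n \<Longrightarrow> cinv (w' r)" "\<And>r x. r \<le> n \<Longrightarrow> \<bar>w' r x - w r x\<bar> \<le> e"
      "\<And>r P x. r \<le> n \<Longrightarrow> P \<in> \<P> r \<Longrightarrow> x \<in> P \<Longrightarrow> (h r x, w' r (h r x)) \<notin> A r"
    by metis
  define v' where "v' r i = (if r \<le> n \<and> i = j r then w' r else v r i)" for r i
  have "admissible v'"
    using v w'(1) by (auto simp: admissible_def v'_def)
  moreover have "near e v v'"
    using w'(2) e by (auto simp: near_def v'_def w_def)
  moreover have "avoids n j h A E v'"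
    unfolding avoids_def
  proof
    fix x assume "x \<in> E"
    then obtain r P where r: "r \<le> n" "P \<in> \<P> r" "x \<in> P"
      using Pcov by blast
    then show "\<exists>r\<le>n. (h r x, v' r (j r) (h r x)) \<notin> A r"
      using w'(3)[OF r] by (intro exI[of _ r]) (simp add: v'_def)
  qed
  ultimately show ?thesis by blast
qed

section \<open>Stabilizers and their strata\<close>

definition stab :: "'a \<Rightarrow> 'g set" where
  "stab x = {g \<in> carrier G. act g x = x}"

text \<open>If \<open>y\<close> and \<open>act g y\<close> are both close to \<open>x\<close>,
  isometry brings \<open>act g x\<close> close to \<open>x\<close>, and the gap of the orbit forces
  equality.\<close>

lemma stab_locally:
  assumes "x \<in> X"
  shows "\<exists>s>0. \<forall>y\<in>ball x s. \<forall>g\<in>carrier G. act g y \<in> ball x s \<longrightarrow> g \<in> stab x"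
proof -
  obtain s where s: "s > 0" "\<forall>g\<in>carrier G. dist x (act g x) < s \<longrightarrow> act g x = x"
    using separated[OF assms] by blast
  have "g \<in> stab x" if "y \<in> ball x (s/2)" "g \<in> carrier G" "act g y \<in> ball x (s/2)" for y g
  proof -
    have "dist x (act g x) \<le> dist x (act g y) + dist (act g y) (act g x)"
      by (rule dist_triangle)
    also have "\<dots> < s"
      using that by (simp add: dist_commute)
    finally show ?thesis
      using s(2) that(2) by (simp add: stab_def)
  qed
  then show ?thesis
    using s(1) by (intro exI[of _ "s/2"]) auto
qed

lemma finite_stab:
  assumes "x \<in> X"
  shows "finite (stab x)"
proof -
  obtain r where r: "r > 0" "finite {g \<in> carrier G. dist x (act g x) < r}"
    using X_proper[OF assms] by blast
  show ?thesis
    by (rule finite_subset[OF _ r(2)]) (use r(1) in \<open>auto simp: stab_def\<close>)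
qed

lemma stab_nbhd:
  assumes "x \<in> X"
  obtains s where "s > 0" "\<And>y g. \<lbrakk>y \<in> ball x s; g \<in> carrier G; act g y \<in> ball x s\<rbrakk> \<Longrightarrow> g \<in> stab x"
    "\<And>y. y \<in> ball x s \<Longrightarrow> stab y \<subseteq> stab x \<and> card (stab y) \<le> card (stab x)"
proof -
  obtain s where s: "s > 0" "\<forall>y\<in>ball x s. \<forall>g\<in>carrier G. act g y \<in> ball x s \<longrightarrow> g \<in> stab x"
    using stab_locally[OF assms] by blast
  have sub: "stab y \<subseteq> stab x" if "y \<in> ball x s" for y
    using s(2) that by (auto simp: stab_def)
  show ?thesis
    by (rule that[OF s(1)]) (use s(2) sub card_mono[OF finite_stab[OF assms]] in auto)
qed

text \<open>Perturbations must be \<open>G\<close>-invariant, so the dimension of the quotient by \<open>G\<close> matters. On a stratum of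
  constant stabilizer order small pieces embed into the quotient; the strata are treated in the order
  of decreasing stabilizer order.\<close>
lemma generic_avoids:
  assumes dim: "covering_dim_le X n" and E: "compact E" "E \<subseteq> X"
    and h: "\<And>r. r \<le> n \<Longrightarrow> continuous_on E (h r)" "\<And>r. r \<le> n \<Longrightarrow> h r ` E \<subseteq> X"
    and hinj: "\<And>r x y g. \<lbrakk>r \<le> n; x \<in> E; y \<in> E; g \<in> carrier G; h r y = act g (h r x)\<rbrakk> \<Longrightarrow> y = act g x"
    and A: "\<And>r. r \<le> n \<Longrightarrow> closed (A r)" "\<And>r x. r \<le> n \<Longrightarrow> finite {a. (x, a) \<in> A r}"
  shows "generic (avoids n j h A E)"
proof -
  have piece: "generic (avoids n j h A F)"
    if F: "compact F" "F \<subseteq> E" "\<And>x g. \<lbrakk>x \<in> F; g \<in> carrier G; act g x \<in> F\<rbrakk> \<Longrightarrow> act g x = x" for F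
    unfolding generic_def
  proof (intro allI impI)
    fix v :: "nat \<Rightarrow> nat \<Rightarrow> 'a \<Rightarrow> real" and e :: real
    assume v: "admissible v" and e: "e > 0"
    have hF: "continuous_on F (h r)" if "r \<le> n" for r
      by (rule continuous_on_subset[OF h(1)[OF that] F(2)])
    have FX: "F \<subseteq> X" using F(2) E(2) by blast
    have imF: "h r ` F \<subseteq> X" if "r \<le> n" for r
      using h(2)[OF that] F(2) by blast
    have injF: "y = act g x" if "r \<le> n" "x \<in> F" "y \<in> F" "g \<in> carrier G" "h r y = act g (h r x)" for r x y g
      using hinj[of r x y g] that F(2) by blast
    have "\<exists>v'. admissible v' \<and> near e v v' \<and> avoids n j h A F v'"
      by (rule avoids_dense_piece[OF dim F(1) FX _ _ _ _ _ _ v e]) (fact hF imF injF A F(3))+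
    then obtain v' where v': "admissible v'" "near e v v'" "avoids n j h A F v'"
      by blast
    have "\<exists>U d. open U \<and> F \<subseteq> U \<and> d > 0 \<and> (\<forall>v''. near d v' v'' \<longrightarrow> avoids n j h A (F \<inter> U) v'')"
      by (rule avoids_robust[OF F(1) subset_refl _ _ v'(1,3)]) (fact hF A(1))+
    then obtain U d where U: "F \<subseteq> U" "d > 0" "\<forall>v''. near d v' v'' \<longrightarrow> avoids n j h A (F \<inter> U) v''"
      by blast
    have "F \<inter> U = F" using U(1) by blast
    then show "\<exists>v' d. admissible v' \<and> d > 0 \<and> near e v v' \<and> (\<forall>v''. admissible v'' \<longrightarrow> near d v' v'' \<longrightarrow> avoids n j h A F v'')"
      using v' U(2,3) by (intro exI[of _ v'] exI[of _ d]) simp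
  qed
  have strata: "generic (avoids n j h A F)"
    if "compact F" "F \<subseteq> E" "\<forall>x\<in>F. card (stab x) \<le> m" for m F
    using that
  proof (induction m arbitrary: F)
    case 0
    have "F = {}"
    proof (rule ccontr)
      assume "F \<noteq> {}"
      then obtain x where x: "x \<in> F" by blast
      then have "finite (stab x)" "\<one> \<in> stab x"
        using finite_stab 0(2) E(2) by (auto simp: stab_def)
      then have "card (stab x) \<noteq> 0" by auto
      then show False using 0(3) x by auto
    qed
    then have "avoids n j h A F = (\<lambda>_. True)"
      by (auto simp: avoids_def)
    then show ?case using generic_True by simp
  next
    case (Suc m)
    have FX: "F \<subseteq> X" using Suc.prems(2) E(2) by blast
    define nb where "nb x s \<longleftrightarrow>
        (\<forall>y g. y \<in> ball x s \<longrightarrow> g \<in> carrier G \<longrightarrow> act g y \<in> ball x s \<longrightarrow> g \<in> stab x) \<and>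
        (\<forall>y\<in>ball x s. stab y \<subseteq> stab x \<and> card (stab y) \<le> card (stab x))" for x s
    have "\<exists>s>0. nb x s" if "x \<in> F" for x
    proof -
      have "x \<in> X" using FX that by blast
      then show ?thesis unfolding nb_def by (rule stab_nbhd) blast
    qed
    then obtain s where nb: "\<And>x. x \<in> F \<Longrightarrow> s x > 0" "\<And>x. x \<in> F \<Longrightarrow> nb x (s x)"
      by metis
    have s: "\<And>x. x \<in> F \<Longrightarrow> s x > 0"
        "\<And>x y g. \<lbrakk>x \<in> F; y \<in> ball x (s x); g \<in> carrier G; act g y \<in> ball x (s x)\<rbrakk> \<Longrightarrow> g \<in> stab x"
        "\<And>x y. \<lbrakk>x \<in> F; y \<in> ball x (s x)\<rbrakk> \<Longrightarrow> stab y \<subseteq> stab x"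
        "\<And>x y. \<lbrakk>x \<in> F; y \<in> ball x (s x)\<rbrakk> \<Longrightarrow> card (stab y) \<le> card (stab x)"
      using nb unfolding nb_def by blast+
    \<comment> \<open>The stabilizer order does not increase near a point, so removing balls around
      the points of lower order leaves exactly the points of order \<open>Suc m\<close>, as a
      compact set.\<close>
    define T where "T = F - (\<Union>x\<in>{x\<in>F. card (stab x) \<le> m}. ball x (s x))"
    have T: "compact T" "T \<subseteq> F"
      unfolding T_def using Suc.prems(1) by (auto intro!: compact_diff)
    have cT: "card (stab x) = Suc m" if "x \<in> T" for x
    proof -
      have "x \<in> F" "x \<notin> ball x (s x) \<or> \<not> card (stab x) \<le> m"
        using that unfolding T_def by blast+
      then show ?thesis
        using s(1)[of x] Suc.prems(3) by (metis centre_in_ball le_SucE)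
    qed
    have Tcl: "x \<in> T" if "x \<in> F" "card (stab x) = Suc m" for x
    proof -
      have "x \<notin> ball y (s y)" if "y \<in> F" "card (stab y) \<le> m" for y
        using s(4)[OF that(1), of x] that(2) \<open>card (stab x) = Suc m\<close> by auto
      then show ?thesis using that(1) unfolding T_def by blast
    qed
    have "T \<subseteq> (\<Union>x\<in>T. ball x (s x / 2))"
      using s(1) T(2) by fastforce
    then obtain C where C: "C \<subseteq> T" "finite C" "T \<subseteq> (\<Union>x\<in>C. ball x (s x / 2))"
      using compactE_image[OF T(1), of T "\<lambda>x. ball x (s x / 2)"] by auto
    have "generic (avoids n j h A (T \<inter> cball x (s x / 2)))" if x: "x \<in> C" for x
    proof (rule piece)
      show "compact (T \<inter> cball x (s x / 2))"
        using T(1) by (intro compact_Int_closed) auto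
      show "T \<inter> cball x (s x / 2) \<subseteq> E"
        using T(2) Suc.prems(2) by blast
      fix y g assume y: "y \<in> T \<inter> cball x (s x / 2)" "g \<in> carrier G" "act g y \<in> T \<inter> cball x (s x / 2)"
      have xT: "x \<in> T" "x \<in> F" using x C(1) T(2) by blast+
      have "s x > 0" using s(1) xT by blast
      then have yb: "y \<in> ball x (s x)" "act g y \<in> ball x (s x)"
        using y by auto
      \<comment> \<open>Stabilizers near \<open>x\<close> are contained in that of \<open>x\<close>;
        on the stratum the orders agree, so they are equal. An element that returns \<open>y\<close>
        to the ball therefore fixes \<open>y\<close>.\<close>
      have "card (stab y) = card (stab x)"
        using cT xT(1) y(1) by simp
      moreover have "finite (stab x)"
        using finite_stab FX xT(2) by blast
      ultimately have "stab y = stab x"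
        using s(3)[OF xT(2) yb(1)] by (intro card_subset_eq) auto
      then have "g \<in> stab y"
        using s(2)[OF xT(2) yb(1) y(2) yb(2)] by simp
      then show "act g y = y" by (simp add: stab_def)
    qed
    then have "generic (\<lambda>v. \<forall>x\<in>C. avoids n j h A (T \<inter> cball x (s x / 2)) v)"
      by (rule generic_ball[OF C(2)])
    then have gT: "generic (avoids n j h A T)"
    proof (rule generic_mono)
      fix v assume v: "\<forall>x\<in>C. avoids n j h A (T \<inter> cball x (s x / 2)) v"
      show "avoids n j h A T v"
        unfolding avoids_def
      proof
        fix y assume y: "y \<in> T"
        then obtain x where x: "x \<in> C" "y \<in> ball x (s x / 2)" using C(3) by blast
        then have "y \<in> T \<inter> cball x (s x / 2)" using y by simp
        then show "\<exists>r\<le>n. (h r y, v r (j r) (h r y)) \<notin> A r"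
          using v x(1) unfolding avoids_def by blast
      qed
    qed
    show ?case
      unfolding generic_def
    proof (intro allI impI)
      fix v :: "nat \<Rightarrow> nat \<Rightarrow> 'a \<Rightarrow> real" and e :: real
      assume v: "admissible v" and e: "e > 0"
      have "e/2 > 0" using e by simp
      then obtain v1 d1 where 1: "admissible v1" "d1 > 0" "near (e/2) v v1"
          "\<And>v''. admissible v'' \<Longrightarrow> near d1 v1 v'' \<Longrightarrow> avoids n j h A T v''"
        using genericE[OF gT v] by blast
      have hF: "continuous_on F (h r)" if "r \<le> n" for r
        by (rule continuous_on_subset[OF h(1)[OF that] Suc.prems(2)])
      have T1: "avoids n j h A T v1"
        using 1(4)[OF 1(1) near_refl] 1(2) by simp
      have "\<exists>U d. open U \<and> T \<subseteq> U \<and> d > 0 \<and> (\<forall>v''. near d v1 v'' \<longrightarrow> avoids n j h A (F \<inter> U) v'')"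
        by (rule avoids_robust[OF T _ _ 1(1) T1]) (fact hF A(1))+
      then obtain U d2 where 2: "open U" "T \<subseteq> U" "d2 > 0"
          "\<forall>v''. near d2 v1 v'' \<longrightarrow> avoids n j h A (F \<inter> U) v''"
        by blast
      \<comment> \<open>\<open>generic_conj\<close> does not apply, because the remainder
        \<open>F - U\<close> depends on the perturbation \<open>v1\<close> already chosen.\<close>
      have gR: "generic (avoids n j h A (F - U))"
      proof (rule Suc.IH)
        show "compact (F - U)" using Suc.prems(1) 2(1) by (rule compact_diff)
        show "F - U \<subseteq> E" using Suc.prems(2) by blast
        show "\<forall>x\<in>F - U. card (stab x) \<le> m"
        proof
          fix x assume x: "x \<in> F - U"
          then have "card (stab x) \<noteq> Suc m" using Tcl[of x] 2(2) by blast
          then show "card (stab x) \<le> m" using Suc.prems(3) x by (auto simp: le_Suc_eq)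
        qed
      qed
      have "min (e/2) (d2/2) > 0" using e 2(3) by simp
      then obtain v3 d3 where 3: "admissible v3" "d3 > 0" "near (min (e/2) (d2/2)) v1 v3"
          "\<And>v''. admissible v'' \<Longrightarrow> near d3 v3 v'' \<Longrightarrow> avoids n j h A (F - U) v''"
        using genericE[OF gR 1(1)] by blast
      show "\<exists>v' d. admissible v' \<and> d > 0 \<and> near e v v' \<and> (\<forall>v''. admissible v'' \<longrightarrow> near d v' v'' \<longrightarrow> avoids n j h A F v'')"
      proof (intro exI[of _ v3] exI[of _ "min d3 (d2/2)"] conjI allI impI)
        show "near e v v3" using near_trans[OF 1(3) 3(3)] by simp
        fix v'' assume v'': "admissible v''" "near (min d3 (d2/2)) v3 v''"
        have "avoids n j h A (F \<inter> U) v''"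
          using 2(4) near_trans[OF 3(3) v''(2), of d2] by simp
        moreover have "avoids n j h A (F - U) v''"
          using 3(4)[OF v''(1)] near_mono[OF v''(2), of d3] by simp
        ultimately show "avoids n j h A F v''"
          unfolding avoids_def by blast
      qed (use 3(1,2) 2(3) in auto)
    qed
  qed
  \<comment> \<open>Stabilizer orders are locally bounded, hence bounded on the compact set
    \<open>E\<close>; this starts the induction over strata.\<close>
  have "\<exists>m. \<forall>x\<in>E. card (stab x) \<le> m"
  proof -
    have "\<exists>s>0. \<forall>y\<in>ball x s. card (stab y) \<le> card (stab x)" if "x \<in> E" for x
    proof -
      have "x \<in> X" using E(2) that by blast
      then show ?thesis by (rule stab_nbhd) blast
    qed
    then obtain s where s: "\<And>x. x \<in> E \<Longrightarrow> s x > 0"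
        "\<And>x y. x \<in> E \<Longrightarrow> y \<in> ball x (s x) \<Longrightarrow> card (stab y) \<le> card (stab x)"
      by metis
    have "E \<subseteq> (\<Union>x\<in>E. ball x (s x))"
      using s(1) by auto
    then obtain C where C: "C \<subseteq> E" "finite C" "E \<subseteq> (\<Union>x\<in>C. ball x (s x))"
      using compactE_image[OF E(1), of E "\<lambda>x. ball x (s x)"] by auto
    have "card (stab y) \<le> (\<Sum>x\<in>C. card (stab x))" if y: "y \<in> E" for y
    proof -
      obtain x where x: "x \<in> C" "y \<in> ball x (s x)" using C(3) y by blast
      have "card (stab y) \<le> card (stab x)" using s(2) x C(1) by blast
      also have "\<dots> \<le> (\<Sum>x\<in>C. card (stab x))"
        using C(2) x(1) by (intro member_le_sum) auto
      finally show ?thesis .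
    qed
    then show ?thesis by blast
  qed
  then obtain m where "\<forall>x\<in>E. card (stab x) \<le> m" by blast
  then show ?thesis
    using strata[OF E(1) subset_refl] by blast
qed

section \<open>Slices\<close>

text \<open>\<open>f y\<close> is the integral over \<open>s\<close> in \<open>[0, a]\<close> of the distance of \<open>fl s y\<close> to the orbit of \<open>z\<close>. Its derivative
  along the flow at \<open>z\<close> is the distance of \<open>fl a z\<close> to the orbit of \<open>z\<close>, which is positive.\<close>
lemma transversal_function:
  assumes z: "z \<in> X" and a: "a > 0" "fl a z \<notin> orb z"
  shows "\<exists>f r t0. cinv f \<and> r > 0 \<and> t0 > 0 \<and>
    (\<forall>y s t. infdist y (orb z) < r \<longrightarrow> - t0 \<le> s \<longrightarrow> s < t \<longrightarrow> t \<le> t0 \<longrightarrow> f (fl s y) < f (fl t y))"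
proof -
  define \<psi> where "\<psi> x = infdist x (orb z)" for x
  have \<psi>c: "continuous_on UNIV (\<lambda>p. \<psi> (fl (u p) (v p)))"
    if "continuous_on UNIV u" "continuous_on UNIV v" for u and v :: "'x::topological_space \<Rightarrow> 'a"
    unfolding \<psi>_def using that by (intro continuous_intros)
  have \<psi>inv: "\<psi> (act g x) = \<psi> x" if "g \<in> carrier G" for g x
    using infdist_orb_act[OF that] by (simp add: \<psi>_def)
  define f where "f y = integral {0..a} (\<lambda>s. \<psi> (fl s y))" for y
  have "continuous_on UNIV (\<lambda>p. \<psi> (fl (snd p) (fst p)))"
    by (intro \<psi>c continuous_intros)
  then have "continuous_on (UNIV \<times> cbox 0 a) (\<lambda>(y, s). \<psi> (fl s y))"
    by (auto simp: case_prod_beta intro: continuous_on_subset)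
  then have "continuous_on UNIV f"
    unfolding f_def box_real[symmetric] by (rule integral_continuous_on_param)
  moreover have f_act: "f (act g y) = f y" if "g \<in> carrier G" for g y
    using that by (simp add: f_def fl_act \<psi>inv)
  ultimately have finv: "cinv f"
    by (simp add: cinv_def invariant_def)
  define W where "W = {p. \<psi> (fl (snd p) (fst p)) < \<psi> (fl (snd p + a) (fst p))}"
  have "open W"
    unfolding W_def by (intro open_Collect_less \<psi>c continuous_intros)
  moreover have "0 < \<psi> (fl a z)"
    using infdist_orb_zero[OF z, of "fl a z"] a(2) infdist_nonneg[of "fl a z" "orb z"]
    by (auto simp: \<psi>_def less_le)
  then have "(z, 0) \<in> W"
    by (simp add: W_def \<psi>_def)
  ultimately obtain Y T where YT: "open Y" "open T" "(z, 0) \<in> Y \<times> T" "Y \<times> T \<subseteq> W"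
    by (rule open_prod_elim)
  obtain r where r: "r > 0" "ball z r \<subseteq> Y"
    using YT(1,3) open_contains_ball by blast
  obtain e where e: "e > 0" "ball 0 e \<subseteq> T"
    using YT(2,3) open_contains_ball by blast
  \<comment> \<open>With half of \<open>a\<close> the integration windows of length \<open>a\<close>
    starting at \<open>s\<close> and at \<open>t\<close> overlap; half of \<open>e\<close> keeps the
    times between them inside \<open>T\<close>.\<close>
  define t0 where "t0 = min (a/2) (e/2)"
  have t0: "t0 > 0" "t0 \<le> a/2" "t0 < e"
    using a(1) e(1) by (auto simp: t0_def)
  have mono: "f (fl s y) < f (fl t y)"
    if y: "dist z y < r" and st: "- t0 \<le> s" "s < t" "t \<le> t0" for y s t
  proof -
    define w where "w x = \<psi> (fl x y)" for x
    have wc: "continuous_on A w" for A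
      unfolding w_def using \<psi>c[of "\<lambda>x::real. x" "\<lambda>_. y"] continuous_on_subset by force
    have wi: "w integrable_on {b..c}" for b c
      by (intro integrable_continuous_interval wc)
    have shift: "integral {b..c} (\<lambda>x. w (x + d)) = integral {b + d..c + d} w" for b c d
      using integral_shift[OF wc, of b c d] by (simp add: o_def)
    have f_eq: "f (fl x y) = integral {x..a + x} w" for x
      using shift[of 0 a x] by (simp add: f_def w_def fl_add[symmetric])
    have le: "t \<le> a + s"
      using st t0 by linarith
    \<comment> \<open>Both values integrate \<open>w\<close> over windows of length
      \<open>a\<close>. The common part cancels, and what remains is to compare \<open>w x\<close>
      with \<open>w (x + a)\<close> for \<open>x\<close> between \<open>s\<close> and
      \<open>t\<close>.\<close>
    have "f (fl s y) = integral {s..t} w + integral {t..a + s} w"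
      unfolding f_eq using Henstock_Kurzweil_Integration.integral_combine[OF _ le wi, of s] st by simp
    moreover have "f (fl t y) = integral {t..a + s} w + integral {a + s..a + t} w"
      unfolding f_eq using Henstock_Kurzweil_Integration.integral_combine[OF le _ wi, of "a + t"] st by simp
    moreover have "integral {a + s..a + t} w = integral {s..t} (\<lambda>x. w (x + a))"
      using shift[of s t a] by (simp add: add.commute)
    moreover have "integral {s..t} w < integral {s..t} (\<lambda>x. w (x + a))"
    proof (rule integral_less_real)
      show "continuous_on {s..t} (\<lambda>x. w (x + a))"
        by (rule continuous_on_compose2[OF wc[of UNIV]]) (auto intro!: continuous_intros)
      show "{s<..<t} \<noteq> {}" using st(2) by simp
      fix x assume "x \<in> {s<..<t}"
      then have "\<bar>x\<bar> < e" using st t0 by auto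
      then have "y \<in> Y" "x \<in> T"
        using r(2) e(2) y by (auto simp: subset_iff dist_real_def)
      then have "(y, x) \<in> W"
        using YT(4) by blast
      then show "w x < w (x + a)"
        by (simp add: W_def w_def)
    qed (rule wc)
    ultimately show ?thesis by linarith
  qed
  have "f (fl s y) < f (fl t y)"
    if y: "infdist y (orb z) < r" and st: "- t0 \<le> s" "s < t" "t \<le> t0" for y s t
  proof -
    obtain p where p: "p \<in> orb z" "dist y p < r"
      by (rule infdist_lessE[OF orb_nonempty y])
    then obtain g where g: "g \<in> carrier G" "dist y (act g z) < r"
      by (auto simp: orb_def)
    then have "dist z (act (inv g) y) < r"
      by (metis dist_act_right dist_commute)
    then have "f (fl s (act (inv g) y)) < f (fl t (act (inv g) y))"
      using mono st by blast
    then show ?thesis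
      using g(1) by (simp add: fl_act f_act)
  qed
  then show ?thesis
    using finv r(1) t0(1) by blast
qed

text \<open>The last clause, a flow box property, may fail at the rim of \<open>S\<close>, which is where \<open>q\<close> is \<open>- 1\<close>.\<close>
definition slice :: "real \<Rightarrow> 'a set \<Rightarrow> 'a set \<Rightarrow> ('a \<Rightarrow> real) \<Rightarrow> bool" where
  "slice \<Lambda> S S0 q \<longleftrightarrow>
    closed S \<and> compact S0 \<and> S0 \<subseteq> X \<and> S = sat S0 \<and>
    finite {g \<in> carrier G. act g ` S0 \<inter> S0 \<noteq> {}} \<and>
    (\<forall>g\<in>carrier G. act g ` S0 \<inter> S0 \<noteq> {} \<longrightarrow> act g ` S0 = S0) \<and>
    (\<exists>s>0. \<forall>x\<in>S0. \<forall>y\<in>S. dist x y < s \<longrightarrow> y \<in> S0) \<and>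
    (\<forall>x\<in>S. \<forall>t. fl t x \<in> S \<longrightarrow> \<bar>t\<bar> \<le> \<Lambda> \<longrightarrow> t = 0) \<and>
    cinv q \<and> (\<forall>x. \<bar>q x\<bar> \<le> 1) \<and>
    (\<forall>y\<in>S. - 1 < q y \<longrightarrow> (\<forall>e>0. \<exists>d>0. \<forall>y'. dist y y' < d \<longrightarrow> (\<exists>t. \<bar>t\<bar> < e \<and> fl t y' \<in> S)))"

text \<open>Inverting the group element extends the absence of returns to negative times. The
  distance to the orbit is then positive and continuous on a compact set of times.\<close>

lemma far_from_orbit:
  assumes z: "z \<in> X" and t0: "0 < t0"
    and \<Lambda>: "\<And>t. \<lbrakk>0 < t; t \<le> \<Lambda>\<rbrakk> \<Longrightarrow> fl t z \<notin> orb z"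
  shows "\<exists>e>0. \<forall>t. t0 \<le> \<bar>t\<bar> \<longrightarrow> \<bar>t\<bar> \<le> \<Lambda> \<longrightarrow> e \<le> infdist (fl t z) (orb z)"
proof -
  define T where "T = {-\<Lambda>..-t0} \<union> {t0..\<Lambda>}"
  have notin: "fl t z \<notin> orb z" if t: "t \<in> T" for t
  proof
    assume "fl t z \<in> orb z"
    then obtain g where g: "g \<in> carrier G" "fl t z = act g z" by (auto simp: orb_def)
    have "fl (- t) z = fl (- t) (act (inv g) (act g z))" using g by simp
    also have "\<dots> = act (inv g) (fl (- t) (fl t z))" using g by (simp add: fl_act)
    also have "\<dots> = act (inv g) z" by simp
    finally have "fl (- t) z \<in> orb z" using g by (auto simp: orb_def)
    then show False
      using \<open>fl t z \<in> orb z\<close> \<Lambda>[of t] \<Lambda>[of "- t"] t t0 by (auto simp: T_def)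
  qed
  show ?thesis
  proof (cases "T = {}")
    case True
    then show ?thesis
      using t0 by (intro exI[of _ 1]) (auto simp: T_def abs_le_iff abs_if split: if_splits)
  next
    case False
    have "compact T" unfolding T_def by auto
    moreover have "continuous_on T (\<lambda>t. infdist (fl t z) (orb z))"
      by (intro continuous_intros)
    ultimately obtain t where t: "t \<in> T" "\<forall>u\<in>T. infdist (fl t z) (orb z) \<le> infdist (fl u z) (orb z)"
      using continuous_attains_inf[OF _ False] by blast
    have "infdist (fl t z) (orb z) \<noteq> 0"
      using notin[OF t(1)] infdist_orb_zero[OF z] by blast
    then have "0 < infdist (fl t z) (orb z)"
      using infdist_nonneg[of "fl t z" "orb z"] by simp
    moreover have "u \<in> T" if "t0 \<le> \<bar>u\<bar>" "\<bar>u\<bar> \<le> \<Lambda>" for u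
      using that by (auto simp: T_def)
    ultimately show ?thesis using t(2) by blast
  qed
qed

text \<open>The slice is a level set of the transversal function, cut off near the orbit of
  \<open>z\<close>. A return before time \<open>t0\<close> contradicts strict monotonicity along the
  flow. A return between \<open>t0\<close> and \<open>\<Lambda>\<close> contradicts uniform
  continuity, since \<open>fl t z\<close> keeps distance \<open>e\<close> from the orbit of
  \<open>z\<close>. The part \<open>S0\<close> around \<open>z\<close> itself is preserved by the
  stabilizer of \<open>z\<close> and returns to itself under no other element.\<close>

lemma slice_exists:
  assumes z: "z \<in> X" and \<Lambda>: "0 < \<Lambda>" "\<And>t. \<lbrakk>0 < t; t \<le> \<Lambda>\<rbrakk> \<Longrightarrow> fl t z \<notin> orb z"
  shows "\<exists>S S0 q. slice \<Lambda> S S0 q \<and> z \<in> S \<and> q z = 1"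
proof -
  define \<psi> where "\<psi> x = infdist x (orb z)" for x
  have \<psi>c: "continuous_on A \<psi>" for A
    unfolding \<psi>_def by (intro continuous_intros)
  have \<psi>inv: "\<psi> (act g x) = \<psi> x" if "g \<in> carrier G" for g x
    using infdist_orb_act[OF that] by (simp add: \<psi>_def)
  have \<psi>z: "\<psi> z = 0" by (simp add: \<psi>_def)
  obtain f r1 t0 where f: "cinv f" "r1 > 0" "t0 > 0"
      "\<And>y s t. \<lbrakk>\<psi> y < r1; - t0 \<le> s; s < t; t \<le> t0\<rbrakk> \<Longrightarrow> f (fl s y) < f (fl t y)"
    using transversal_function[OF z \<Lambda>(1) \<Lambda>(2)[OF \<Lambda>(1) order_refl]] unfolding \<psi>_def by blast
  have fc: "continuous_on A f" for A
    using f(1) continuous_on_subset unfolding cinv_def by blast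
  have finv: "f (act g x) = f x" if "g \<in> carrier G" for g x
    using f(1) that by (simp add: cinv_def invariant_def)
  obtain r2 where r2: "r2 > 0" "compact (cball z r2)" "cball z r2 \<subseteq> X"
    using X_cball[OF z] by blast
  obtain s where s: "s > 0" "\<forall>g\<in>carrier G. dist z (act g z) < s \<longrightarrow> act g z = z"
    using separated[OF z] by blast
  obtain e where e: "e > 0" "\<And>t. t0 \<le> \<bar>t\<bar> \<Longrightarrow> \<bar>t\<bar> \<le> \<Lambda> \<Longrightarrow> e \<le> \<psi> (fl t z)"
    using far_from_orbit[OF z f(3) \<Lambda>(2)] unfolding \<psi>_def by blast
  obtain \<delta> where \<delta>: "\<delta> > 0" "\<And>x y t. \<bar>t\<bar> \<le> \<Lambda> \<Longrightarrow> dist x y \<le> \<delta> \<Longrightarrow> dist (fl t x) (fl t y) \<le> e/3"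
    using fl_unif[OF \<Lambda>(1), of "e/3"] e(1) by auto
  \<comment> \<open>The entries serve, in order, monotonicity of \<open>f\<close>, compactness,
    disjointness of distinct translates, and the last two the exclusion of late returns.\<close>
  define r where "r = Min {r1/2, r2, s/4, \<delta>, e/3}"
  have r: "r > 0" "r < r1" "r \<le> r2" "4 * r \<le> s" "r \<le> \<delta>" "r \<le> e/3"
    using f(2) r2(1) s(1) \<delta>(1) e(1) by (auto simp: r_def)
  define S0 where "S0 = {x. dist z x \<le> r \<and> f x = f z}"
  define S where "S = {x. \<psi> x \<le> r \<and> f x = f z}"
  \<comment> \<open>This is 1 on the orbit of \<open>z\<close> and reaches \<open>- 1\<close>
    exactly where \<open>\<psi>\<close> is at least \<open>r\<close>, that is, from the rim of the
    slice outwards.\<close>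
  define q where "q x = max (- 1) (1 - 2 * \<psi> x / r)" for x
  have att: "\<exists>g\<in>carrier G. dist x (act g z) \<le> r" if "\<psi> x \<le> r" for x
  proof -
    have "infdist x (orb z) < s / 2" using that r(1,4) by (simp add: \<psi>_def)
    then obtain g where "g \<in> carrier G" "dist x (act g z) = infdist x (orb z)"
      using infdist_orb_attained[OF s(2)] by blast
    then show ?thesis
      using that by (intro bexI[of _ g]) (simp_all add: \<psi>_def)
  qed
  have S_sat: "S = sat S0"
  proof
    show "S \<subseteq> sat S0"
    proof
      fix x assume x: "x \<in> S"
      then obtain g where g: "g \<in> carrier G" "dist x (act g z) \<le> r"
        using att by (auto simp: S_def)
      have "dist z (act (inv g) x) \<le> r"
        using g by (metis dist_act_right dist_commute)
      then have "act (inv g) x \<in> S0"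
        using x g(1) by (simp add: S0_def S_def finv)
      then have "act g (act (inv g) x) \<in> sat S0"
        using g(1) unfolding sat_def by blast
      then show "x \<in> sat S0" using g(1) by simp
    qed
    have "S0 \<subseteq> S"
    proof
      fix x assume "x \<in> S0"
      then show "x \<in> S"
        using infdist_le2[OF orb_refl, of x z r] by (simp add: S0_def S_def \<psi>_def dist_commute)
    qed
    then show "sat S0 \<subseteq> S"
      by (auto simp: sat_def S_def \<psi>inv finv)
  qed
  have "closed S"
  proof -
    have "S = {x. \<psi> x \<le> r} \<inter> {x. f x = f z}" by (auto simp: S_def)
    then show ?thesis
      by (auto intro!: closed_Int closed_Collect_le closed_Collect_eq \<psi>c fc continuous_intros)
  qed
  moreover have "compact S0"
  proof -
    have "closed {x. f x = f z}"
      by (intro closed_Collect_eq fc continuous_intros)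
    moreover have "S0 = cball z r \<inter> {x. f x = f z}"
      by (auto simp: S0_def)
    moreover have "compact (cball z r)"
      using compact_Int_closed[OF r2(2), of "cball z r"] r(3) by (simp add: Int_absorb1 subset_cball)
    ultimately show ?thesis by (metis compact_Int_closed)
  qed
  moreover have "S0 \<subseteq> X"
    using r(3) r2(3) by (auto simp: S0_def subset_iff)
  moreover have meet: "g \<in> stab z"
    if "g \<in> carrier G" "x \<in> S0" "act g y \<in> S" "y \<in> S0" "dist x (act g y) < r" for g x y
  proof -
    have "dist z (act g z) \<le> dist z x + dist x (act g y) + dist (act g y) (act g z)"
      using dist_triangle[of z "act g z" x] dist_triangle[of x "act g z" "act g y"] by linarith
    also have "\<dots> < s"
      using that r(1,4) by (simp add: S0_def dist_commute)
    finally show ?thesis using s(2) that(1) by (simp add: stab_def)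
  qed
  have fix_S0: "act g ` S0 = S0" if g: "g \<in> stab z" for g
  proof -
    have le: "act h ` S0 \<subseteq> S0" if "h \<in> stab z" for h
    proof
      fix y assume "y \<in> act h ` S0"
      then obtain x where x: "y = act h x" "x \<in> S0" by blast
      have h: "h \<in> carrier G" "act h z = z" using that by (auto simp: stab_def)
      have "dist z (act h x) = dist z x"
        using act_dist[OF h(1), of z x] h(2) by simp
      then show "y \<in> S0" using x h by (simp add: S0_def finv)
    qed
    have gc: "g \<in> carrier G" "act g z = z" using g by (auto simp: stab_def)
    then have "act (inv g) z = z" using act_inv(1)[of g z] by simp
    then have "inv g \<in> stab z" using gc by (simp add: stab_def)
    then have "act g ` (act (inv g) ` S0) \<subseteq> act g ` S0"
      using le by blast
    then show ?thesis
      using le[OF g] gc(1) by (auto simp: image_image)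
  qed
  have meet': "g \<in> stab z" if g: "g \<in> carrier G" "act g ` S0 \<inter> S0 \<noteq> {}" for g
  proof -
    obtain y where y: "y \<in> S0" "act g y \<in> S0" using g(2) by blast
    then have "act g y \<in> S" using S_sat subset_sat by blast
    then show ?thesis using meet[OF g(1) y(2) _ y(1)] r(1) by simp
  qed
  then have "{g \<in> carrier G. act g ` S0 \<inter> S0 \<noteq> {}} \<subseteq> stab z" by blast
  then have "finite {g \<in> carrier G. act g ` S0 \<inter> S0 \<noteq> {}}"
    using finite_stab[OF z] finite_subset by blast
  moreover have "\<forall>g\<in>carrier G. act g ` S0 \<inter> S0 \<noteq> {} \<longrightarrow> act g ` S0 = S0"
    using meet' fix_S0 by blast
  moreover have "\<forall>x\<in>S0. \<forall>y\<in>S. dist x y < r \<longrightarrow> y \<in> S0"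
  proof (intro ballI impI)
    fix x y assume x: "x \<in> S0" and y: "y \<in> S" and xy: "dist x y < r"
    obtain g u where g: "g \<in> carrier G" "y = act g u" "u \<in> S0"
      using y S_sat by (auto simp: sat_def)
    have "g \<in> stab z" by (rule meet[OF g(1) x _ g(3)]) (use y xy g(2) in auto)
    then show "y \<in> S0" using fix_S0 g(2,3) by blast
  qed
  moreover have "t = 0" if x: "x \<in> S" "fl t x \<in> S" "\<bar>t\<bar> \<le> \<Lambda>" for x t
  proof (rule ccontr)
    assume "t \<noteq> 0"
    obtain g u where g: "g \<in> carrier G" "x = act g u" "u \<in> S0"
      using x(1) S_sat by (auto simp: sat_def)
    have u: "u \<in> S" using g(3) S_sat subset_sat by blast
    have tu: "\<psi> (fl t u) \<le> r" "f (fl t u) = f z"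
      using x(2) g(1,2) by (auto simp: S_def fl_act \<psi>inv finv)
    show False
    proof (cases "\<bar>t\<bar> < t0")
      case True
      have "f (fl 0 u) = f z" "\<psi> u < r1"
        using u r(2) by (auto simp: S_def)
      then have "t < 0 \<Longrightarrow> f (fl t u) < f (fl 0 u)" "0 < t \<Longrightarrow> f (fl 0 u) < f (fl t u)"
        using f(4)[of u t 0] f(4)[of u 0 t] True by auto
      then show False
        using \<open>t \<noteq> 0\<close> tu(2) \<open>f (fl 0 u) = f z\<close> by linarith
    next
      case False
      have "dist z u \<le> \<delta>" using g(3) r(5) by (simp add: S0_def)
      then have "dist (fl t z) (fl t u) \<le> e/3" using \<delta>(2) x(3) by blast
      then have "\<psi> (fl t z) \<le> \<psi> (fl t u) + e/3"
        using infdist_triangle[of "fl t z" "orb z" "fl t u"] by (simp add: \<psi>_def)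
      then show False
        using e(1) e(2)[of t] False x(3) tu(1) r(6) by linarith
    qed
  qed
  moreover have "cinv q"
    unfolding cinv_def invariant_def q_def using r(1)
    by (auto intro!: continuous_intros \<psi>c simp: \<psi>inv)
  moreover have "\<bar>q x\<bar> \<le> 1" for x
  proof -
    have "0 \<le> 2 * \<psi> x / r"
      using infdist_nonneg[of x "orb z"] r(1) by (simp add: \<psi>_def)
    then show ?thesis by (simp add: q_def)
  qed
  moreover have "\<exists>d>0. \<forall>y'. dist y y' < d \<longrightarrow> (\<exists>t. \<bar>t\<bar> < \<epsilon> \<and> fl t y' \<in> S)"
    if y: "y \<in> S" "- 1 < q y" and \<epsilon>: "\<epsilon> > 0" for y \<epsilon>
  proof -
    have \<psi>y: "\<psi> y < r"
      using y(2) r(1) by (auto simp: q_def field_simps split: if_splits simp: max_def)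
    have c: "continuous_on UNIV (\<lambda>p. \<psi> (fl (snd p) (fst p)))"
      by (rule continuous_on_compose2[OF \<psi>c[of UNIV]]) (auto intro!: continuous_intros)
    have "open {p. \<psi> (fl (snd p) (fst p)) < r}"
      by (intro open_Collect_less c continuous_intros)
    moreover have "(y, 0) \<in> {p. \<psi> (fl (snd p) (fst p)) < r}" using \<psi>y by simp
    ultimately obtain Y T where YT: "open Y" "open T" "(y, 0) \<in> Y \<times> T"
        "Y \<times> T \<subseteq> {p. \<psi> (fl (snd p) (fst p)) < r}"
      by (rule open_prod_elim)
    obtain e1 where e1: "e1 > 0" "ball 0 e1 \<subseteq> T"
      using YT(2,3) open_contains_ball by blast
    define \<eta> where "\<eta> = Min {e1/2, \<epsilon>/2, t0}"
    have \<eta>: "\<eta> > 0" "\<eta> < e1" "\<eta> < \<epsilon>" "\<eta> \<le> t0"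
      using e1(1) \<epsilon> f(3) by (auto simp: \<eta>_def)
    have "f (fl (- \<eta>) y) < f (fl 0 y)" "f (fl 0 y) < f (fl \<eta> y)"
      using f(4)[of y "- \<eta>" 0] f(4)[of y 0 \<eta>] \<psi>y r(2) \<eta> by simp_all
    then have fy: "f (fl (- \<eta>) y) < f z" "f z < f (fl \<eta> y)"
      using y(1) by (auto simp: S_def)
    \<comment> \<open>On \<open>Z\<close> the level \<open>f z\<close> is crossed between the times
      \<open>- \<eta>\<close> and \<open>\<eta>\<close>, and by the choice of \<open>e1\<close> the
      crossing still has \<open>\<psi>\<close> below \<open>r\<close>.\<close>
    define Z where "Z = Y \<inter> {x. f (fl (- \<eta>) x) < f z} \<inter> {x. f z < f (fl \<eta> x)}"
    have fcu: "continuous_on UNIV (\<lambda>x. f (fl t x))" for t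
      by (rule continuous_on_compose2[OF fc[of UNIV]]) (auto intro!: continuous_intros)
    have "open Z"
      unfolding Z_def by (intro open_Int YT(1) open_Collect_less fcu continuous_intros)
    moreover have "y \<in> Z" using fy YT(3) by (simp add: Z_def)
    ultimately obtain d where d: "d > 0" "ball y d \<subseteq> Z"
      using open_contains_ball by blast
    have "\<exists>t. \<bar>t\<bar> < \<epsilon> \<and> fl t y' \<in> S" if "dist y y' < d" for y'
    proof -
      have y': "y' \<in> Z" using d(2) that by auto
      have "continuous_on {-\<eta>..\<eta>} (\<lambda>t. f (fl t y'))"
        by (rule continuous_on_compose2[OF fc[of UNIV]]) (auto intro!: continuous_intros)
      then have "\<exists>t\<ge>-\<eta>. t \<le> \<eta> \<and> f (fl t y') = f z"
        using y' \<eta>(1) by (intro IVT') (auto simp: Z_def)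
      then obtain t where t: "- \<eta> \<le> t" "t \<le> \<eta>" "f (fl t y') = f z" by blast
      have "t \<in> ball 0 e1" using t \<eta>(2) by (auto simp: dist_real_def)
      then have "(y', t) \<in> Y \<times> T" using e1(2) y' by (auto simp: Z_def)
      then have "\<psi> (fl t y') < r" using YT(4) by auto
      then have "fl t y' \<in> S" using t(3) by (simp add: S_def)
      then show ?thesis using t(1,2) \<eta>(3) by (intro exI[of _ t]) auto
    qed
    then show ?thesis using d(1) by blast
  qed
  ultimately have "slice \<Lambda> S S0 q"
    unfolding slice_def using S_sat r(1) by blast
  moreover have "z \<in> S" using r(1) by (simp add: S_def \<psi>z)
  moreover have "q z = 1" by (simp add: q_def \<psi>z)
  ultimately show ?thesis by blast
qed

lemma sat_act_iff: "g \<in> carrier G \<Longrightarrow> act g x \<in> sat A \<longleftrightarrow> x \<in> sat A"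
  using sat_act[of g A] act_inj by (metis image_iff)

text \<open>A window of length \<open>\<Lambda>\<close> contains at most one hit. For closed
  \<open>B\<close> the hits at times in \<open>B\<close> form a closed subset of a compact product,
  so their projection is compact; this projection is the preimage of \<open>B\<close> under the
  hitting time.\<close>

lemma hitting_time:
  assumes S: "closed S" "\<And>x t. \<lbrakk>x \<in> S; fl t x \<in> S; \<bar>t\<bar> \<le> \<Lambda>\<rbrakk> \<Longrightarrow> t = 0"
    and E: "compact E" "\<And>x. x \<in> E \<Longrightarrow> \<exists>t\<in>{a..a + \<Lambda>}. fl t x \<in> S"
  shows "\<exists>\<tau>. continuous_on E \<tau> \<and> (\<forall>x\<in>E. \<forall>t\<in>{a..a + \<Lambda>}. fl t x \<in> S \<longleftrightarrow> t = \<tau> x)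
    \<and> (\<forall>x\<in>E. \<tau> x \<in> {a..a + \<Lambda>})"
proof -
  obtain \<tau> where \<tau>: "\<And>x. x \<in> E \<Longrightarrow> \<tau> x \<in> {a..a + \<Lambda>}" "\<And>x. x \<in> E \<Longrightarrow> fl (\<tau> x) x \<in> S"
    using E(2) by metis
  have uniq: "t = \<tau> x" if x: "x \<in> E" and t: "t \<in> {a..a + \<Lambda>}" "fl t x \<in> S" for x t
  proof -
    have "fl (t - \<tau> x) (fl (\<tau> x) x) = fl t x"
      using fl_add[of "t - \<tau> x" "\<tau> x" x] by simp
    then have "t - \<tau> x = 0"
      using S(2)[OF \<tau>(2)[OF x], of "t - \<tau> x"] t \<tau>(1)[OF x] by auto
    then show ?thesis by simp
  qed
  have "continuous_on E \<tau>"
    unfolding continuous_on_closed_vimage[OF compact_imp_closed[OF E(1)]]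
  proof (intro allI impI)
    fix B :: "real set" assume B: "closed B"
    define C where "C = (E \<times> ({a..a + \<Lambda>} \<inter> B)) \<inter> (\<lambda>p. fl (snd p) (fst p)) -` S"
    have "closed ((\<lambda>p. fl (snd p) (fst p)) -` S)"
      by (intro closed_vimage S(1) continuous_intros)
    moreover have "compact (E \<times> ({a..a + \<Lambda>} \<inter> B))"
      using E(1) B by (intro compact_Times compact_Int_closed) auto
    ultimately have "compact C"
      unfolding C_def by (intro compact_Int_closed)
    then have "compact (fst ` C)"
      by (intro compact_continuous_image continuous_intros)
    moreover have "fst ` C = \<tau> -` B \<inter> E"
    proof
      show "fst ` C \<subseteq> \<tau> -` B \<inter> E"
        using uniq by (auto simp: C_def)
      show "\<tau> -` B \<inter> E \<subseteq> fst ` C"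
      proof
        fix x assume "x \<in> \<tau> -` B \<inter> E"
        then have "(x, \<tau> x) \<in> C" using \<tau>[of x] by (simp add: C_def)
        then show "x \<in> fst ` C" by force
      qed
    qed
    ultimately show "closed (\<tau> -` B \<inter> E)"
      by (simp add: compact_imp_closed)
  qed
  then show ?thesis
    using \<tau> uniq by (intro exI[of _ \<tau>]) blast
qed

end

section \<open>Systems of slices and general position of their weights\<close>

locale slice_system = proper_flow G act fl X
  for G :: "('g, 'b) monoid_scheme" (structure) and act :: "'g \<Rightarrow> 'a::metric_space \<Rightarrow> 'a" and fl X +
  fixes k :: nat and R \<Lambda> :: real and S S0 :: "nat \<Rightarrow> 'a set" and q :: "nat \<Rightarrow> 'a \<Rightarrow> real"
  assumes R: "2 < R" and \<Lambda>: "2 * R + 4 \<le> \<Lambda>"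
    and slices: "\<And>i. i < k \<Longrightarrow> slice \<Lambda> (S i) (S0 i) (q i)"
begin

lemma slice_closed: "i < k \<Longrightarrow> closed (S i)"
  and slice_compact: "i < k \<Longrightarrow> compact (S0 i)"
  and slice_X: "i < k \<Longrightarrow> S0 i \<subseteq> X"
  and slice_sat: "i < k \<Longrightarrow> S i = sat (S0 i)"
  and slice_cinv: "i < k \<Longrightarrow> cinv (q i)"
  and slice_bound: "i < k \<Longrightarrow> \<bar>q i x\<bar> \<le> 1"
  using slices[of i] by (auto simp: slice_def)

lemma slice_no_return:
  assumes "i < k" "x \<in> S i" "fl t x \<in> S i" "\<bar>t\<bar> \<le> \<Lambda>"
  shows "t = 0"
  using slices[OF assms(1)] assms(2-) unfolding slice_def by blast

lemma slice_no_return2: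
  assumes "i < k" "fl s x \<in> S i" "fl t x \<in> S i" "\<bar>s - t\<bar> \<le> \<Lambda>"
  shows "s = t"
proof -
  have "fl (s - t) (fl t x) = fl s x"
    using fl_add[of "s - t" t x] by simp
  then show ?thesis
    using slice_no_return[OF assms(1,3), of "s - t"] assms(2,4) by simp
qed

lemma slice_act: "\<lbrakk>i < k; g \<in> carrier G\<rbrakk> \<Longrightarrow> act g x \<in> S i \<longleftrightarrow> x \<in> S i"
  by (simp add: slice_sat sat_act_iff)

text \<open>The values of the weight at \<open>x\<close> at which the marking below may jump: the threshold \<open>0\<close>, and the
  values for which the blocking radius \<open>R + a\<close> is exactly the time to another slice.\<close>
definition exceptional :: "nat \<Rightarrow> ('a \<times> real) set" where
  "exceptional i = {(x, a). x \<in> S i \<and>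
     (a = 0 \<or> (\<exists>l<i. \<bar>R + a\<bar> \<le> R + 2 \<and> (fl (R + a) x \<in> S l \<or> fl (- (R + a)) x \<in> S l)))}"

definition bad :: "(nat \<Rightarrow> 'a \<Rightarrow> real) \<Rightarrow> 'a set" where
  "bad w = {x. \<exists>i<k. (x, w i x) \<in> exceptional i}"

lemma closed_exceptional:
  assumes "i < k"
  shows "closed (exceptional i)"
proof -
  define B where "B = fst -` S i \<inter> (snd -` {0} \<union> (\<Union>l\<in>{..<i}. {p. \<bar>R + snd p\<bar> \<le> R + 2} \<inter>
      ((\<lambda>p. fl (R + snd p) (fst p)) -` S l \<union> (\<lambda>p. fl (- (R + snd p)) (fst p)) -` S l)))"
  have cl: "closed (S l)" if "l \<le> i" for l
    using slice_closed that assms by simp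
  have "closed (fst -` S i :: ('a \<times> real) set)"
    by (auto intro!: closed_vimage cl continuous_intros)
  moreover have "closed (snd -` {0} :: ('a \<times> real) set)"
    by (auto intro!: closed_vimage continuous_intros)
  moreover have "closed ((\<lambda>p. fl (R + snd p) (fst p)) -` S l)"
      "closed ((\<lambda>p. fl (- (R + snd p)) (fst p)) -` S l)" if "l < i" for l
    using that by (auto intro!: closed_vimage cl continuous_intros)
  moreover have "closed {p::'a \<times> real. \<bar>R + snd p\<bar> \<le> R + 2}"
    by (intro closed_Collect_le continuous_intros)
  ultimately have "closed B"
    unfolding B_def by (intro closed_Int closed_Un closed_UN) auto
  moreover have "exceptional i = B"
    by (auto simp: exceptional_def B_def)
  ultimately show ?thesis by simp
qed

lemma finite_exceptional:
  assumes "i < k"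
  shows "finite {a. (x, a) \<in> exceptional i}"
proof -
  define B where "B l = {a. \<bar>R + a\<bar> \<le> R + 2 \<and> fl (R + a) x \<in> S l}" for l
  define C where "C l = {a. \<bar>R + a\<bar> \<le> R + 2 \<and> fl (- (R + a)) x \<in> S l}" for l
  have sub: "finite D" if "\<And>a b. a \<in> D \<Longrightarrow> b \<in> D \<Longrightarrow> a = b" for D :: "real set"
  proof (cases "D = {}")
    case False
    then obtain a where "a \<in> D" by blast
    then have "D = {a}" using that by blast
    then show ?thesis by simp
  qed simp
  have "finite (B l)" if l: "l < i" for l
  proof (rule sub)
    fix a b assume ab: "a \<in> B l" "b \<in> B l"
    \<comment> \<open>Two times of absolute value at most \<open>R + 2\<close> differ by at most
      \<open>2 * R + 4\<close>, the lower bound required of \<open>\<Lambda>\<close>; so an orbit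
      meets a slice at most once at such times.\<close>
    have "\<bar>(R + a) - (R + b)\<bar> \<le> \<Lambda>" using ab \<Lambda> unfolding B_def mem_Collect_eq by argo
    then have "R + a = R + b"
      using ab l assms by (intro slice_no_return2[of l]) (auto simp: B_def)
    then show "a = b" by simp
  qed
  moreover have "finite (C l)" if l: "l < i" for l
  proof (rule sub)
    fix a b assume ab: "a \<in> C l" "b \<in> C l"
    have "\<bar>- (R + a) - (- (R + b))\<bar> \<le> \<Lambda>" using ab \<Lambda> unfolding C_def mem_Collect_eq by argo
    then have "- (R + a) = - (R + b)"
      using ab l assms by (intro slice_no_return2[of l "- (R + a)" x "- (R + b)"]) (auto simp: C_def)
    then show "a = b" by simp
  qed
  ultimately have "finite ({0} \<union> (\<Union>l<i. B l \<union> C l))" by auto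
  moreover have "{a. (x, a) \<in> exceptional i} \<subseteq> {0} \<union> (\<Union>l<i. B l \<union> C l)"
    by (auto simp: exceptional_def B_def C_def)
  ultimately show ?thesis by (rule finite_subset[rotated])
qed

lemma exceptional_act: "\<lbrakk>i < k; g \<in> carrier G\<rbrakk> \<Longrightarrow> (act g x, a) \<in> exceptional i \<longleftrightarrow> (x, a) \<in> exceptional i"
  unfolding exceptional_def by (simp add: fl_act slice_act cong: conj_cong)

text \<open>On the compact set \<open>E\<close> of starting points that meet all
  \<open>n + 1\<close> slices in their windows, the hitting points depend continuously on the start,
  and the claim becomes an instance of \<open>avoids\<close>. Starting points are taken on a slice
  to make the passage to a hitting point injective modulo \<open>G\<close>: two starts with
  equivalent hitting points would, up to \<open>G\<close>, be two visits of one orbit to slice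
  \<open>i0\<close> within time \<open>\<Lambda>\<close>.\<close>

lemma generic_box:
  assumes dim: "covering_dim_le X n" and i0: "i0 < k" and j: "\<And>r. r \<le> n \<Longrightarrow> j r < k"
  shows "generic (\<lambda>v. \<forall>x\<in>S0 i0. \<not> (\<forall>r\<le>n. \<exists>t\<in>{b r..b r + \<Lambda>}. (fl t x, v r (j r) (fl t x)) \<in> exceptional (j r)))"
proof -
  define H where "H r = fst ` ((S0 i0 \<times> {b r..b r + \<Lambda>}) \<inter> (\<lambda>p. fl (snd p) (fst p)) -` S (j r))" for r
  define E where "E = S0 i0 \<inter> (\<Inter>r\<in>{..n}. H r)"
  have "closed (H r)" if "r \<le> n" for r
  proof -
    have "closed ((\<lambda>p. fl (snd p) (fst p)) -` S (j r))"
      using that by (intro closed_vimage slice_closed j continuous_intros)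
    then have "compact ((S0 i0 \<times> {b r..b r + \<Lambda>}) \<inter> (\<lambda>p. fl (snd p) (fst p)) -` S (j r))"
      using slice_compact[OF i0] by (intro compact_Int_closed compact_Times) auto
    then have "compact (H r)"
      unfolding H_def by (intro compact_continuous_image continuous_intros)
    then show ?thesis by (rule compact_imp_closed)
  qed
  then have cE: "compact E"
    unfolding E_def using slice_compact[OF i0] by (intro compact_Int_closed) auto
  have "\<exists>\<tau>. continuous_on E \<tau> \<and> (\<forall>x\<in>E. \<forall>t\<in>{b r..b r + \<Lambda>}. fl t x \<in> S (j r) \<longleftrightarrow> t = \<tau> x)
      \<and> (\<forall>x\<in>E. \<tau> x \<in> {b r..b r + \<Lambda>})" if r: "r \<le> n" for r
  proof (rule hitting_time[OF slice_closed[OF j[OF r]] _ cE])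
    show "t = 0" if "x \<in> S (j r)" "fl t x \<in> S (j r)" "\<bar>t\<bar> \<le> \<Lambda>" for x t
      using slice_no_return[OF j[OF r] that] .
    show "\<exists>t\<in>{b r..b r + \<Lambda>}. fl t x \<in> S (j r)" if "x \<in> E" for x
    proof -
      have "x \<in> H r" using that r by (simp add: E_def)
      then show ?thesis unfolding H_def by auto
    qed
  qed
  then obtain \<tau> where \<tau>: "\<And>r. r \<le> n \<Longrightarrow> continuous_on E (\<tau> r)"
      "\<And>r x t. \<lbrakk>r \<le> n; x \<in> E; t \<in> {b r..b r + \<Lambda>}\<rbrakk> \<Longrightarrow> fl t x \<in> S (j r) \<longleftrightarrow> t = \<tau> r x"
      "\<And>r x. \<lbrakk>r \<le> n; x \<in> E\<rbrakk> \<Longrightarrow> \<tau> r x \<in> {b r..b r + \<Lambda>}"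
    by metis
  define h where "h r x = fl (\<tau> r x) x" for r x
  have EX: "E \<subseteq> X" using slice_X[OF i0] by (auto simp: E_def)
  have gen: "generic (avoids n j h (\<lambda>r. exceptional (j r)) E)"
  proof (rule generic_avoids[OF dim cE EX])
    fix r assume r: "r \<le> n"
    show "continuous_on E (h r)"
      unfolding h_def by (intro continuous_intros \<tau>(1) r)
    show "h r ` E \<subseteq> X" using EX by (auto simp: h_def)
    show "closed (exceptional (j r))" by (rule closed_exceptional[OF j[OF r]])
    show "finite {a. (x, a) \<in> exceptional (j r)}" for x by (rule finite_exceptional[OF j[OF r]])
    fix x y g assume xy: "x \<in> E" "y \<in> E" and g: "g \<in> carrier G" and eq: "h r y = act g (h r x)"
    have "y = fl (- \<tau> r y) (act g (fl (\<tau> r x) x))"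
      using eq by (metis h_def fl_minus(1))
    also have "\<dots> = act g (fl (\<tau> r x - \<tau> r y) x)"
      using g fl_add[of "- \<tau> r y" "\<tau> r x" x] by (simp add: fl_act)
    finally have y: "y = act g (fl (\<tau> r x - \<tau> r y) x)" .
    have "x \<in> S i0" "y \<in> S i0"
      using xy slice_sat[OF i0] subset_sat by (auto simp: E_def)
    moreover from this y have "fl (\<tau> r x - \<tau> r y) x \<in> S i0"
      using slice_act[OF i0 g] by metis
    moreover have "\<bar>\<tau> r x - \<tau> r y\<bar> \<le> \<Lambda>"
      using \<tau>(3)[OF r xy(1)] \<tau>(3)[OF r xy(2)] by auto
    ultimately have "\<tau> r x - \<tau> r y = 0"
      using slice_no_return[OF i0] by blast
    then show "y = act g x" using y by simp
  qed
  show ?thesis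
  proof (rule generic_mono[OF gen])
    fix v assume v: "avoids n j h (\<lambda>r. exceptional (j r)) E v"
    show "\<forall>x\<in>S0 i0. \<not> (\<forall>r\<le>n. \<exists>t\<in>{b r..b r + \<Lambda>}. (fl t x, v r (j r) (fl t x)) \<in> exceptional (j r))"
    proof (intro ballI notI)
      fix x assume x: "x \<in> S0 i0" and all: "\<forall>r\<le>n. \<exists>t\<in>{b r..b r + \<Lambda>}. (fl t x, v r (j r) (fl t x)) \<in> exceptional (j r)"
      have AS: "p \<in> S i" if "(p, a) \<in> exceptional i" for p a i
        using that by (auto simp: exceptional_def)
      have "x \<in> H r" if r: "r \<le> n" for r
      proof -
        obtain t where "t \<in> {b r..b r + \<Lambda>}" "fl t x \<in> S (j r)"
          using all r AS by blast
        then show ?thesis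
          unfolding H_def using x by (intro image_eqI[of _ _ "(x, t)"]) auto
      qed
      then have xE: "x \<in> E" using x by (auto simp: E_def)
      obtain r where r: "r \<le> n" "(h r x, v r (j r) (h r x)) \<notin> exceptional (j r)"
        using v xE unfolding avoids_def by blast
      obtain t where t: "t \<in> {b r..b r + \<Lambda>}" "(fl t x, v r (j r) (fl t x)) \<in> exceptional (j r)"
        using all r(1) by blast
      have "t = \<tau> r x"
        using \<tau>(2)[OF r(1) xE t(1)] AS[OF t(2)] by simp
      then show False using t(2) r(2) by (simp add: h_def)
    qed
  qed
qed

text \<open>If every choice fails on a segment, the exceptional point found for \<open>r = 0\<close>
  lies on a slice and can be moved into some \<open>S0 i\<close> by \<open>G\<close>. Seen from
  there, the other exceptional points occur within time \<open>2 * N\<close>, so finitely many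
  combinations of slices and windows of length \<open>\<Lambda>\<close> have to be excluded.\<close>

lemma general_position:
  assumes dim: "covering_dim_le X n" and N: "0 \<le> N"
  shows "\<exists>v. admissible v \<and> (\<forall>r. \<forall>i<k. \<forall>x. \<bar>v r i x - q i x\<bar> \<le> 1/2) \<and>
    (\<forall>z. \<exists>r\<le>n. \<forall>t. \<bar>t\<bar> \<le> N \<longrightarrow> fl t z \<notin> bad (v r))"
proof -
  have \<Lambda>0: "\<Lambda> > 0" using \<Lambda> R by linarith
  define m where "m = \<lceil>2 * N / \<Lambda>\<rceil> + 1"
  define box where "box p = {of_int p * \<Lambda>..of_int p * \<Lambda> + \<Lambda>}" for p :: int
  define I where "I = {..<k} \<times> ({..n} \<rightarrow>\<^sub>E ({..<k} \<times> {-m..m}))"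
  define P where "P ic v \<longleftrightarrow> (\<forall>x\<in>S0 (fst ic). \<not> (\<forall>r\<le>n. \<exists>t\<in>box (snd (snd ic r)).
      (fl t x, v r (fst (snd ic r)) (fl t x)) \<in> exceptional (fst (snd ic r))))" for ic :: "nat \<times> (nat \<Rightarrow> nat \<times> int)" and v
  have "finite I"
    unfolding I_def by (intro finite_cartesian_product finite_PiE) auto
  moreover have "generic (P ic)" if "ic \<in> I" for ic
  proof -
    obtain i0 c where ic: "ic = (i0, c)" by (cases ic)
    have i0: "i0 < k" using that ic by (simp add: I_def)
    have c: "fst (c r) < k" if r: "r \<le> n" for r
    proof -
      have "c r \<in> {..<k} \<times> {-m..m}"
        using \<open>ic \<in> I\<close> ic r unfolding I_def by (auto dest: PiE_mem)
      then show ?thesis by auto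
    qed
    show ?thesis
      using generic_box[OF dim i0, of "\<lambda>r. fst (c r)" "\<lambda>r. of_int (snd (c r)) * \<Lambda>"] c
      unfolding P_def ic box_def by simp
  qed
  ultimately have gen: "generic (\<lambda>v. \<forall>ic\<in>I. P ic v)"
    by (rule generic_ball)
  define v0 :: "nat \<Rightarrow> nat \<Rightarrow> 'a \<Rightarrow> real" where "v0 r i = (if i < k then q i else (\<lambda>_. 0))" for r i
  have "admissible v0"
    using slice_cinv by (auto simp: admissible_def v0_def cinv_def invariant_def)
  then obtain v d where v: "admissible v" "d > 0" "near (1/2) v0 v" "\<And>v''. admissible v'' \<Longrightarrow> near d v v'' \<Longrightarrow> \<forall>ic\<in>I. P ic v''"
    using genericE[OF gen, of v0 "1/2"] by auto
  have vP: "P ic v" if "ic \<in> I" for ic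
    using v(4)[OF v(1) near_refl] v(2) that by auto
  have vinv: "v r i (act g x) = v r i x" if "g \<in> carrier G" for r i g x
    using v(1) that by (simp add: admissible_def cinv_def invariant_def)
  have "\<exists>r\<le>n. \<forall>t. \<bar>t\<bar> \<le> N \<longrightarrow> fl t z \<notin> bad (v r)" for z
  proof (rule ccontr)
    assume "\<not> ?thesis"
    then have "\<forall>r. \<exists>t i. r \<le> n \<longrightarrow> \<bar>t\<bar> \<le> N \<and> i < k \<and> (fl t z, v r i (fl t z)) \<in> exceptional i"
      unfolding bad_def by blast
    then obtain t i where ti: "\<And>r. r \<le> n \<Longrightarrow> \<bar>t r\<bar> \<le> N" "\<And>r. r \<le> n \<Longrightarrow> i r < k"
        "\<And>r. r \<le> n \<Longrightarrow> (fl (t r) z, v r (i r) (fl (t r) z)) \<in> exceptional (i r)"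
      by metis
    have i0: "i 0 < k" using ti(2) by simp
    have "fl (t 0) z \<in> S (i 0)" using ti(3)[of 0] by (simp add: exceptional_def)
    then obtain g x where g: "g \<in> carrier G" "x \<in> S0 (i 0)" "fl (t 0) z = act g x"
      using slice_sat[OF i0] by (auto simp: sat_def)
    define u where "u r = t r - t 0" for r
    have fu: "fl (u r) x = act (inv g) (fl (t r) z)" for r
    proof -
      have "fl (t r) z = fl (u r) (fl (t 0) z)"
        by (simp add: u_def fl_add[symmetric])
      then show ?thesis using g by (simp add: fl_act)
    qed
    \<comment> \<open>The value \<open>undefined\<close> beyond \<open>n\<close> makes
      \<open>c\<close> extensional, as membership in \<open>I\<close> demands.\<close>
    define c where "c r = (if r \<le> n then (i r, \<lfloor>u r / \<Lambda>\<rfloor>) else undefined)" for r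
    have ub: "\<bar>u r / \<Lambda>\<bar> \<le> 2 * N / \<Lambda>" if "r \<le> n" for r
      using ti(1)[OF that] ti(1)[of 0] \<Lambda>0 by (simp add: u_def abs_divide divide_right_mono)
    have "\<lfloor>u r / \<Lambda>\<rfloor> \<in> {-m..m}" if "r \<le> n" for r
    proof -
      have "u r / \<Lambda> \<le> 2 * N / \<Lambda>" "- (2 * N / \<Lambda>) \<le> u r / \<Lambda>"
        using ub[OF that] by argo+
      then have "\<lfloor>u r / \<Lambda>\<rfloor> \<le> \<lfloor>2 * N / \<Lambda>\<rfloor>" "\<lfloor>- (2 * N / \<Lambda>)\<rfloor> \<le> \<lfloor>u r / \<Lambda>\<rfloor>"
        by (simp_all only: floor_mono)
      moreover have "\<lfloor>2 * N / \<Lambda>\<rfloor> \<le> \<lceil>2 * N / \<Lambda>\<rceil>"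
        by (rule floor_le_ceiling)
      moreover have "\<lfloor>- (2 * N / \<Lambda>)\<rfloor> = - \<lceil>2 * N / \<Lambda>\<rceil>"
        unfolding ceiling_def by simp
      ultimately have "\<lfloor>u r / \<Lambda>\<rfloor> \<le> m" "- m \<le> \<lfloor>u r / \<Lambda>\<rfloor>"
        unfolding m_def by linarith+
      then show ?thesis by simp
    qed
    then have "(i 0, c) \<in> I"
      using i0 ti(2) by (auto simp: I_def c_def PiE_def extensional_def)
    then have "\<not> (\<forall>r\<le>n. \<exists>t\<in>box (snd (c r)). (fl t x, v r (fst (c r)) (fl t x)) \<in> exceptional (fst (c r)))"
      using vP g(2) unfolding P_def by fastforce
    moreover have "\<exists>t\<in>box (snd (c r)). (fl t x, v r (fst (c r)) (fl t x)) \<in> exceptional (fst (c r))" if r: "r \<le> n" for r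
    proof
      have "of_int \<lfloor>u r / \<Lambda>\<rfloor> * \<Lambda> \<le> u r" "u r \<le> (of_int \<lfloor>u r / \<Lambda>\<rfloor> + 1) * \<Lambda>"
      proof -
        have eq: "u r = u r / \<Lambda> * \<Lambda>" using \<Lambda>0 by simp
        show "of_int \<lfloor>u r / \<Lambda>\<rfloor> * \<Lambda> \<le> u r"
          by (subst (2) eq, rule mult_right_mono[OF of_int_floor_le]) (use \<Lambda>0 in simp)
        show "u r \<le> (of_int \<lfloor>u r / \<Lambda>\<rfloor> + 1) * \<Lambda>"
          by (subst (1) eq, rule mult_right_mono[OF real_of_int_floor_add_one_ge]) (use \<Lambda>0 in simp)
      qed
      then show "u r \<in> box (snd (c r))"
        using r by (simp add: box_def c_def algebra_simps)
      show "(fl (u r) x, v r (fst (c r)) (fl (u r) x)) \<in> exceptional (fst (c r))"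
        using ti(2,3)[OF r] r g(1) by (simp add: fu c_def exceptional_act vinv)
    qed
    ultimately show False by blast
  qed
  moreover have "\<bar>v r i x - q i x\<bar> \<le> 1/2" if "i < k" for r i x
    using v(3)[unfolded near_def, rule_format, where r = r and i = i and x = x] that
    by (simp add: v0_def)
  ultimately show ?thesis using v(1) by blast
qed

end

section \<open>Marks\<close>

context proper_flow begin

lemma tendsto_fl:
  assumes "(t \<longlongrightarrow> a) F" "(y \<longlongrightarrow> x) F"
  shows "((\<lambda>m. fl (t m) (y m)) \<longlongrightarrow> fl a x) F"
proof -
  have "isCont (\<lambda>p. fl (snd p) (fst p)) (x, a)"
    using fl_cont continuous_on_eq_continuous_at open_UNIV by blast
  then have "((\<lambda>m. fl (snd (y m, t m)) (fst (y m, t m))) \<longlongrightarrow> fl (snd (x, a)) (fst (x, a))) F"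
    by (rule isCont_tendsto_compose) (intro tendsto_Pair assms)
  then show ?thesis by simp
qed

lemma limit_hit:
  assumes y: "y \<longlonglongrightarrow> x" and t: "\<And>m. \<bar>t m\<bar> \<le> b" and L: "\<And>m. fl (t m) (y m) \<in> L"
  obtains \<sigma> u where "strict_mono (\<sigma> :: nat \<Rightarrow> nat)" "(t \<circ> \<sigma>) \<longlonglongrightarrow> u" "(y \<circ> \<sigma>) \<longlonglongrightarrow> x" "fl u x \<in> closure L"
proof -
  have "seq_compact {-b..b}" by (simp add: compact_eq_seq_compact_metric[symmetric])
  moreover have "\<And>m. t m \<in> {-b..b}" using t by (simp add: abs_le_iff minus_le_iff)
  ultimately obtain u \<sigma> where u: "strict_mono (\<sigma> :: nat \<Rightarrow> nat)" "(t \<circ> \<sigma>) \<longlonglongrightarrow> u"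
    unfolding seq_compact_def by metis
  have y': "(y \<circ> \<sigma>) \<longlonglongrightarrow> x" using LIMSEQ_subseq_LIMSEQ[OF y u(1)] .
  have "(\<lambda>m. fl ((t \<circ> \<sigma>) m) ((y \<circ> \<sigma>) m)) \<longlonglongrightarrow> fl u x"
    by (rule tendsto_fl[OF u(2) y'])
  moreover have "fl ((t \<circ> \<sigma>) m) ((y \<circ> \<sigma>) m) \<in> L" for m
    using L by simp
  ultimately have "fl u x \<in> closure L"
    unfolding closure_sequential by (intro exI[of _ "\<lambda>m. fl ((t \<circ> \<sigma>) m) ((y \<circ> \<sigma>) m)"]) simp
  then show ?thesis using that u y' by blast
qed

end

context slice_system begin

primrec marks :: "(nat \<Rightarrow> 'a \<Rightarrow> real) \<Rightarrow> nat \<Rightarrow> 'a set" where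
  "marks w 0 = {}"
| "marks w (Suc i) = marks w i \<union> {x \<in> S i. 0 < w i x \<and> \<not> (\<exists>t. \<bar>t\<bar> \<le> R + w i x \<and> fl t x \<in> marks w i)}"

definition layer :: "(nat \<Rightarrow> 'a \<Rightarrow> real) \<Rightarrow> nat \<Rightarrow> 'a set" where
  "layer w i = {x \<in> S i. 0 < w i x \<and> \<not> (\<exists>t. \<bar>t\<bar> \<le> R + w i x \<and> fl t x \<in> marks w i)}"

lemma marks_iff: "x \<in> marks w m \<longleftrightarrow> (\<exists>i<m. x \<in> layer w i)"
  by (induction m) (auto simp: layer_def less_Suc_eq)

lemma marks_mono: "i \<le> j \<Longrightarrow> x \<in> marks w i \<Longrightarrow> x \<in> marks w j"
  by (meson marks_iff order_less_le_trans)

text \<open>The tolerance 1/2 keeps \<open>w i\<close> positive where \<open>q i\<close> exceeds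
  1/2, which produces marks, and keeps points of positive weight away from the rim, where
  \<open>q i\<close> is \<open>- 1\<close>.\<close>

definition weight :: "(nat \<Rightarrow> 'a \<Rightarrow> real) \<Rightarrow> bool" where
  "weight w \<longleftrightarrow> (\<forall>i<k. cinv (w i) \<and> (\<forall>x. \<bar>w i x - q i x\<bar> \<le> 1/2))"

context
  fixes w :: "nat \<Rightarrow> 'a \<Rightarrow> real"
  assumes w: "weight w"
begin

lemma weight_bound: "i < k \<Longrightarrow> \<bar>w i x\<bar> \<le> 2"
  and weight_cont: "i < k \<Longrightarrow> continuous_on UNIV (w i)"
  and weight_act: "i < k \<Longrightarrow> g \<in> carrier G \<Longrightarrow> w i (act g x) = w i x"
  and weight_q: "i < k \<Longrightarrow> 0 < w i x \<Longrightarrow> - 1 < q i x"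
proof -
  assume i: "i < k"
  have "\<bar>w i x - q i x\<bar> \<le> 1/2" "\<bar>q i x\<bar> \<le> 1"
    using w i slice_bound[OF i] by (auto simp: weight_def)
  then show "\<bar>w i x\<bar> \<le> 2" "0 < w i x \<Longrightarrow> - 1 < q i x" by linarith+
  show "continuous_on UNIV (w i)" "g \<in> carrier G \<Longrightarrow> w i (act g x) = w i x"
    using w i by (auto simp: weight_def cinv_def invariant_def)
qed

lemma weight_tendsto:
  assumes "i < k" "(y \<longlongrightarrow> x) F"
  shows "((\<lambda>m. w i (y m)) \<longlongrightarrow> w i x) F"
proof -
  have "isCont (w i) x"
    using weight_cont[OF assms(1)] continuous_on_eq_continuous_at open_UNIV by blast
  then show ?thesis using assms(2) by (rule isCont_tendsto_compose)
qed

lemma layer_act: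
  assumes "i < k" "g \<in> carrier G"
  shows "act g x \<in> layer w i \<longleftrightarrow> x \<in> layer w i"
  using assms(1)
proof (induction i arbitrary: x rule: less_induct)
  case (less i)
  have "act g y \<in> marks w i \<longleftrightarrow> y \<in> marks w i" for y
    using less by (auto simp: marks_iff)
  then show ?case
    using less.prems assms(2) by (simp add: layer_def slice_act weight_act fl_act)
qed

lemma marks_act: "g \<in> carrier G \<Longrightarrow> act g x \<in> marks w k \<longleftrightarrow> x \<in> marks w k"
  using layer_act by (auto simp: marks_iff)

lemma layer_slice: "x \<in> layer w i \<Longrightarrow> x \<in> S i"
  by (simp add: layer_def)

text \<open>The mark on the later slice carries the blocking condition, and its radius is at least
  \<open>R - 2\<close>. On a single slice a return this early is excluded.\<close>

lemma layer_separated_le: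
  assumes i: "i < k" "j \<le> i" and x: "x \<in> layer w i" "fl t x \<in> layer w j" and t: "\<bar>t\<bar> \<le> R - 2"
  shows "i = j \<and> t = 0"
proof (cases "j = i")
  case True
  have "\<bar>t\<bar> \<le> \<Lambda>" using t R \<Lambda> by linarith
  then show ?thesis
    using True slice_no_return[OF i(1) layer_slice[OF x(1)], of t] layer_slice[OF x(2)] by simp
next
  case False
  then have "j < i" using i(2) by simp
  then have "fl t x \<in> marks w i" using x(2) by (auto simp: marks_iff)
  moreover have "\<bar>t\<bar> \<le> R + w i x" using t weight_bound[OF i(1), of x] by linarith
  ultimately show ?thesis using x(1) by (auto simp: layer_def)
qed

lemma layer_separated:
  assumes "i < k" "j < k" "x \<in> layer w i" "fl t x \<in> layer w j" "\<bar>t\<bar> \<le> R - 2"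
  shows "i = j \<and> t = 0"
proof (cases "j \<le> i")
  case True
  then show ?thesis using layer_separated_le assms by blast
next
  case False
  then have "j = i \<and> - t = 0"
    using layer_separated_le[of j i "fl t x" "- t"] assms by simp
  then show ?thesis by simp
qed

text \<open>Either the greedy rule marks \<open>x\<close>, or it refuses \<open>x\<close> because of
  an earlier mark inside the blocking radius, which is at most \<open>R + 2\<close>.\<close>

lemma mark_near:
  assumes "i < k" "x \<in> S i" "0 < w i x"
  shows "\<exists>t. \<bar>t\<bar> \<le> R + 2 \<and> fl t x \<in> marks w k"
proof (cases "x \<in> layer w i")
  case True
  then show ?thesis using assms(1) R by (intro exI[of _ 0]) (auto simp: marks_iff)
next
  case False
  then obtain t where t: "\<bar>t\<bar> \<le> R + w i x" "fl t x \<in> marks w i"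
    using assms(2,3) by (auto simp: layer_def)
  have "fl t x \<in> marks w k" using marks_mono[OF less_imp_le[OF assms(1)] t(2)] .
  moreover have "\<bar>t\<bar> \<le> R + 2" using t(1) weight_bound[OF assms(1), of x] by linarith
  ultimately show ?thesis by blast
qed

text \<open>Positive weight keeps \<open>y\<close> off the rim, so orbits close to \<open>y\<close>
  cross the slice close to \<open>y\<close> and at a small time. The slice points close to
  \<open>y\<close> are marked as well, so these crossings are marks.\<close>

lemma tube_layer:
  assumes j: "j < k" and y: "y \<in> layer w j" "y \<notin> closure (S j - layer w j)" and e: "e > 0"
  shows "\<exists>d>0. \<forall>y'. dist y y' < d \<longrightarrow> (\<exists>s. \<bar>s\<bar> < e \<and> fl s y' \<in> layer w j \<and> dist y (fl s y') < e)"
proof -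
  obtain \<delta> where \<delta>: "\<delta> > 0" "\<And>y'. y' \<in> S j \<Longrightarrow> dist y y' < \<delta> \<Longrightarrow> y' \<in> layer w j"
  proof -
    have "open (- closure (S j - layer w j))" "y \<in> - closure (S j - layer w j)"
      using y(2) by auto
    then obtain \<delta> where "\<delta> > 0" "ball y \<delta> \<subseteq> - closure (S j - layer w j)"
      using open_contains_ball by blast
    then have "\<forall>y'. y' \<in> S j \<longrightarrow> dist y y' < \<delta> \<longrightarrow> y' \<in> layer w j"
      using closure_subset[of "S j - layer w j"] by (auto simp: subset_iff)
    then show ?thesis using that \<open>\<delta> > 0\<close> by blast
  qed
  have "open {p. dist y (fl (snd p) (fst p)) < min \<delta> e}"
    by (intro open_Collect_less continuous_intros)
  moreover have "(y, 0) \<in> {p. dist y (fl (snd p) (fst p)) < min \<delta> e}"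
    using \<delta>(1) e by simp
  ultimately obtain Y T where YT: "open Y" "open T" "(y, 0) \<in> Y \<times> T"
      "Y \<times> T \<subseteq> {p. dist y (fl (snd p) (fst p)) < min \<delta> e}"
    by (rule open_prod_elim)
  obtain d1 where d1: "d1 > 0" "ball y d1 \<subseteq> Y" using YT(1,3) open_contains_ball by blast
  obtain e1 where e1: "e1 > 0" "ball 0 e1 \<subseteq> T" using YT(2,3) open_contains_ball by blast
  have "- 1 < q j y" using weight_q[OF j] y(1) by (simp add: layer_def)
  moreover have "0 < min e e1" using e e1(1) by simp
  ultimately have "\<exists>d>0. \<forall>y'. dist y y' < d \<longrightarrow> (\<exists>t. \<bar>t\<bar> < min e e1 \<and> fl t y' \<in> S j)"
    using slices[OF j] layer_slice[OF y(1)] unfolding slice_def by blast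
  then obtain d2 where d2: "d2 > 0" "\<And>y'. dist y y' < d2 \<Longrightarrow> \<exists>t. \<bar>t\<bar> < min e e1 \<and> fl t y' \<in> S j"
    by blast
  have "\<exists>s. \<bar>s\<bar> < e \<and> fl s y' \<in> layer w j \<and> dist y (fl s y') < e" if y': "dist y y' < min d1 d2" for y'
  proof -
    obtain t where t: "\<bar>t\<bar> < min e e1" "fl t y' \<in> S j" using d2(2)[of y'] y' by auto
    have "y' \<in> Y" using d1(2) y' by auto
    moreover have "t \<in> T" using e1(2) t(1) by (auto simp: dist_real_def)
    ultimately have "dist y (fl t y') < min \<delta> e" using YT(4) by auto
    then show ?thesis using \<delta>(2)[OF t(2)] t(1) by (intro exI[of _ t]) auto
  qed
  then show ?thesis using d1(1) d2(1) by (intro exI[of _ "min d1 d2"]) auto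
qed

text \<open>The window grows with the index of the slice, since whether a point is marked depends on chains of
  earlier marks.\<close>
lemma layer_locally_constant:
  assumes "i < k" "x \<in> S i" "\<And>t. \<bar>t\<bar> \<le> real (Suc i) * (R + 2) \<Longrightarrow> fl t x \<notin> bad w"
  shows "(x \<in> layer w i \<longrightarrow> x \<notin> closure (S i - layer w i)) \<and> (x \<notin> layer w i \<longrightarrow> x \<notin> closure (layer w i))"
  using assms
proof (induction i arbitrary: x rule: less_induct)
  case (less i)
  \<comment> \<open>Passing to an earlier slice costs a time shift of at most \<open>R + 2\<close>,
    which the longer window of slice \<open>i\<close> pays for.\<close>
  have good: "fl t (fl u x) \<notin> bad w" if "j < i" "\<bar>u\<bar> \<le> R + 2" "\<bar>t\<bar> \<le> real (Suc j) * (R + 2)" for j t u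
  proof -
    have "\<bar>t + u\<bar> \<le> real (Suc j) * (R + 2) + (R + 2)" using that(2,3) by linarith
    also have "\<dots> = real (Suc (Suc j)) * (R + 2)" by (simp add: algebra_simps)
    also have "\<dots> \<le> real (Suc i) * (R + 2)" using that(1) R by (intro mult_right_mono) auto
    finally show ?thesis using less.prems(3)[of "t + u"] by (simp add: fl_add)
  qed
  have IH: "(fl u x \<in> layer w j \<longrightarrow> fl u x \<notin> closure (S j - layer w j)) \<and>
      (fl u x \<notin> layer w j \<longrightarrow> fl u x \<notin> closure (layer w j))"
    if "j < i" "\<bar>u\<bar> \<le> R + 2" "fl u x \<in> S j" for j u
    using less.IH[OF that(1) _ that(3)] good[OF that(1,2)] that(1) less.prems(1) by simp
  have wb: "\<bar>w i y\<bar> \<le> 2" for y using weight_bound[OF less.prems(1)] .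
  show ?case
  proof (intro conjI impI)
    assume x: "x \<in> layer w i"
    \<comment> \<open>These are the points blocked by a mark on slice \<open>j\<close>. The blocking
      inequality is closed, and by the induction hypothesis a limit of the blocking marks is again a
      mark, so a limit of blocked points is blocked.\<close>
    define C where "C j = {y \<in> S i. \<exists>t. \<bar>t\<bar> \<le> R + w i y \<and> fl t y \<in> layer w j}" for j
    have "x \<notin> closure (C j)" if j: "j < i" for j
    proof (rule notin_closureI)
      fix y assume y: "\<And>m. y m \<in> C j" "y \<longlonglongrightarrow> x"
      have "\<forall>m. \<exists>t. \<bar>t\<bar> \<le> R + w i (y m) \<and> fl t (y m) \<in> layer w j"
        using y(1) by (auto simp: C_def)
      then obtain t where t: "\<And>m. \<bar>t m\<bar> \<le> R + w i (y m)" "\<And>m. fl (t m) (y m) \<in> layer w j"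
        by metis
      have "\<bar>t m\<bar> \<le> R + 2" for m using t(1)[of m] wb[of "y m"] by linarith
      then obtain \<sigma> u where u: "strict_mono \<sigma>" "(t \<circ> \<sigma>) \<longlonglongrightarrow> u" "(y \<circ> \<sigma>) \<longlonglongrightarrow> x" "fl u x \<in> closure (layer w j)"
        using limit_hit[OF y(2) _ t(2)] by blast
      have "(\<lambda>m. R + w i ((y \<circ> \<sigma>) m)) \<longlonglongrightarrow> R + w i x"
        by (intro tendsto_intros weight_tendsto[OF less.prems(1) u(3)])
      then have ub: "\<bar>u\<bar> \<le> R + w i x"
        by (rule LIMSEQ_le[OF tendsto_rabs[OF u(2)]]) (use t(1) in auto)
      then have ub': "\<bar>u\<bar> \<le> R + 2" using wb[of x] by linarith
      have "closure (layer w j) \<subseteq> S j"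
        using slice_closed[of j] j less.prems(1) layer_slice by (intro closure_minimal) auto
      then have "fl u x \<in> layer w j"
        using IH[OF j ub'] u(4) by blast
      then have "fl u x \<in> marks w i" using j by (auto simp: marks_iff)
      then show False using x ub by (auto simp: layer_def)
    qed
    then have "x \<notin> (\<Union>j<i. closure (C j))" by blast
    moreover have "closure (\<Union>j<i. C j) \<subseteq> (\<Union>j<i. closure (C j))"
      using closure_subset by (intro closure_minimal closed_UN) fastforce+
    ultimately have "x \<notin> closure (\<Union>j<i. C j)" by blast
    moreover have "closed {y. w i y \<le> 0}"
      by (intro closed_Collect_le weight_cont less.prems(1) continuous_intros)
    then have "x \<notin> closure {y. w i y \<le> 0}"
      using x by (simp add: layer_def)
    ultimately have "x \<notin> closure ({y. w i y \<le> 0} \<union> (\<Union>j<i. C j))"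
      by (simp add: closure_Un)
    moreover have "S i - layer w i \<subseteq> {y. w i y \<le> 0} \<union> (\<Union>j<i. C j)"
      by (auto simp: layer_def[of w i] C_def marks_iff)
    ultimately show "x \<notin> closure (S i - layer w i)"
      using closure_mono by blast
  next
    assume x: "x \<notin> layer w i"
    have nbad: "(x, w i x) \<notin> exceptional i"
    proof -
      have "0 \<le> real (Suc i) * (R + 2)" using R by (intro mult_nonneg_nonneg) auto
      then have "x \<notin> bad w" using less.prems(3)[of 0] by simp
      then show ?thesis using less.prems(1) by (auto simp: bad_def)
    qed
    then have w0: "w i x \<noteq> 0" using less.prems(2) by (auto simp: exceptional_def)
    show "x \<notin> closure (layer w i)"
    proof (cases "w i x < 0")
      case True
      have "closed {y. 0 \<le> w i y}"
        by (intro closed_Collect_le weight_cont less.prems(1) continuous_intros)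
      moreover have "layer w i \<subseteq> {y. 0 \<le> w i y}" by (auto simp: layer_def)
      ultimately have "closure (layer w i) \<subseteq> {y. 0 \<le> w i y}" by (rule closure_minimal[rotated])
      then show ?thesis using True by auto
    next
      case False
      then obtain t j where tj: "\<bar>t\<bar> \<le> R + w i x" "j < i" "fl t x \<in> layer w j"
        using x less.prems(2) w0 by (auto simp: layer_def[of w i] marks_iff)
      have tb: "\<bar>t\<bar> \<le> R + 2" using tj(1) wb[of x] by linarith
      have jk: "j < k" using tj(2) less.prems(1) by simp
      have Sj: "fl t x \<in> S j" by (rule layer_slice[OF tj(3)])
      \<comment> \<open>A small change of \<open>x\<close> could move the blocking mark out of range
        only in case of equality, and then the weight is exceptional.\<close>
      have "\<bar>t\<bar> \<noteq> R + w i x"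
      proof
        assume eq: "\<bar>t\<bar> = R + w i x"
        then have "t = R + w i x \<or> t = - (R + w i x)" by linarith
        then have "fl (R + w i x) x \<in> S j \<or> fl (- (R + w i x)) x \<in> S j" using Sj by auto
        moreover have "\<bar>R + w i x\<bar> \<le> R + 2" using eq tb by linarith
        ultimately show False
          using nbad tj(2) less.prems(2) unfolding exceptional_def by blast
      qed
      then have lt: "\<bar>t\<bar> < R + w i x" using tj(1) by simp
      \<comment> \<open>Half of the slack absorbs the shift of the blocking mark in time, the other
        half the change of the weight.\<close>
      define e where "e = (R + w i x - \<bar>t\<bar>) / 2"
      have e: "e > 0" using lt by (simp add: e_def)
      have "fl t x \<notin> closure (S j - layer w j)" using IH[OF tj(2) tb Sj] tj(3) by blast
      then obtain d where d: "d > 0" "\<And>y'. dist (fl t x) y' < d \<Longrightarrow>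
          \<exists>s. \<bar>s\<bar> < e \<and> fl s y' \<in> layer w j \<and> dist (fl t x) (fl s y') < e"
        using tube_layer[OF jk tj(3) _ e] by blast
      show ?thesis
      proof (rule notin_closureI)
        fix y assume y: "\<And>m. y m \<in> layer w i" "y \<longlonglongrightarrow> x"
        have "(\<lambda>m. fl t (y m)) \<longlonglongrightarrow> fl t x"
          by (rule tendsto_fl[OF tendsto_const y(2)])
        then have "eventually (\<lambda>m. dist (fl t (y m)) (fl t x) < d) sequentially"
          using d(1) by (rule tendstoD)
        moreover have "eventually (\<lambda>m. dist (w i (y m)) (w i x) < e) sequentially"
          using weight_tendsto[OF less.prems(1) y(2)] e by (rule tendstoD)
        ultimately have "eventually (\<lambda>m. dist (fl t (y m)) (fl t x) < d \<and> dist (w i (y m)) (w i x) < e) sequentially"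
          by (rule eventually_conj)
        then obtain m where m: "dist (fl t (y m)) (fl t x) < d" "dist (w i (y m)) (w i x) < e"
          by (auto simp: eventually_sequentially)
        then obtain s where s: "\<bar>s\<bar> < e" "fl s (fl t (y m)) \<in> layer w j"
          using d(2)[of "fl t (y m)"] by (auto simp: dist_commute)
        have "fl (s + t) (y m) \<in> marks w i"
          using s(2) tj(2) by (auto simp: marks_iff fl_add)
        moreover have "\<bar>s + t\<bar> \<le> R + w i (y m)"
        proof -
          have "\<bar>t\<bar> + 2 * e = R + w i x" unfolding e_def by argo
          moreover have "\<bar>w i (y m) - w i x\<bar> < e" using m(2) by (simp add: dist_real_def)
          ultimately show ?thesis using s(1) by linarith
        qed
        ultimately show False
          using y(1)[of m] by (auto simp: layer_def)
      qed
    qed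
  qed
qed

end

end

section \<open>Blocks\<close>

lemma (in group) finite_subgroup_virtually_cyclic:
  assumes H: "subgroup H G" "finite H"
  shows "H \<in> virtually_cyclic_subgroups G"
proof -
  let ?H = "G\<lparr>carrier := H\<rparr>"
  interpret H: group ?H
    using subgroup_imp_group[OF H(1)] .
  let ?T = "G\<lparr>carrier := {\<one>}\<rparr>"
  have "group ?T"
    using subgroup_imp_group[OF triv_subgroup] .
  then have "cyclic_group ?T"
    by (intro trivial_imp_cyclic_group) (simp add: trivial_group_def)
  moreover have "subgroup {\<one>} ?H"
    using H.triv_subgroup by simp
  moreover have "finite (rcosets\<^bsub>?H\<^esub> {\<one>})"
    using H(2) by (simp add: RCOSETS_def)
  ultimately show ?thesis
    using H(1) unfolding virtually_cyclic_subgroups_def by blast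
qed

context slice_system begin

text \<open>Cutting a slice into the translates of \<open>S0 i\<close> keeps the stabilizers finite.
  The parameter \<open>Q\<close> prescribes the times covered by the tube over a mark, so that both
  kinds of tubes share one treatment.\<close>

definition block :: "(nat \<Rightarrow> 'a \<Rightarrow> real) \<Rightarrow> (real \<Rightarrow> 'a \<Rightarrow> bool) \<Rightarrow> nat \<Rightarrow> 'g \<Rightarrow> 'a set" where
  "block w Q i g = {fl s x |s x. x \<in> layer w i \<and> x \<in> act g ` S0 i \<and> Q s x}"

text \<open>Interiors are taken because a block need not be a neighbourhood of its points where the
  marks jump. The empty set is left out because its stabilizer is all of \<open>G\<close>.\<close>

definition blocks :: "(nat \<Rightarrow> 'a \<Rightarrow> real) \<Rightarrow> (real \<Rightarrow> 'a \<Rightarrow> bool) \<Rightarrow> 'a set set" where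
  "blocks w Q = {interior (block w Q i g) |i g. i < k \<and> g \<in> carrier G} - {{}}"

lemma translate_eq:
  assumes "i < k" "g \<in> carrier G" "h \<in> carrier G" "act g ` S0 i \<inter> act h ` S0 i \<noteq> {}"
  shows "act g ` S0 i = act h ` S0 i" "inv h \<otimes> g \<in> {f \<in> carrier G. act f ` S0 i \<inter> S0 i \<noteq> {}}"
proof -
  obtain x y where xy: "x \<in> S0 i" "y \<in> S0 i" "act g x = act h y" using assms(4) by auto
  define f where "f = inv h \<otimes> g"
  have f: "f \<in> carrier G" using assms(2,3) by (simp add: f_def)
  have af: "act f u = act (inv h) (act g u)" for u
    using assms(2,3) by (simp add: f_def act_mult)
  have "act f x = y" using xy(3) assms(3) by (simp add: af)
  then have ne: "act f ` S0 i \<inter> S0 i \<noteq> {}" using xy by blast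
  then show "inv h \<otimes> g \<in> {f \<in> carrier G. act f ` S0 i \<inter> S0 i \<noteq> {}}"
    using f by (simp add: f_def)
  have "act f ` S0 i = S0 i"
    using slices[OF assms(1)] f ne unfolding slice_def by blast
  then have "act h ` act f ` S0 i = act h ` S0 i" by simp
  then show "act g ` S0 i = act h ` S0 i"
    using assms(3) by (simp add: image_image af)
qed

context
  fixes w :: "nat \<Rightarrow> 'a \<Rightarrow> real" and Q :: "real \<Rightarrow> 'a \<Rightarrow> bool"
  assumes w: "weight w"
    and Qact: "\<And>g s x. g \<in> carrier G \<Longrightarrow> Q s (act g x) \<longleftrightarrow> Q s x"
    and Quniq: "\<And>i j x y s t. \<lbrakk>i < k; j < k; x \<in> layer w i; y \<in> layer w j; Q s x; Q t y; fl s x = fl t y\<rbrakk> \<Longrightarrow> s = t"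
begin

lemma act_block:
  assumes i: "i < k" and g: "g \<in> carrier G" "h \<in> carrier G"
  shows "act h ` block w Q i g = block w Q i (h \<otimes> g)"
proof -
  have le: "act h ` block w Q i g \<subseteq> block w Q i (h \<otimes> g)" if "g \<in> carrier G" "h \<in> carrier G" for g h
  proof
    fix y assume "y \<in> act h ` block w Q i g"
    then obtain s u where u: "y = act h (fl s (act g u))" "act g u \<in> layer w i" "u \<in> S0 i" "Q s (act g u)"
      by (auto simp: block_def)
    have "y = fl s (act (h \<otimes> g) u)" using u(1) that by (simp add: fl_act act_mult)
    moreover have "act (h \<otimes> g) u \<in> layer w i" "Q s (act (h \<otimes> g) u)"
      using u(2,4) that layer_act[OF w i, of h "act g u"] Qact[of h s "act g u"] by (simp_all add: act_mult)
    ultimately show "y \<in> block w Q i (h \<otimes> g)" unfolding block_def using u(3) by blast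
  qed
  have "act (inv h) ` block w Q i (h \<otimes> g) \<subseteq> block w Q i (inv h \<otimes> (h \<otimes> g))"
    using g by (intro le) auto
  also have "inv h \<otimes> (h \<otimes> g) = g" using g by (simp add: m_assoc[symmetric])
  finally have "act h ` act (inv h) ` block w Q i (h \<otimes> g) \<subseteq> act h ` block w Q i g" by blast
  then show ?thesis using le[OF g] g by (auto simp: image_image)
qed

text \<open>By \<open>Quniq\<close> a point of a block determines its time and hence its mark. The
  mark determines the slice by separation, and the translate because translates of
  \<open>S0 i\<close> coincide or are disjoint.\<close>

lemma block_meet:
  assumes i: "i < k" "j < k" and g: "g \<in> carrier G" "h \<in> carrier G"
    and z: "z \<in> block w Q i g" "z \<in> block w Q j h"
  shows "i = j \<and> act g ` S0 i \<inter> act h ` S0 i \<noteq> {} \<and> block w Q i g = block w Q j h"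
proof -
  obtain s x where x: "z = fl s x" "x \<in> layer w i" "x \<in> act g ` S0 i" "Q s x"
    using z(1) by (auto simp: block_def)
  obtain t y where y: "z = fl t y" "y \<in> layer w j" "y \<in> act h ` S0 j" "Q t y"
    using z(2) by (auto simp: block_def)
  have "s = t" using Quniq[OF i x(2) y(2) x(4) y(4)] x(1) y(1) by simp
  then have xy: "x = y" using x(1) y(1) by (simp add: fl_inj)
  have ij: "i = j"
    using layer_separated[OF w i x(2), of 0] y(2) xy R by simp
  have ne: "act g ` S0 i \<inter> act h ` S0 i \<noteq> {}" using x(3) y(3) xy ij by blast
  then have "act g ` S0 i = act h ` S0 i" using translate_eq(1)[OF i(1) g] by blast
  then show ?thesis using ij ne by (simp add: block_def)
qed

lemma interior_act:
  assumes "g \<in> carrier G"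
  shows "act g ` interior B = interior (act g ` B)"
proof -
  have le: "act h ` interior B \<subseteq> interior (act h ` B)" if h: "h \<in> carrier G" for h B
  proof (rule interior_maximal)
    show "act h ` interior B \<subseteq> act h ` B" using interior_subset by blast
    have "act h ` interior B = act (inv h) -` interior B"
      using h by (auto simp: image_iff) (metis act_inv(2))
    moreover have "open (act (inv h) -` interior B)"
      using h by (intro open_vimage cont_act) auto
    ultimately show "open (act h ` interior B)" by simp
  qed
  have "act g ` act (inv g) ` interior (act g ` B) \<subseteq> act g ` interior (act (inv g) ` act g ` B)"
    using le[of "inv g" "act g ` B"] assms by blast
  then show ?thesis using le[OF assms] assms by (auto simp: image_image)
qed

lemma act_blocks:
  assumes "i < k" "g \<in> carrier G" "h \<in> carrier G"
  shows "act h ` interior (block w Q i g) = interior (block w Q i (h \<otimes> g))"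
  using interior_act[OF assms(3)] act_block[OF assms] by simp

lemma blocks_invariant:
  assumes "h \<in> carrier G" "V \<in> blocks w Q"
  shows "act h ` V \<in> blocks w Q"
proof -
  obtain i g where V: "V = interior (block w Q i g)" "i < k" "g \<in> carrier G" "V \<noteq> {}"
    using assms(2) by (auto simp: blocks_def)
  have "act h ` V = interior (block w Q i (h \<otimes> g))"
    using act_blocks V assms(1) by simp
  then show ?thesis
    using V assms(1) unfolding blocks_def by (auto intro!: exI[of _ i] exI[of _ "h \<otimes> g"])
qed

lemma blocks_disjoint:
  assumes "V \<in> blocks w Q" "V' \<in> blocks w Q" "V \<inter> V' \<noteq> {}"
  shows "V = V'"
proof -
  obtain i g where V: "V = interior (block w Q i g)" "i < k" "g \<in> carrier G"
    using assms(1) by (auto simp: blocks_def)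
  obtain j h where V': "V' = interior (block w Q j h)" "j < k" "h \<in> carrier G"
    using assms(2) by (auto simp: blocks_def)
  obtain z where "z \<in> V" "z \<in> V'" using assms(3) by blast
  then have "z \<in> block w Q i g" "z \<in> block w Q j h"
    using V(1) V'(1) interior_subset by blast+
  then have "block w Q i g = block w Q j h"
    using block_meet[OF V(2) V'(2) V(3) V'(3)] by blast
  then show ?thesis using V(1) V'(1) by simp
qed

text \<open>An element that preserves the block over the \<open>g\<close>-translate of
  \<open>S0 i\<close> makes that translate meet itself. Its conjugate by \<open>g\<close> then lies
  in the finite set of elements that return \<open>S0 i\<close> to itself.\<close>

lemma blocks_family_subset:
  assumes "V \<in> blocks w Q"
  shows "family_subset G act (virtually_cyclic_subgroups G) V"
proof -
  obtain i g where V: "V = interior (block w Q i g)" "i < k" "g \<in> carrier G" "V \<noteq> {}"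
    using assms by (auto simp: blocks_def)
  let ?St = "stabilizer G (set_act act) V"
  have St: "?St = {h \<in> carrier G. act h ` V = V}"
    by (simp add: stabilizer_def)
  define F where "F = {f \<in> carrier G. act f ` S0 i \<inter> S0 i \<noteq> {}}"
  have finF: "finite F"
    using slices[OF V(2)] unfolding slice_def F_def by blast
  have "?St \<subseteq> (\<lambda>f. g \<otimes> f \<otimes> inv g) ` F"
  proof
    fix h assume "h \<in> ?St"
    then have h: "h \<in> carrier G" "act h ` V = V" by (auto simp: St)
    obtain z where z: "z \<in> V" using V(4) by blast
    have "V = interior (block w Q i (h \<otimes> g))"
      using act_blocks[OF V(2,3) h(1)] h(2) V(1) by simp
    then have "z \<in> block w Q i (h \<otimes> g)" "z \<in> block w Q i g"
      using z V(1) interior_subset by blast+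
    then have "act (h \<otimes> g) ` S0 i \<inter> act g ` S0 i \<noteq> {}"
      using block_meet[OF V(2,2) _ V(3)] h(1) V(3) by blast
    then have f: "inv g \<otimes> (h \<otimes> g) \<in> F"
      using translate_eq(2)[OF V(2) _ V(3)] h(1) V(3) unfolding F_def by blast
    have "g \<otimes> (inv g \<otimes> (h \<otimes> g)) \<otimes> inv g = h"
      using h(1) V(3) by (simp add: m_assoc[symmetric]) (simp add: m_assoc)
    then show "h \<in> (\<lambda>f. g \<otimes> f \<otimes> inv g) ` F" using f by (metis image_eqI)
  qed
  then have fin: "finite ?St" using finF finite_surj by blast
  have "subgroup ?St G"
    unfolding St
  proof (rule subgroupI)
    have "act \<one> ` V = V" by simp
    then show "{h \<in> carrier G. act h ` V = V} \<noteq> {}" using one_closed by blast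
    fix a assume a: "a \<in> {h \<in> carrier G. act h ` V = V}"
    then have ac: "a \<in> carrier G" and "act (inv a) ` V = act (inv a) ` act a ` V" by auto
    note this(2)
    also have "\<dots> = V" using ac by (simp add: image_image)
    finally show "inv a \<in> {h \<in> carrier G. act h ` V = V}" using a by simp
    fix b assume b: "b \<in> {h \<in> carrier G. act h ` V = V}"
    then have "b \<in> carrier G" by simp
    then have "act (a \<otimes> b) ` V = act a ` act b ` V" using ac by (simp add: act_mult image_image)
    then show "a \<otimes> b \<in> {h \<in> carrier G. act h ` V = V}" using a b by simp
  qed auto
  then have "?St \<in> virtually_cyclic_subgroups G"
    using fin by (rule finite_subgroup_virtually_cyclic)
  moreover have "act h ` V = V" if "h \<in> carrier G" "act h ` V \<inter> V \<noteq> {}" for h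
    using blocks_disjoint[OF blocks_invariant[OF that(1) assms] assms that(2)] .
  ultimately show ?thesis by (simp add: family_subset_def)
qed

lemma blocks_card:
  "finite {V \<in> blocks w Q. x \<in> V}" "card {V \<in> blocks w Q. x \<in> V} \<le> 1"
proof -
  have eq: "V = V'" if "V \<in> blocks w Q" "V' \<in> blocks w Q" "x \<in> V" "x \<in> V'" for V V'
    by (rule blocks_disjoint[OF that(1,2)]) (use that in blast)
  have "\<exists>W. {V \<in> blocks w Q. x \<in> V} \<subseteq> {W}"
  proof (cases "{V \<in> blocks w Q. x \<in> V} = {}")
    case True
    then show ?thesis by (intro exI[of _ "{}"]) (simp only: empty_subsetI)
  next
    case False
    then obtain W where "W \<in> blocks w Q" "x \<in> W" by blast
    then show ?thesis using eq by (intro exI[of _ W]) blast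
  qed
  then obtain W where W: "{V \<in> blocks w Q. x \<in> V} \<subseteq> {W}" ..
  show "finite {V \<in> blocks w Q. x \<in> V}" by (rule finite_subset[OF W]) simp
  show "card {V \<in> blocks w Q. x \<in> V} \<le> 1" using card_mono[OF _ W] by simp
qed

text \<open>By \<open>act_blocks\<close> the interior over \<open>S0 i\<close> is carried to that
  over any translate, so each slice contributes at most one orbit.\<close>

lemma blocks_cofinite: "finite (orbit G (set_act act) ` blocks w Q)"
proof -
  have "orbit G (set_act act) V \<in> (\<lambda>i. orbit G (set_act act) (interior (block w Q i \<one>))) ` {..<k}"
    if V: "V \<in> blocks w Q" for V
  proof -
    obtain i g where V: "V = interior (block w Q i g)" "i < k" "g \<in> carrier G"
      using V by (auto simp: blocks_def)
    have orb: "orbit G (set_act act) (interior (block w Q i h)) = {interior (block w Q i f) |f. f \<in> carrier G}"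
      if h: "h \<in> carrier G" for h
    proof -
      have "\<exists>e. interior (block w Q i f) = act e ` interior (block w Q i h) \<and> e \<in> carrier G"
        if "f \<in> carrier G" for f
        using act_blocks[OF V(2) h, of "f \<otimes> inv h"] that h
        by (intro exI[of _ "f \<otimes> inv h"]) (simp add: m_assoc)
      moreover have "\<exists>f. act e ` interior (block w Q i h) = interior (block w Q i f) \<and> f \<in> carrier G"
        if "e \<in> carrier G" for e
        using act_blocks[OF V(2) h that] that h by (intro exI[of _ "e \<otimes> h"]) simp
      ultimately show ?thesis
        unfolding orbit_def by (intro subset_antisym subsetI) (elim CollectE exE conjE, simp, blast)+
    qed
    show ?thesis
      using orb[OF V(3)] orb[OF one_closed] V(1,2) by (intro image_eqI[of _ _ i]) auto
  qed
  then have "orbit G (set_act act) ` blocks w Q \<subseteq> (\<lambda>i. orbit G (set_act act) (interior (block w Q i \<one>))) ` {..<k}"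
    by blast
  then show ?thesis by (rule finite_subset) simp
qed

text \<open>A point close to \<open>fl s x\<close>, moved back by time \<open>s\<close>, comes close
  to \<open>x\<close> and reaches a mark \<open>x'\<close> after a small time \<open>r\<close>; its
  time over \<open>x'\<close> is \<open>s - r\<close>. The radius \<open>d0\<close> keeps
  \<open>x'\<close> in the same translate as \<open>x\<close>.\<close>

lemma interior_block:
  assumes i: "i < k" and x: "x \<in> layer w i" "x \<notin> closure (S i - layer w i)" and g: "g \<in> carrier G" "x \<in> act g ` S0 i"
    and e: "e > 0" "\<And>s' x'. \<lbrakk>\<bar>s' - s\<bar> < e; dist x x' < e; x' \<in> layer w i\<rbrakk> \<Longrightarrow> Q s' x'"
  shows "fl s x \<in> interior (block w Q i g)"
proof -
  have "\<exists>d>0. \<forall>u\<in>S0 i. \<forall>y\<in>S i. dist u y < d \<longrightarrow> y \<in> S0 i"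
    using slices[OF i] unfolding slice_def by (elim conjE)
  then obtain d0 where d0: "d0 > 0" "\<And>u y. u \<in> S0 i \<Longrightarrow> y \<in> S i \<Longrightarrow> dist u y < d0 \<Longrightarrow> y \<in> S0 i"
    by blast
  have "min e d0 > 0" using e(1) d0(1) by simp
  then obtain d where d: "d > 0" "\<And>y'. dist x y' < d \<Longrightarrow>
      \<exists>r. \<bar>r\<bar> < min e d0 \<and> fl r y' \<in> layer w i \<and> dist x (fl r y') < min e d0"
    using tube_layer[OF w i x] by blast
  have "open {y. dist x (fl (- s) y) < d}"
    by (intro open_Collect_less continuous_intros)
  moreover have "fl s x \<in> {y. dist x (fl (- s) y) < d}" using d(1) by simp
  moreover have "{y. dist x (fl (- s) y) < d} \<subseteq> block w Q i g"
  proof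
    fix y assume "y \<in> {y. dist x (fl (- s) y) < d}"
    then obtain r where r: "\<bar>r\<bar> < min e d0" "fl r (fl (- s) y) \<in> layer w i" "dist x (fl r (fl (- s) y)) < min e d0"
      using d(2) by blast
    define x' where "x' = fl r (fl (- s) y)"
    have x': "x' \<in> layer w i" "dist x x' < e" "dist x x' < d0" using r by (auto simp: x'_def)
    have "x' \<in> act g ` S0 i"
    proof -
      have "act (inv g) x \<in> S0 i" using g by auto
      moreover have "act (inv g) x' \<in> S i"
        using layer_slice[OF w x'(1)] slice_act[OF i, of "inv g"] g(1) by simp
      moreover have "dist (act (inv g) x) (act (inv g) x') < d0" using x'(3) g(1) by simp
      ultimately have "act (inv g) x' \<in> S0 i" by (rule d0(2))
      then show ?thesis using g(1) by (intro image_eqI[of _ _ "act (inv g) x'"]) auto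
    qed
    moreover have "fl (s - r) x' = fl (s - r + r + - s) y"
      by (simp only: x'_def fl_add)
    then have "y = fl (s - r) x'" by simp
    moreover have "Q (s - r) x'"
      using e(2)[of "s - r" x'] x' r(1) by simp
    ultimately show "y \<in> block w Q i g"
      unfolding block_def using x'(1) by blast
  qed
  ultimately show ?thesis by (meson interiorI)
qed

end

text \<open>Segments close to a mark lie in a block of the first kind, the others between two marks in one of
  the second kind; there \<open>x\<close> is the last mark before the segment.\<close>
definition short_time :: "real \<Rightarrow> real \<Rightarrow> 'a \<Rightarrow> bool" where
  "short_time \<alpha> s x \<longleftrightarrow> \<bar>s\<bar> < 4 * \<alpha>"

definition gap_time :: "(nat \<Rightarrow> 'a \<Rightarrow> real) \<Rightarrow> real \<Rightarrow> real \<Rightarrow> real \<Rightarrow> 'a \<Rightarrow> bool" where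
  "gap_time w \<alpha> P s x \<longleftrightarrow> \<alpha> < s \<and> s < P \<and> (\<forall>t. 0 < t \<longrightarrow> t \<le> s + \<alpha> \<longrightarrow> fl t x \<notin> marks w k)"

lemma short_time_unique:
  assumes w: "weight w" and \<alpha>: "8 * \<alpha> \<le> R - 2" and i: "i < k" "j < k"
    and x: "x \<in> layer w i" "y \<in> layer w j" "short_time \<alpha> s x" "short_time \<alpha> t y" "fl s x = fl t y"
  shows "s = t"
proof -
  have "y = fl (- t) (fl s x)" using x(5) by simp
  then have "fl (s - t) x = y" using fl_add[of "- t" s x] by simp
  \<comment> \<open>Both times are below \<open>4 * \<alpha>\<close> in absolute value, whence the
    requirement on \<open>R\<close>.\<close>
  moreover have "\<bar>s - t\<bar> \<le> R - 2" using x(3,4) \<alpha> unfolding short_time_def by linarith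
  ultimately show ?thesis
    using layer_separated[OF w i x(1), of "s - t"] x(2) by simp
qed

text \<open>Of two different marks on the orbit the later one would lie in the interval after the
  earlier one that \<open>gap_time\<close> keeps free of marks.\<close>

lemma gap_time_unique:
  assumes \<alpha>: "0 < \<alpha>" and i: "i < k" "j < k"
    and x: "x \<in> layer w i" "y \<in> layer w j" "gap_time w \<alpha> P s x" "gap_time w \<alpha> P t y" "fl s x = fl t y"
  shows "s = t"
proof (rule ccontr)
  have xm: "x \<in> marks w k" "y \<in> marks w k" using x(1,2) i by (auto simp: marks_iff)
  have "y = fl (- t) (fl s x)" "x = fl (- s) (fl t y)" using x(5) by (simp, metis fl_minus(1))
  then have e: "fl (s - t) x = y" "fl (t - s) y = x"
    using fl_add[of "- t" s x] fl_add[of "- s" t y] by simp_all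
  assume "s \<noteq> t"
  then consider "0 < s - t" | "0 < t - s" by linarith
  then show False
  proof cases
    case 1
    have "\<alpha> < t" using x(4) by (simp add: gap_time_def)
    then have "s - t \<le> s + \<alpha>" using \<alpha> by simp
    then show False using 1 x(3) e(1) xm by (auto simp: gap_time_def)
  next
    case 2
    have "\<alpha> < s" using x(3) by (simp add: gap_time_def)
    then have "t - s \<le> t + \<alpha>" using \<alpha> by simp
    then show False using 2 x(4) e(2) xm by (auto simp: gap_time_def)
  qed
qed

lemma gap_time_act:
  assumes "weight w" "g \<in> carrier G"
  shows "gap_time w \<alpha> P s (act g x) \<longleftrightarrow> gap_time w \<alpha> P s x"
  using assms by (simp add: gap_time_def fl_act marks_act)

lemma closure_marks: "closure (marks w m) \<subseteq> (\<Union>j<m. closure (layer w j))"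
proof (rule closure_minimal)
  show "marks w m \<subseteq> (\<Union>j<m. closure (layer w j))"
  proof
    fix x assume "x \<in> marks w m"
    then obtain j where "j < m" "x \<in> layer w j" by (auto simp: marks_iff)
    then show "x \<in> (\<Union>j<m. closure (layer w j))" using closure_subset by blast
  qed
qed (auto intro!: closed_UN)

text \<open>If this failed, marks would appear in the windows of points converging to
  \<open>x\<close>. Their times accumulate at some \<open>u\<close> with
  \<open>u \<le> s + \<alpha>\<close>, and \<open>cl\<close> makes the limit a mark, in the window
  of \<open>x\<close>.\<close>

lemma gap_time_robust:
  assumes w: "weight w" and i: "i < k" and \<alpha>: "0 < \<alpha>" and s: "\<alpha> < s" "s < P"
    and gap: "gap_time w \<alpha> P s x"
    and cl: "\<And>u j. \<lbrakk>0 \<le> u; u \<le> s + \<alpha>; j < k; fl u x \<in> closure (layer w j)\<rbrakk> \<Longrightarrow> fl u x \<in> layer w j"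
  shows "\<exists>e>0. \<forall>s' x'. \<bar>s' - s\<bar> < e \<longrightarrow> dist x x' < e \<longrightarrow> x' \<in> layer w i \<longrightarrow> gap_time w \<alpha> P s' x'"
proof (rule ccontr)
  assume contra: "\<not> ?thesis"
  \<comment> \<open>The first two terms preserve \<open>\<alpha> < s'\<close> and
    \<open>s' < P\<close>, so only the condition on marks can fail; the third tends to 0.\<close>
  define e where "e m = min (min (s - \<alpha>) (P - s)) (inverse (real (Suc m)))" for m
  have e: "e m > 0" "e m \<le> s - \<alpha>" "e m \<le> P - s" "e m \<le> inverse (real (Suc m))" for m
    using s by (auto simp: e_def)
  have "\<exists>s' x' t. \<bar>s' - s\<bar> < e m \<and> dist x x' < e m \<and> x' \<in> layer w i \<and> 0 < t \<and> t \<le> s' + \<alpha> \<and> fl t x' \<in> marks w k" for m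
  proof -
    obtain s' x' where s': "\<bar>s' - s\<bar> < e m" "dist x x' < e m" "x' \<in> layer w i" "\<not> gap_time w \<alpha> P s' x'"
      using contra e(1)[of m] by blast
    have "\<alpha> < s'" "s' < P" using s'(1) e(2,3)[of m] by linarith+
    then show ?thesis using s' unfolding gap_time_def by blast
  qed
  then obtain s' x' t where st: "\<And>m. \<bar>s' m - s\<bar> < e m" "\<And>m. dist x (x' m) < e m" "\<And>m. x' m \<in> layer w i"
      "\<And>m. 0 < t m" "\<And>m. t m \<le> s' m + \<alpha>" "\<And>m. fl (t m) (x' m) \<in> marks w k"
    by metis
  have inv0: "(\<lambda>m. inverse (real (Suc m))) \<longlonglongrightarrow> 0" by (rule LIMSEQ_inverse_real_of_nat)
  have dx: "dist (x' m) x \<le> inverse (real (Suc m))" and ds: "dist (s' m) s \<le> inverse (real (Suc m))" for m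
    using st(1,2)[of m] e(4)[of m] unfolding dist_commute[of "x' m" x] dist_real_def by linarith+
  have "(\<lambda>m. dist (x' m) x) \<longlonglongrightarrow> 0"
    by (rule tendsto_sandwich[OF _ _ tendsto_const inv0]) (simp, intro always_eventually allI dx)
  then have x'lim: "x' \<longlonglongrightarrow> x" by (rule tendsto_dist_iff[THEN iffD2])
  have "(\<lambda>m. dist (s' m) s) \<longlonglongrightarrow> 0"
    by (rule tendsto_sandwich[OF _ _ tendsto_const inv0]) (simp, intro always_eventually allI ds)
  then have s'lim: "s' \<longlonglongrightarrow> s" by (rule tendsto_dist_iff[THEN iffD2])
  \<comment> \<open>Without this bound the offending marks could converge to the mark
    \<open>x\<close> itself, as the condition \<open>0 < t\<close> is not closed.\<close>
  have tlow: "R - 2 \<le> t m" for m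
  proof (rule ccontr)
    assume "\<not> R - 2 \<le> t m"
    moreover obtain j where "j < k" "fl (t m) (x' m) \<in> layer w j"
      using st(6)[of m] by (auto simp: marks_iff)
    ultimately have "t m = 0"
      using layer_separated[OF w i \<open>j < k\<close> st(3)[of m], of "t m"] st(4)[of m] by simp
    then show False using st(4)[of m] by simp
  qed
  have tup: "t m \<le> P + \<alpha>" for m
    using st(1)[of m] st(5)[of m] e(3)[of m] by linarith
  have "\<bar>t m\<bar> \<le> P + \<alpha>" for m using st(4)[of m] tup[of m] by simp
  then obtain \<sigma> u where u: "strict_mono \<sigma>" "(t \<circ> \<sigma>) \<longlonglongrightarrow> u" "(x' \<circ> \<sigma>) \<longlonglongrightarrow> x" "fl u x \<in> closure (marks w k)"
    using limit_hit[OF x'lim _ st(6)] by blast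
  have "R - 2 \<le> u"
    by (rule LIMSEQ_le_const[OF u(2)]) (use tlow in auto)
  then have u0: "0 < u" using R by simp
  have "(s' \<circ> \<sigma>) \<longlonglongrightarrow> s" using LIMSEQ_subseq_LIMSEQ[OF s'lim u(1)] .
  then have "(\<lambda>m. (s' \<circ> \<sigma>) m + \<alpha>) \<longlonglongrightarrow> s + \<alpha>" by (intro tendsto_intros)
  then have us: "u \<le> s + \<alpha>"
    by (rule LIMSEQ_le[OF u(2)]) (use st(5) in auto)
  obtain j where "j < k" "fl u x \<in> closure (layer w j)"
    using u(4) closure_marks by blast
  then have "fl u x \<in> marks w k" using cl[of u j] u0 us by (auto simp: marks_iff)
  then show False using gap u0 us by (auto simp: gap_time_def)
qed

text \<open>If a mark lies within \<open>3 * \<alpha>\<close> of the centre, the whole segment is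
  within \<open>4 * \<alpha>\<close> of it. Otherwise the visit to a slice at about time
  \<open>- b\<close> yields a mark no later than \<open>- 3 * \<alpha>\<close>. The last such mark
  starts a gap that contains the segment with margin \<open>\<alpha>\<close>, and \<open>P\<close>
  exceeds the time from that mark to any point of the segment.\<close>

lemma blocks_cover:
  assumes w: "weight w" and \<alpha>: "0 < \<alpha>" and R_eq: "R = 8 * \<alpha> + 3"
    and b: "b = R + 3 + 3 * \<alpha>" and P: "P = b + R + 3 + 2 * \<alpha>"
    and good: "\<And>t. \<bar>t\<bar> \<le> P + \<alpha> + real k * (R + 2) \<Longrightarrow> fl t z \<notin> bad w"
    and core: "i0 < k" "\<bar>c\<bar> \<le> 1" "fl (c - b) z \<in> S i0" "0 < w i0 (fl (c - b) z)"
  shows "\<exists>V\<in>blocks w (short_time \<alpha>) \<union> blocks w (gap_time w \<alpha> P). \<forall>s. \<bar>s\<bar> \<le> \<alpha> \<longrightarrow> fl s z \<in> V"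
proof -
  have LC: "(fl u z \<in> layer w i \<longrightarrow> fl u z \<notin> closure (S i - layer w i)) \<and>
      (fl u z \<notin> layer w i \<longrightarrow> fl u z \<notin> closure (layer w i))"
    if "i < k" "\<bar>u\<bar> \<le> P + \<alpha>" "fl u z \<in> S i" for i u
  proof (rule layer_locally_constant[OF w that(1,3)])
    fix t assume t: "\<bar>t\<bar> \<le> real (Suc i) * (R + 2)"
    have "real (Suc i) * (R + 2) \<le> real k * (R + 2)"
      using that(1) R by (intro mult_right_mono) auto
    then have "\<bar>t + u\<bar> \<le> P + \<alpha> + real k * (R + 2)" using t that(2) by linarith
    then show "fl t (fl u z) \<notin> bad w" using good[of "t + u"] by (simp add: fl_add)
  qed
  have clos: "fl u z \<in> layer w j" if "j < k" "\<bar>u\<bar> \<le> P + \<alpha>" "fl u z \<in> closure (layer w j)" for u j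
  proof -
    have "closure (layer w j) \<subseteq> S j"
      using slice_closed[OF that(1)] layer_slice[OF w] by (intro closure_minimal) auto
    then show ?thesis using LC[OF that(1,2)] that(3) by blast
  qed
  have place: "\<exists>g\<in>carrier G. fl u z \<in> act g ` S0 i" if "i < k" "fl u z \<in> layer w i" for u i
    using layer_slice[OF w that(2)] slice_sat[OF that(1)] by (auto simp: sat_def)
  have "P + \<alpha> \<ge> 0" "3 * \<alpha> \<le> P" using P b \<alpha> R by linarith+
  show ?thesis
  proof (cases "\<exists>u. \<bar>u\<bar> < 3 * \<alpha> \<and> fl u z \<in> marks w k")
    case True
    then obtain u i where u: "\<bar>u\<bar> < 3 * \<alpha>" "i < k" "fl u z \<in> layer w i"
      by (auto simp: marks_iff)
    obtain g where g: "g \<in> carrier G" "fl u z \<in> act g ` S0 i" using place[OF u(2,3)] by blast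
    have uP: "\<bar>u\<bar> \<le> P + \<alpha>" using u(1) \<open>3 * \<alpha> \<le> P\<close> \<alpha> by linarith
    have ncl: "fl u z \<notin> closure (S i - layer w i)"
      using LC[OF u(2) uP layer_slice[OF w u(3)]] u(3) by blast
    have inV: "fl s z \<in> interior (block w (short_time \<alpha>) i g)" if s: "\<bar>s\<bar> \<le> \<alpha>" for s
    proof -
      have lt: "\<bar>s - u\<bar> < 4 * \<alpha>" using s u(1) by linarith
      have "fl (s - u) (fl u z) \<in> interior (block w (short_time \<alpha>) i g)"
      proof (rule interior_block[OF w _ _ u(2,3) ncl g])
        show "4 * \<alpha> - \<bar>s - u\<bar> > 0" using lt by simp
        show "short_time \<alpha> s' x'" if "\<bar>s' - (s - u)\<bar> < 4 * \<alpha> - \<bar>s - u\<bar>" for s' x'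
          using that unfolding short_time_def by linarith
        show "short_time \<alpha> s (act g x) = short_time \<alpha> s x" for g s x by (simp add: short_time_def)
        show "s = t" if "i < k" "j < k" "x \<in> layer w i" "y \<in> layer w j" "short_time \<alpha> s x" "short_time \<alpha> t y"
            "fl s x = fl t y" for i j x y s t
          by (rule short_time_unique[OF w _ that]) (simp add: R_eq)
      qed
      then show ?thesis using fl_add[of "s - u" u z] by simp
    qed
    then have "interior (block w (short_time \<alpha>) i g) \<in> blocks w (short_time \<alpha>)"
      using inV[of 0] \<alpha> u(2) g(1) unfolding blocks_def by auto
    then show ?thesis using inV by blast
  next
    case False
    \<comment> \<open>The mark obtained from the slice visit lies within \<open>1 + (R + 2)\<close>
      of time \<open>- b\<close>. The bounds come from \<open>b - R - 3 = 3 * \<alpha>\<close> and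
      \<open>b + R + 3 = P - 2 * \<alpha>\<close>.\<close>
    define T where "T = {u. - (P - 2 * \<alpha>) \<le> u \<and> u \<le> - 3 * \<alpha> \<and> fl u z \<in> marks w k}"
    obtain t where t: "\<bar>t\<bar> \<le> R + 2" "fl t (fl (c - b) z) \<in> marks w k"
      using mark_near[OF w core(1,3,4)] by blast
    have "t + (c - b) \<in> T"
      using t core(2) by (simp add: T_def fl_add b P abs_le_iff)
    then have T0: "T \<noteq> {}" by blast
    have sep: "u = u'" if uu: "u \<in> T" "u' \<in> T" "\<bar>u - u'\<bar> \<le> R - 2" for u u'
    proof -
      obtain i j where ij: "i < k" "fl u' z \<in> layer w i" "j < k" "fl u z \<in> layer w j"
        using uu(1,2) by (auto simp: T_def marks_iff)
      have "fl (u - u') (fl u' z) = fl u z" using fl_add[of "u - u'" u' z] by simp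
      then have "u - u' = 0"
        using layer_separated[OF w ij(1,3,2), of "u - u'"] ij(4) uu(3) by simp
      then show ?thesis by simp
    qed
    \<comment> \<open>Marks on an orbit are more than \<open>R - 2\<close> apart, so each interval
      of this length in the subdivision holds at most one, and a last one exists.\<close>
    have finT: "finite T"
    proof (rule finite_imageD)
      define f where "f u = \<lfloor>u / (R - 2)\<rfloor>" for u
      have "f ` T \<subseteq> {\<lfloor>- (P - 2 * \<alpha>) / (R - 2)\<rfloor>..\<lfloor>- 3 * \<alpha> / (R - 2)\<rfloor>}"
      proof
        fix y assume "y \<in> f ` T"
        then obtain u where u: "y = f u" "- (P - 2 * \<alpha>) \<le> u" "u \<le> - 3 * \<alpha>" by (auto simp: T_def)
        have "0 \<le> R - 2" using R by simp
        then have "- (P - 2 * \<alpha>) / (R - 2) \<le> u / (R - 2)" "u / (R - 2) \<le> - 3 * \<alpha> / (R - 2)"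
          using u(2,3) divide_right_mono by blast+
        then show "y \<in> {\<lfloor>- (P - 2 * \<alpha>) / (R - 2)\<rfloor>..\<lfloor>- 3 * \<alpha> / (R - 2)\<rfloor>}"
          unfolding u(1) f_def atLeastAtMost_iff using floor_mono by blast
      qed
      then show "finite (f ` T)" by (rule finite_subset) simp
      show "inj_on f T"
      proof (rule inj_onI)
        fix u u' assume uu: "u \<in> T" "u' \<in> T" "f u = f u'"
        have "\<bar>u / (R - 2) - u' / (R - 2)\<bar> < 1"
          using uu(3) unfolding f_def by linarith
        then have "\<bar>u - u'\<bar> / (R - 2) < 1"
          using R by (simp add: diff_divide_distrib[symmetric])
        then have "\<bar>u - u'\<bar> \<le> R - 2" using R by (simp add: divide_less_eq)
        then show "u = u'" using sep uu(1,2) by blast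
      qed
    qed
    define u where "u = Max T"
    have uT: "u \<in> T" "\<And>u'. u' \<in> T \<Longrightarrow> u' \<le> u"
      using finT T0 by (auto simp: u_def)
    then have ub: "- (P - 2 * \<alpha>) \<le> u" "u \<le> - 3 * \<alpha>" by (auto simp: T_def)
    obtain i where i: "i < k" "fl u z \<in> layer w i" using uT(1) by (auto simp: T_def marks_iff)
    obtain g where g: "g \<in> carrier G" "fl u z \<in> act g ` S0 i" using place[OF i] by blast
    have uP: "\<bar>u\<bar> \<le> P + \<alpha>" using ub \<alpha> by linarith
    have ncl: "fl u z \<notin> closure (S i - layer w i)"
      using LC[OF i(1) uP layer_slice[OF w i(2)]] i(2) by blast
    have inV: "fl s z \<in> interior (block w (gap_time w \<alpha> P) i g)" if s: "\<bar>s\<bar> \<le> \<alpha>" for s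
    proof -
      have su: "\<alpha> < s - u" "s - u < P" using s ub \<alpha> by linarith+
      \<comment> \<open>The time \<open>t + u\<close> is at most \<open>2 * \<alpha>\<close>, so a
        mark there contradicts either the maximality of \<open>u\<close> or the absence of marks
        near the centre.\<close>
      have nomark: "fl t (fl u z) \<notin> marks w k" if t: "0 < t" "t \<le> s - u + \<alpha>" for t
      proof
        assume "fl t (fl u z) \<in> marks w k"
        then have m: "fl (t + u) z \<in> marks w k" by (simp add: fl_add)
        show False
        proof (cases "t + u \<le> - 3 * \<alpha>")
          case True
          then have "t + u \<in> T" using m ub t by (simp add: T_def)
          then show False using uT(2)[of "t + u"] t(1) by simp
        next
          case False
          then have "\<bar>t + u\<bar> < 3 * \<alpha>" using t s \<alpha> by linarith
          then show False using m \<open>\<not> (\<exists>u. \<bar>u\<bar> < 3 * \<alpha> \<and> fl u z \<in> marks w k)\<close> by blast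
        qed
      qed
      then have gap: "gap_time w \<alpha> P (s - u) (fl u z)" using su by (simp add: gap_time_def)
      have cl: "fl t (fl u z) \<in> layer w j"
        if "0 \<le> t" "t \<le> s - u + \<alpha>" "j < k" "fl t (fl u z) \<in> closure (layer w j)" for t j
      proof -
        have "\<bar>t + u\<bar> \<le> P + \<alpha>" using that(1,2) s ub \<alpha> \<open>3 * \<alpha> \<le> P\<close> by linarith
        then show ?thesis using clos[OF that(3), of "t + u"] that(4) by (simp add: fl_add)
      qed
      obtain e where e: "e > 0" "\<And>s' x'. \<lbrakk>\<bar>s' - (s - u)\<bar> < e; dist (fl u z) x' < e; x' \<in> layer w i\<rbrakk> \<Longrightarrow> gap_time w \<alpha> P s' x'"
        using gap_time_robust[OF w i(1) \<alpha> su gap cl] by blast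
      have "fl (s - u) (fl u z) \<in> interior (block w (gap_time w \<alpha> P) i g)"
      proof (rule interior_block[OF w _ _ i ncl g e])
        show "gap_time w \<alpha> P s (act g x) = gap_time w \<alpha> P s x" if "g \<in> carrier G" for g s x
          by (rule gap_time_act[OF w that])
        show "s = t" if "i < k" "j < k" "x \<in> layer w i" "y \<in> layer w j" "gap_time w \<alpha> P s x" "gap_time w \<alpha> P t y"
            "fl s x = fl t y" for i j x y s t
          by (rule gap_time_unique[OF \<alpha> that])
      qed
      then show ?thesis using fl_add[of "s - u" u z] by simp
    qed
    then have "interior (block w (gap_time w \<alpha> P) i g) \<in> blocks w (gap_time w \<alpha> P)"
      using inV[of 0] \<alpha> i(1) g(1) unfolding blocks_def by auto
    then show ?thesis using inV by blast
  qed
qed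

lemma slice_system_cover:
  assumes dim: "covering_dim_le X n" and \<alpha>: "0 < \<alpha>" and R_eq: "R = 8 * \<alpha> + 3" and b: "b = R + 3 + 3 * \<alpha>"
    and core: "\<And>z. z \<in> K \<Longrightarrow> \<exists>i<k. \<exists>c. \<bar>c\<bar> \<le> 1 \<and> fl (c - b) z \<in> S i \<and> 1/2 < q i (fl (c - b) z)"
  shows "\<exists>\<V>. (\<forall>V\<in>\<V>. open V \<and> family_subset G act (virtually_cyclic_subgroups G) V) \<and>
      (\<forall>g\<in>carrier G. \<forall>V\<in>\<V>. act g ` V \<in> \<V>) \<and>
      collection_dim_le \<V> (2 * n + 1) \<and>
      finite (orbits G \<V> (set_act act)) \<and>
      (\<forall>z\<in>sat K. \<exists>V\<in>\<V>. \<forall>s. \<bar>s\<bar> \<le> \<alpha> \<longrightarrow> fl s z \<in> V)"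
proof -
  define P where "P = b + R + 3 + 2 * \<alpha>"
  \<comment> \<open>Marks at times up to \<open>P + \<alpha>\<close> depend on chains of earlier
    marks over at most \<open>k\<close> slices, with steps of at most \<open>R + 2\<close>.\<close>
  define N where "N = P + \<alpha> + real k * (R + 2)"
  have "0 \<le> real k * (R + 2)" using R by simp
  then have "0 \<le> N" using R \<alpha> by (simp add: N_def P_def b)
  then obtain v where v: "admissible v" "\<forall>r. \<forall>i<k. \<forall>x. \<bar>v r i x - q i x\<bar> \<le> 1/2"
      "\<forall>z. \<exists>r\<le>n. \<forall>t. \<bar>t\<bar> \<le> N \<longrightarrow> fl t z \<notin> bad (v r)"
    using general_position[OF dim] by blast
  have w: "weight (v r)" for r
    using v(1,2) by (simp add: weight_def admissible_def)
  \<comment> \<open>Indexing by pairs of a weight and a time condition bounds the number of families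
    even if different \<open>r\<close> give the same weight.\<close>
  define \<C> where "\<C> = (\<lambda>r. (v r, short_time \<alpha>)) ` {..n} \<union> (\<lambda>r. (v r, gap_time (v r) \<alpha> P)) ` {..n}"
  define \<V> where "\<V> = (\<Union>(u, Q)\<in>\<C>. blocks u Q)"
  have fin\<C>: "finite \<C>" by (simp add: \<C>_def)
  have "card \<C> \<le> card {..n} + card {..n}"
    unfolding \<C>_def by (rule order_trans[OF card_Un_le add_mono[OF card_image_le card_image_le]]) auto
  then have card\<C>: "card \<C> \<le> 2 * n + 2" by simp
  have uQ: "weight u" "\<And>g s x. g \<in> carrier G \<Longrightarrow> Q s (act g x) \<longleftrightarrow> Q s x"
      "\<And>i j x y s t. \<lbrakk>i < k; j < k; x \<in> layer u i; y \<in> layer u j; Q s x; Q t y; fl s x = fl t y\<rbrakk> \<Longrightarrow> s = t"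
    if uC: "(u, Q) \<in> \<C>" for u Q
  proof -
    from uC obtain r where r: "u = v r" and Q: "Q = short_time \<alpha> \<or> Q = gap_time (v r) \<alpha> P"
      by (auto simp: \<C>_def)
    show "weight u" using w r by simp
    show "Q s (act g x) \<longleftrightarrow> Q s x" if "g \<in> carrier G" for g s x
      using Q gap_time_act[OF w that] by (auto simp: short_time_def)
    show "s = t" if "i < k" "j < k" "x \<in> layer u i" "y \<in> layer u j" "Q s x" "Q t y" "fl s x = fl t y" for i j x y s t
      using Q
    proof
      assume Q': "Q = short_time \<alpha>"
      have "8 * \<alpha> \<le> R - 2" using R_eq by simp
      then show ?thesis
        using short_time_unique[OF w _ that(1,2)] that(3-7) unfolding Q' r by blast
    next
      assume Q': "Q = gap_time (v r) \<alpha> P"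
      show ?thesis
        using gap_time_unique[OF \<alpha> that(1,2)] that(3-7) unfolding Q' r by blast
    qed
  qed
  show ?thesis
  proof (intro exI[of _ \<V>] conjI ballI)
    fix V assume "V \<in> \<V>"
    then obtain u Q where V: "(u, Q) \<in> \<C>" "V \<in> blocks u Q" by (auto simp: \<V>_def)
    show "open V" using V(2) by (auto simp: blocks_def)
    show "family_subset G act (virtually_cyclic_subgroups G) V"
      by (rule blocks_family_subset[of u Q]) (use uQ[OF V(1)] V(2) in blast)+
    show "act g ` V \<in> \<V>" if g: "g \<in> carrier G" for g
    proof -
      have "act g ` V \<in> blocks u Q"
        by (rule blocks_invariant[of u Q]) (use uQ[OF V(1)] V(2) g in blast)+
      then show ?thesis using V(1) by (auto simp: \<V>_def)
    qed
  next
    have "finite {V \<in> \<V>. x \<in> V} \<and> card {V \<in> \<V>. x \<in> V} \<le> 2 * n + 1 + 1" for x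
    proof -
      define D where "D p = {V \<in> blocks (fst p) (snd p). x \<in> V}" for p
      have eq: "{V \<in> \<V>. x \<in> V} = (\<Union>p\<in>\<C>. D p)" by (auto simp: \<V>_def D_def)
      have D: "finite (D p) \<and> card (D p) \<le> 1" if "p \<in> \<C>" for p
      proof -
        have p: "(fst p, snd p) \<in> \<C>" using that by simp
        show ?thesis
          unfolding D_def
          by (intro conjI blocks_card[of "fst p" "snd p"]) (use uQ[OF p] in blast)+
      qed
      have "card (\<Union>p\<in>\<C>. D p) \<le> (\<Sum>p\<in>\<C>. card (D p))" by (rule card_UN_le[OF fin\<C>])
      also have "\<dots> \<le> (\<Sum>p\<in>\<C>. 1)" using D by (intro sum_mono) blast
      also have "\<dots> \<le> 2 * n + 2" using card\<C> by simp
      finally show ?thesis using eq fin\<C> D by simp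
    qed
    then show "collection_dim_le \<V> (2 * n + 1)" by (simp add: collection_dim_le_def)
  next
    have "finite (orbit G (set_act act) ` blocks (fst p) (snd p))" if "p \<in> \<C>" for p
    proof -
      have p: "(fst p, snd p) \<in> \<C>" using that by simp
      show ?thesis by (rule blocks_cofinite) (use uQ[OF p] in blast)+
    qed
    then have "finite (\<Union>p\<in>\<C>. orbit G (set_act act) ` blocks (fst p) (snd p))"
      using fin\<C> by blast
    moreover have "orbits G \<V> (set_act act) \<subseteq> (\<Union>p\<in>\<C>. orbit G (set_act act) ` blocks (fst p) (snd p))"
      by (auto simp: orbits_def \<V>_def)
    ultimately show "finite (orbits G \<V> (set_act act))" by (rule finite_subset[rotated])
  next
    fix z assume "z \<in> sat K"
    then obtain g y where g: "g \<in> carrier G" "y \<in> K" "z = act g y" by (auto simp: sat_def)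
    obtain i c where ic: "i < k" "\<bar>c\<bar> \<le> 1" "fl (c - b) y \<in> S i" "1/2 < q i (fl (c - b) y)"
      using core[OF g(2)] by blast
    have z: "fl (c - b) z \<in> S i" "1/2 < q i (fl (c - b) z)"
      using ic g slice_act[OF ic(1) g(1)] slice_cinv[OF ic(1)]
      by (simp_all add: fl_act cinv_def invariant_def)
    obtain r where r: "r \<le> n" "\<And>t. \<bar>t\<bar> \<le> N \<Longrightarrow> fl t z \<notin> bad (v r)" using v(3) by blast
    have "\<bar>v r i (fl (c - b) z) - q i (fl (c - b) z)\<bar> \<le> 1/2" using v(2) ic(1) by blast
    then have pos: "0 < v r i (fl (c - b) z)" using z(2) by linarith
    have "\<exists>V\<in>blocks (v r) (short_time \<alpha>) \<union> blocks (v r) (gap_time (v r) \<alpha> P). \<forall>s. \<bar>s\<bar> \<le> \<alpha> \<longrightarrow> fl s z \<in> V"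
      by (rule blocks_cover[OF w \<alpha> R_eq b P_def _ ic(1,2) z(1) pos]) (rule r(2), simp add: N_def)
    then obtain V where V: "V \<in> blocks (v r) (short_time \<alpha>) \<union> blocks (v r) (gap_time (v r) \<alpha> P)"
        "\<forall>s. \<bar>s\<bar> \<le> \<alpha> \<longrightarrow> fl s z \<in> V"
      by blast
    have "V \<in> \<V>"
      using V(1) r(1) unfolding \<V>_def \<C>_def by auto
    then show "\<exists>V\<in>\<V>. \<forall>s. \<bar>s\<bar> \<le> \<alpha> \<longrightarrow> fl s z \<in> V" using V(2) by blast
  qed
qed

end

section \<open>Slices through a compact set and conclusion\<close>

context proper_flow begin

text \<open>Compactness of \<open>K\<close> is applied to balls of this kind: near the centre of a
  slice all orbits cross it within time 1, at points where \<open>q\<close> leaves room for a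
  perturbation by 1/2.\<close>

lemma slice_core:
  assumes S: "slice \<Lambda> S S0 q" and y: "y \<in> S" "q y = 1"
  shows "\<exists>d>0. \<forall>y'\<in>ball y d. \<exists>c. \<bar>c\<bar> \<le> 1 \<and> fl c y' \<in> S \<and> 1/2 < q (fl c y')"
proof -
  have "continuous_on UNIV q" using S by (simp add: slice_def cinv_def)
  then have c: "continuous_on UNIV (\<lambda>p. q (fl (snd p) (fst p)))"
    by (rule continuous_on_compose2) (auto intro!: continuous_intros)
  have "open {p. 1/2 < q (fl (snd p) (fst p))}"
    by (intro open_Collect_less c continuous_intros)
  moreover have "(y, 0) \<in> {p. 1/2 < q (fl (snd p) (fst p))}" using y(2) by simp
  ultimately obtain Y T where YT: "open Y" "open T" "(y, 0) \<in> Y \<times> T" "Y \<times> T \<subseteq> {p. 1/2 < q (fl (snd p) (fst p))}"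
    by (rule open_prod_elim)
  obtain d1 where d1: "d1 > 0" "ball y d1 \<subseteq> Y" using YT(1,3) open_contains_ball by blast
  obtain e1 where e1: "e1 > 0" "ball 0 e1 \<subseteq> T" using YT(2,3) open_contains_ball by blast
  have tube: "\<forall>y\<in>S. - 1 < q y \<longrightarrow> (\<forall>e>0. \<exists>d>0. \<forall>y'. dist y y' < d \<longrightarrow> (\<exists>t. \<bar>t\<bar> < e \<and> fl t y' \<in> S))"
    using S unfolding slice_def by (elim conjE)
  have "- 1 < q y" "0 < min 1 e1" using y(2) e1(1) by auto
  then obtain d2 where d2: "d2 > 0" "\<And>y'. dist y y' < d2 \<Longrightarrow> \<exists>t. \<bar>t\<bar> < min 1 e1 \<and> fl t y' \<in> S"
    using tube y(1) by blast
  have "\<exists>c. \<bar>c\<bar> \<le> 1 \<and> fl c y' \<in> S \<and> 1/2 < q (fl c y')" if y': "y' \<in> ball y (min d1 d2)" for y'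
  proof -
    obtain t where t: "\<bar>t\<bar> < min 1 e1" "fl t y' \<in> S" using d2(2)[of y'] y' by auto
    have "y' \<in> Y" using d1(2) y' by auto
    moreover have "t \<in> T" using e1(2) t(1) by (auto simp: dist_real_def)
    ultimately have "1/2 < q (fl t y')" using YT(4) by auto
    then show ?thesis using t by (intro exI[of _ t]) auto
  qed
  then show ?thesis using d1(1) d2(1) by (intro exI[of _ "min d1 d2"]) auto
qed

text \<open>The slices are placed through the image of \<open>K\<close> under
  \<open>fl (- b)\<close>, in the past of \<open>K\<close>, so that marks exist before each segment.
  The period assumption moves there because the flow commutes with \<open>G\<close>. The bound
  \<open>16 * \<alpha> + 10\<close> is \<open>2 * R + 4\<close> for
  \<open>R = 8 * \<alpha> + 3\<close>.\<close>

lemma long_thin_cover: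
  assumes dim: "covering_dim_le X n" and \<alpha>: "0 < \<alpha>" and K: "compact K" "K \<subseteq> X"
    and per: "\<And>z t. \<lbrakk>z \<in> K; 0 < t; t \<le> 16 * \<alpha> + 10\<rbrakk> \<Longrightarrow> fl t z \<notin> orb z"
  shows "\<exists>\<V>. (\<forall>V\<in>\<V>. open V \<and> family_subset G act (virtually_cyclic_subgroups G) V) \<and>
      (\<forall>g\<in>carrier G. \<forall>V\<in>\<V>. act g ` V \<in> \<V>) \<and>
      collection_dim_le \<V> (2 * n + 1) \<and>
      finite (orbits G \<V> (set_act act)) \<and>
      (\<forall>z\<in>sat K. \<exists>V\<in>\<V>. \<forall>s. \<bar>s\<bar> \<le> \<alpha> \<longrightarrow> fl s z \<in> V)"
proof -
  define R where "R = 8 * \<alpha> + 3"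
  define b where "b = R + 3 + 3 * \<alpha>"
  define \<Lambda> where "\<Lambda> = 16 * \<alpha> + 10"
  define L where "L = fl (- b) ` K"
  have cL: "compact L"
    unfolding L_def by (intro compact_continuous_image continuous_intros K(1))
  have "\<exists>S S0 q d. slice \<Lambda> S S0 q \<and> d > 0 \<and> (\<forall>y'\<in>ball y d. \<exists>c. \<bar>c\<bar> \<le> 1 \<and> fl c y' \<in> S \<and> 1/2 < q (fl c y'))"
    if y: "y \<in> L" for y
  proof -
    obtain z where z: "z \<in> K" "y = fl (- b) z" using y by (auto simp: L_def)
    have "fl t y \<notin> orb y" if t: "0 < t" "t \<le> \<Lambda>" for t
    proof
      assume "fl t y \<in> orb y"
      then obtain g where g: "g \<in> carrier G" "fl t y = act g y" by (auto simp: orb_def)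
      have "fl (- b) (fl t z) = fl t y" unfolding z(2) by (metis add.commute fl_add)
      also have "\<dots> = fl (- b) (act g z)" using g z(2) by (simp add: fl_act)
      finally have "fl t z = act g z" by (simp add: fl_inj)
      then show False using per[OF z(1) t(1)] t(2) g(1) by (auto simp: orb_def \<Lambda>_def)
    qed
    moreover have "y \<in> X" using z K(2) by auto
    moreover have "0 < \<Lambda>" using \<alpha> by (simp add: \<Lambda>_def)
    ultimately obtain S S0 q where S: "slice \<Lambda> S S0 q" "y \<in> S" "q y = 1"
      using slice_exists by blast
    then show ?thesis using slice_core[OF S] by blast
  qed
  then obtain S' S0' q' d where S': "\<And>y. y \<in> L \<Longrightarrow> slice \<Lambda> (S' y) (S0' y) (q' y)" "\<And>y. y \<in> L \<Longrightarrow> d y > 0"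
      "\<And>y y'. \<lbrakk>y \<in> L; y' \<in> ball y (d y)\<rbrakk> \<Longrightarrow> \<exists>c. \<bar>c\<bar> \<le> 1 \<and> fl c y' \<in> S' y \<and> 1/2 < q' y (fl c y')"
    by metis
  have "L \<subseteq> (\<Union>y\<in>L. ball y (d y))" using S'(2) by auto
  then obtain C where C: "C \<subseteq> L" "finite C" "L \<subseteq> (\<Union>y\<in>C. ball y (d y))"
    using compactE_image[OF cL, of L "\<lambda>y. ball y (d y)"] by auto
  obtain h where h: "bij_betw h {0..<card C} C"
    using ex_bij_betw_nat_finite[OF C(2)] by blast
  have hC: "h i \<in> C" if "i < card C" for i
    using h that by (auto simp: bij_betw_def)
  have hL: "h i \<in> L" if "i < card C" for i
    using hC[OF that] C(1) by blast
  interpret sys: slice_system G act fl X "card C" R \<Lambda> "\<lambda>i. S' (h i)" "\<lambda>i. S0' (h i)" "\<lambda>i. q' (h i)"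
  proof
    show "2 < R" using \<alpha> by (simp add: R_def)
    show "2 * R + 4 \<le> \<Lambda>" by (simp add: R_def \<Lambda>_def)
    show "slice \<Lambda> (S' (h i)) (S0' (h i)) (q' (h i))" if "i < card C" for i
      by (rule S'(1)[OF hL[OF that]])
  qed
  show ?thesis
  proof (rule sys.slice_system_cover[OF dim \<alpha> R_def b_def])
    fix z assume "z \<in> K"
    then have "fl (- b) z \<in> L" by (simp add: L_def)
    then obtain y where y: "y \<in> C" "fl (- b) z \<in> ball y (d y)" using C(3) by blast
    have "y \<in> h ` {0..<card C}" using h y(1) by (simp add: bij_betw_def)
    then obtain i where i: "i < card C" "y = h i" by auto
    obtain c where c: "\<bar>c\<bar> \<le> 1" "fl c (fl (- b) z) \<in> S' y" "1/2 < q' y (fl c (fl (- b) z))"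
      using S'(3)[of y "fl (- b) z"] y C(1) by blast
    have "fl (c - b) z = fl c (fl (- b) z)" using fl_add[of c "- b" z] by simp
    then show "\<exists>i<card C. \<exists>c. \<bar>c\<bar> \<le> 1 \<and> fl (c - b) z \<in> S' (h i) \<and> 1/2 < q' (h i) (fl (c - b) z)"
      using c i by (intro exI[of _ i] conjI exI[of _ c]) simp_all
  qed
qed

end

theorem theorem3p2:
  fixes G :: "('g, 'b) monoid_scheme"
    and act :: "'g \<Rightarrow> 'a::metric_space \<Rightarrow> 'a"
    and \<Phi> :: "'a \<times> real \<Rightarrow> 'a"
  assumes "group G"
    and "group_action G UNIV act"
    and "\<And>g x y. g \<in> carrier G \<Longrightarrow> dist (act g x) (act g y) = dist x y"
    and "is_flow \<Phi>"
    and "\<And>g z t. g \<in> carrier G \<Longrightarrow> \<Phi> (act g z, t) = act g (\<Phi> (z, t))"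
    and "locally connected (UNIV - flow_stationary \<Phi>)"
    and "locally compact (UNIV - flow_stationary \<Phi>)"
    and "\<exists>n. covering_dim_le (UNIV - flow_stationary \<Phi>) n"
    and "proper_action_on G act (UNIV - flow_stationary \<Phi>)"
    and "flow_uniformly_continuous \<Phi>"
  shows "\<exists>M::nat. \<forall>\<alpha>::real. \<alpha> > 0 \<longrightarrow>
    (\<exists>\<gamma>::real. \<gamma> > 0 \<and>
      (\<forall>K. compact K \<and> K \<subseteq> period_gt G act \<Phi> \<gamma> \<longrightarrow>
        (\<exists>\<V> :: 'a set set.
          (\<forall>V\<in>\<V>. open V \<and> family_subset G act (virtually_cyclic_subgroups G) V) \<and>
          (\<forall>g\<in>carrier G. \<forall>V\<in>\<V>. act g ` V \<in> \<V>) \<and>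
          collection_dim_le \<V> M \<and>
          finite (orbits G \<V> (set_act act)) \<and>
          (\<forall>z \<in> (\<Union>g\<in>carrier G. act g ` K). \<exists>V\<in>\<V>. flow_segment \<Phi> \<alpha> z \<subseteq> V))))"
proof -
  let ?X = "UNIV - flow_stationary \<Phi>"
  interpret action: group_action G UNIV act by fact
  have act_one: "act \<one>\<^bsub>G\<^esub> x = x" for x
    using fun_cong[OF action.id_eq_one, of x] by simp
  have act_mult: "act (g \<otimes>\<^bsub>G\<^esub> h) x = act g (act h x)" if "g \<in> carrier G" "h \<in> carrier G" for g h x
    using action.composition_rule[of x g h] that by simp
  have \<Phi>0: "\<Phi> (z, 0) = z" and \<Phi>add: "\<Phi> (z, s + t) = \<Phi> (\<Phi> (z, s), t)" and \<Phi>c: "continuous_on UNIV \<Phi>" for z s t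
    using assms(4) by (auto simp: is_flow_def)
  have \<Phi>ct: "continuous_on UNIV (\<lambda>z. \<Phi> (z, t))" for t
    by (rule continuous_on_compose2[OF \<Phi>c]) (auto intro!: continuous_intros)
  have "flow_stationary \<Phi> = (\<Inter>t. {z. \<Phi> (z, t) = z})"
    by (auto simp: flow_stationary_def)
  moreover have "closed (\<Inter>t. {z. \<Phi> (z, t) = z})"
    by (intro closed_INT ballI closed_Collect_eq \<Phi>ct continuous_on_id)
  ultimately have X_open: "open ?X"
    by (simp add: open_Diff)
  have rev: "\<Phi> (\<Phi> (x, t), - t) = x" for x t
    using \<Phi>add[of x t "- t"] \<Phi>0[of x] by simp
  have X_fl: "\<Phi> (x, t) \<in> ?X" if "x \<in> ?X" for x t
  proof (rule ccontr)
    assume "\<Phi> (x, t) \<notin> ?X"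
    then have still: "\<Phi> (\<Phi> (x, t), s) = \<Phi> (x, t)" for s by (simp add: flow_stationary_def)
    have "\<Phi> (x, s) = x" for s
      using \<Phi>add[of x t "s - t"] \<Phi>add[of x s "- s"] still[of "s - t"] still[of "- t"] rev[of x t]
      by (metis add.commute diff_add_cancel)
    then show False using that by (simp add: flow_stationary_def)
  qed
  have act_inj: "x = y" if "g \<in> carrier G" "act g x = act g y" for g x y
    using action.inj_prop[OF that(1)] that(2) by (simp add: inj_on_def)
  have X_act: "act g x \<in> ?X" if "g \<in> carrier G" "x \<in> ?X" for g x
    using that act_inj[OF that(1)] by (auto simp: flow_stationary_def assms(5))
  have X_cball: "\<exists>r>0. compact (cball x r) \<and> cball x r \<subseteq> ?X" if x: "x \<in> ?X" for x
  proof -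
    have "\<exists>U V. openin (top_of_set ?X) U \<and> compact V \<and> x \<in> U \<and> U \<subseteq> V \<and> V \<subseteq> ?X"
      using assms(7) x openin_subtopology_self[of ?X] unfolding locally_def by blast
    then obtain U V where UV: "openin (top_of_set ?X) U" "compact V" "x \<in> U" "U \<subseteq> V" "V \<subseteq> ?X"
      by blast
    have "open U" using UV(1) X_open openin_open_eq by blast
    then obtain r where r: "r > 0" "cball x r \<subseteq> U"
      using UV(3) open_contains_cball by blast
    have "compact (V \<inter> cball x r)" by (rule compact_Int_closed[OF UV(2)]) simp
    moreover have "V \<inter> cball x r = cball x r" using r(2) UV(4) by blast
    ultimately show ?thesis using r UV(4,5) by (intro exI[of _ r]) auto
  qed
  have X_proper: "\<exists>r>0. finite {g \<in> carrier G. dist x (act g x) < r}" if x: "x \<in> ?X" for x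
  proof -
    have "\<exists>U. openin (top_of_set ?X) U \<and> x \<in> U \<and> finite {g \<in> carrier G. act g ` U \<inter> U \<noteq> {}}"
      using assms(9) x unfolding proper_action_on_def by (rule bspec)
    then obtain U where U: "openin (top_of_set ?X) U" "x \<in> U" "finite {g \<in> carrier G. act g ` U \<inter> U \<noteq> {}}"
      by blast
    have "open U" using U(1) X_open openin_open_eq by blast
    then obtain r where r: "r > 0" "ball x r \<subseteq> U"
      using U(2) open_contains_ball by blast
    have "{g \<in> carrier G. dist x (act g x) < r} \<subseteq> {g \<in> carrier G. act g ` U \<inter> U \<noteq> {}}"
      using r(2) U(2) by (auto simp: subset_iff)
    then show ?thesis using U(3) r(1) finite_subset by blast
  qed
  define fl where "fl t x = \<Phi> (x, t)" for t x
  interpret proper_flow G act fl ?X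
  proof (intro proper_flow.intro assms(1) proper_flow_axioms.intro)
    show "continuous_on UNIV (\<lambda>p. fl (snd p) (fst p))"
      using \<Phi>c by (simp add: fl_def)
    show "fl (s + t) x = fl s (fl t x)" for s t x
      unfolding fl_def using \<Phi>add[of x t s] by (simp add: add.commute)
    show "\<exists>d>0. \<forall>x y t. \<bar>t\<bar> \<le> a \<longrightarrow> dist x y \<le> d \<longrightarrow> dist (fl t x) (fl t y) \<le> e"
      if ae: "0 < a" "0 < e" for a e
    proof -
      have "\<exists>d>0. \<forall>z z'. \<forall>t\<in>{-a..a}. dist z z' \<le> d \<longrightarrow> dist (\<Phi> (z, t)) (\<Phi> (z', t)) \<le> e"
        using assms(10) ae unfolding flow_uniformly_continuous_def by simp
      then obtain d where d: "d > 0" "\<forall>z z'. \<forall>t\<in>{-a..a}. dist z z' \<le> d \<longrightarrow> dist (\<Phi> (z, t)) (\<Phi> (z', t)) \<le> e"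
        by blast
      have "dist (fl t x) (fl t y) \<le> e" if "\<bar>t\<bar> \<le> a" "dist x y \<le> d" for x y t
      proof -
        have "t \<in> {-a..a}" using that(1) by auto
        then show ?thesis using d(2) that(2) by (simp add: fl_def)
      qed
      then show ?thesis using d(1) by blast
    qed
    show "fl t x \<in> ?X" if "x \<in> ?X" for x t
      using X_fl[OF that] by (simp add: fl_def)
    show "fl t (act g x) = act g (fl t x)" if "g \<in> carrier G" for g t x
      using assms(5)[OF that] by (simp add: fl_def)
    show "fl 0 x = x" for x by (simp add: fl_def \<Phi>0)
  qed (fact act_one act_mult assms(3) X_open X_act X_cball X_proper)+
  obtain n where dim: "covering_dim_le ?X n" using assms(8) by blast
  show ?thesis
  \<comment> \<open>There are \<open>2 * (n + 1)\<close> disjoint families, and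
    \<open>collection_dim_le\<close> allows one member more than its bound.\<close>
  proof (intro exI[of _ "2 * n + 1"] allI impI)
    fix \<alpha> :: real assume \<alpha>: "0 < \<alpha>"
    define \<gamma> where "\<gamma> = 16 * \<alpha> + 10"
    have "\<exists>\<V>. (\<forall>V\<in>\<V>. open V \<and> family_subset G act (virtually_cyclic_subgroups G) V) \<and>
        (\<forall>g\<in>carrier G. \<forall>V\<in>\<V>. act g ` V \<in> \<V>) \<and> collection_dim_le \<V> (2 * n + 1) \<and>
        finite (orbits G \<V> (set_act act)) \<and>
        (\<forall>z\<in>\<Union>g\<in>carrier G. act g ` K. \<exists>V\<in>\<V>. flow_segment \<Phi> \<alpha> z \<subseteq> V)"
      if K: "compact K \<and> K \<subseteq> period_gt G act \<Phi> \<gamma>" for K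
    proof -
      have per: "\<Phi> (z, t) \<noteq> act g z" if "z \<in> K" "0 < t" "t \<le> \<gamma>" "g \<in> carrier G" for z t g
      proof
        assume "\<Phi> (z, t) = act g z"
        then have "G_period G act \<Phi> z \<le> ereal t"
          unfolding G_period_def using that by (intro Inf_lower) blast
        also have "\<dots> \<le> ereal \<gamma>" using that by simp
        finally show False using K that(1) by (auto simp: period_gt_def)
      qed
      have "0 < \<gamma>" using \<alpha> by (simp add: \<gamma>_def)
      \<comment> \<open>A stationary point returns to itself at every time through the neutral
        element, so its period is 0.\<close>
      have "K \<subseteq> ?X"
      proof
        fix z assume "z \<in> K"
        then have "\<Phi> (z, \<gamma>) \<noteq> z" using per[OF _ \<open>0 < \<gamma>\<close> order_refl one_closed] act_one by metis
        then show "z \<in> ?X" by (auto simp: flow_stationary_def)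
      qed
      have "fl t z \<notin> orb z" if "z \<in> K" "0 < t" "t \<le> 16 * \<alpha> + 10" for z t
        using per[OF that(1,2)] that(3) by (auto simp: orb_def fl_def \<gamma>_def)
      then have "\<exists>\<V>. (\<forall>V\<in>\<V>. open V \<and> family_subset G act (virtually_cyclic_subgroups G) V) \<and>
          (\<forall>g\<in>carrier G. \<forall>V\<in>\<V>. act g ` V \<in> \<V>) \<and> collection_dim_le \<V> (2 * n + 1) \<and>
          finite (orbits G \<V> (set_act act)) \<and>
          (\<forall>z\<in>sat K. \<exists>V\<in>\<V>. \<forall>s. \<bar>s\<bar> \<le> \<alpha> \<longrightarrow> fl s z \<in> V)"
        using K by (intro long_thin_cover[OF dim \<alpha> _ \<open>K \<subseteq> ?X\<close>]) blast+
      then obtain \<V> where \<V>: "\<forall>V\<in>\<V>. open V \<and> family_subset G act (virtually_cyclic_subgroups G) V"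
          "\<forall>g\<in>carrier G. \<forall>V\<in>\<V>. act g ` V \<in> \<V>" "collection_dim_le \<V> (2 * n + 1)"
          "finite (orbits G \<V> (set_act act))" "\<forall>z\<in>sat K. \<exists>V\<in>\<V>. \<forall>s. \<bar>s\<bar> \<le> \<alpha> \<longrightarrow> fl s z \<in> V"
        by (elim exE conjE)
      have "\<exists>V\<in>\<V>. flow_segment \<Phi> \<alpha> z \<subseteq> V" if z: "z \<in> (\<Union>g\<in>carrier G. act g ` K)" for z
      proof -
        have "z \<in> sat K" using z by (simp add: sat_def)
        then obtain V where "V \<in> \<V>" "\<forall>s. \<bar>s\<bar> \<le> \<alpha> \<longrightarrow> fl s z \<in> V"
          using \<V>(5) by blast
        then show ?thesis
          by (intro bexI[of _ V]) (auto simp: flow_segment_def fl_def abs_le_iff)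
      qed
      then show ?thesis using \<V>(1-4) by (intro exI[of _ \<V>] conjI ballI) simp_all
    qed
    then show "\<exists>\<gamma>>0. \<forall>K. compact K \<and> K \<subseteq> period_gt G act \<Phi> \<gamma> \<longrightarrow>
        (\<exists>\<V>. (\<forall>V\<in>\<V>. open V \<and> family_subset G act (virtually_cyclic_subgroups G) V) \<and>
          (\<forall>g\<in>carrier G. \<forall>V\<in>\<V>. act g ` V \<in> \<V>) \<and> collection_dim_le \<V> (2 * n + 1) \<and>
          finite (orbits G \<V> (set_act act)) \<and>
          (\<forall>z\<in>\<Union>g\<in>carrier G. act g ` K. \<exists>V\<in>\<V>. flow_segment \<Phi> \<alpha> z \<subseteq> V))"
      using \<alpha> by (intro exI[of _ \<gamma>] conjI allI impI) (simp_all add: \<gamma>_def)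
  qed
qed

end
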